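(* Let $(X_t)_{t\ge0}$ be a (real-valued) Lévy process with characteristic exponent $\psi_X$, let $\alpha(t),\beta(t),\sigma(t)$ be deterministic integrable functions, and let $(\lambda_t)_{t\ge0}$ be a Hull-White process driven by $X$, i.e. the solution of the stochastic differential equation $$d\lambda_t=(\alpha(t)-\beta(t)\lambda_t)\,dt+\sigma(t)\,dX_t ,$$ the coefficients being such that existence and uniqueness of the solution hold. Let $0\le s\le t$, $\Lambda_{s,t}:=\int_s^t\lambda_u\,du$, and set $G(s,t):=e^{-\int_s^t\beta(u)du}$. Then the log-characteristic function of $\Lambda_{s,t}$, conditional upon $\lambda_s$, is $$\psi_{\Lambda_{s,t}}(x)=ix\,M(s,t)+\int_s^t\psi_X\left(x\int_u^t\sigma(u)G(u,v)\,dv\right)du,\qquad x\in\mathbb{R},$$ where $$M(s,t):=(t-s)\lambda_s+\int_s^t(t-u)\Bigl(\alpha(u)-\beta(u)G(s,u)\bigl(\lambda_s+I(s,u)\bigr)\Bigr)du,\qquad I(s,u):=\int_s^u\alpha(r)G(r,s)\,dr .$$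
   Context: All processes live on a filtered probability space $(\Omega,\mathbb{F},\mathcal{F}_t,\mathbb{Q})$, with $X$ a Lévy process for the filtration and $\lambda$ adapted. The characteristic exponent $\psi_X$ satisfies $\mathbb{E}[e^{ixX_t}]=e^{t\psi_X(x)}$ for all $t\ge0$, $x\in\mathbb{R}$. The conditional log-characteristic function is $\psi_{\Lambda_{s,t}}(x)=\ln\mathbb{E}[e^{ix\Lambda_{s,t}}\mid\lambda_s]$, with the continuous branch of the logarithm vanishing at $x=0$. For $r\ge s$, $G(r,s)=e^{-\int_r^s\beta(v)dv}=1/G(s,r)$. The existence and uniqueness assumption includes that the stochastic integrals of the deterministic integrands with respect to $X$ are well defined. *)

theory Defs
  imports "HOL-Probability.Probability"
begin

text \<open>
  Time is \<open>[0, \<infinity>)\<close>. Processes and filtrations are indexed by \<open>real\<close>, and every condition is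
  restricted to nonnegative times; the values at negative indices are irrelevant.
\<close>

definition filtered_prob_space :: "'a measure \<Rightarrow> (real \<Rightarrow> 'a measure) \<Rightarrow> bool" where
  "filtered_prob_space M F \<longleftrightarrow>
     prob_space M \<and>
     (\<forall>t\<ge>0. subalgebra M (F t)) \<and>
     (\<forall>s t. 0 \<le> s \<and> s \<le> t \<longrightarrow> sets (F s) \<subseteq> sets (F t))"

definition adapted :: "(real \<Rightarrow> 'a measure) \<Rightarrow> (real \<Rightarrow> 'a \<Rightarrow> real) \<Rightarrow> bool" where
  "adapted F Y \<longleftrightarrow> (\<forall>t\<ge>0. Y t \<in> borel_measurable (F t))"

definition cadlag :: "(real \<Rightarrow> real) \<Rightarrow> bool" where
  "cadlag f \<longleftrightarrow>
     (\<forall>t\<ge>0. (f \<longlongrightarrow> f t) (at_right t)) \<and>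
     (\<forall>t>0. \<exists>l. (f \<longlongrightarrow> l) (at_left t))"

definition generated :: "'a measure \<Rightarrow> ('a \<Rightarrow> real) \<Rightarrow> 'a measure" where
  "generated M Z = vimage_algebra (space M) Z borel"


section \<open>Levy processes\<close>

definition levy_process ::
  "'a measure \<Rightarrow> (real \<Rightarrow> 'a measure) \<Rightarrow> (real \<Rightarrow> 'a \<Rightarrow> real) \<Rightarrow> bool" where
  "levy_process M F X \<longleftrightarrow>
     adapted F X \<and>
     (AE \<omega> in M. X 0 \<omega> = 0) \<and>
     (\<forall>s t. 0 \<le> s \<and> s \<le> t \<longrightarrow>
        prob_space.indep_set M (sets (F s)) (sets (generated M (\<lambda>\<omega>. X t \<omega> - X s \<omega>)))) \<and>
     (\<forall>s t. 0 \<le> s \<and> s \<le> t \<longrightarrow>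
        distr M borel (\<lambda>\<omega>. X t \<omega> - X s \<omega>) = distr M borel (X (t - s))) \<and>
     (\<forall>s\<ge>0. \<forall>e>0.
        ((\<lambda>t. measure M {\<omega> \<in> space M. \<bar>X t \<omega> - X s \<omega>\<bar> \<ge> e}) \<longlongrightarrow> 0) (at s within {0..})) \<and>
     (AE \<omega> in M. cadlag (\<lambda>t. X t \<omega>))"

definition char_exponent ::
  "'a measure \<Rightarrow> (real \<Rightarrow> 'a \<Rightarrow> real) \<Rightarrow> (real \<Rightarrow> complex) \<Rightarrow> bool" where
  "char_exponent M X \<psi> \<longleftrightarrow>
     (\<forall>t\<ge>0. \<forall>x. char (distr M borel (X t)) x = exp (complex_of_real t * \<psi> x))"


section \<open>Stochastic integrals of deterministic integrands\<close>

text \<open>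
  A list of triples \<open>(c, p, q)\<close> represents the step function that is the sum of the functions
  \<open>c \<cdot> 1\<^bsub>(p, q]\<^esub>\<close>; its integral is the sum of the \<open>c \<cdot> (X q - X p)\<close>. The intervals may overlap:
  the integral depends only on the function represented.
\<close>

type_synonym step = "(real \<times> real \<times> real) list"

definition step_on :: "real \<Rightarrow> real \<Rightarrow> step \<Rightarrow> bool" where
  "step_on a b h \<longleftrightarrow> (\<forall>(c, p, q) \<in> set h. a \<le> p \<and> p \<le> q \<and> q \<le> b)"

definition step_fun :: "step \<Rightarrow> real \<Rightarrow> real" where
  "step_fun h u = (\<Sum>(c, p, q)\<leftarrow>h. c * indicator {p<..q} u)"

definition step_integral :: "(real \<Rightarrow> 'a \<Rightarrow> real) \<Rightarrow> step \<Rightarrow> 'a \<Rightarrow> real" where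
  "step_integral X h \<omega> = (\<Sum>(c, p, q)\<leftarrow>h. c * (X q \<omega> - X p \<omega>))"

definition tendsto_prob :: "'a measure \<Rightarrow> (nat \<Rightarrow> 'a \<Rightarrow> real) \<Rightarrow> ('a \<Rightarrow> real) \<Rightarrow> bool" where
  "tendsto_prob M Y Z \<longleftrightarrow>
     (\<forall>e>0. (\<lambda>n. measure M {\<omega> \<in> space M. \<bar>Y n \<omega> - Z \<omega>\<bar> \<ge> e}) \<longlonglongrightarrow> 0)"

text \<open>
  \<open>has_stoch_integral M X f a b Y\<close>: the deterministic function \<open>f\<close> is \<open>X\<close>-integrable on \<open>[a, b]\<close>,
  and \<open>Y\<close> is a version of its stochastic integral from \<open>a\<close> to \<open>b\<close>. The integral is the limit in
  probability of the integrals of step functions \<open>S n\<close> that converge to \<open>f\<close> almost everywhere.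
  Convergence in probability of these integrals alone would not make the limit independent of the
  sequence (for \<open>X\<^sub>t = t\<close> take \<open>n \<cdot> 1\<^bsub>(0, 1/n]\<^esub>\<close>, which tends to 0). So the
  sequence must be Cauchy for the Daniell mean
  \<open>g \<mapsto> sup {size of the integral of h | h a step function, |h| \<le> |g|}\<close>, where size refers to
  convergence in probability; this is the Emery (semimartingale) topology for deterministic
  integrands. For \<open>X\<^sub>t = t\<close> the definition gives the Lebesgue integral and for Brownian motion the
  Wiener integral on \<open>L\<^sup>2\<close>.
\<close>

definition mean_Cauchy ::
  "'a measure \<Rightarrow> (real \<Rightarrow> 'a \<Rightarrow> real) \<Rightarrow> real \<Rightarrow> real \<Rightarrow> (nat \<Rightarrow> step) \<Rightarrow> bool" where
  "mean_Cauchy M X a b S \<longleftrightarrow>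
     (\<forall>e>0. \<forall>d>0. \<exists>N. \<forall>m\<ge>N. \<forall>n\<ge>N. \<forall>h.
        step_on a b h \<and> (\<forall>u. \<bar>step_fun h u\<bar> \<le> \<bar>step_fun (S m) u - step_fun (S n) u\<bar>) \<longrightarrow>
        measure M {\<omega> \<in> space M. \<bar>step_integral X h \<omega>\<bar> \<ge> e} < d)"

definition has_stoch_integral ::
  "'a measure \<Rightarrow> (real \<Rightarrow> 'a \<Rightarrow> real) \<Rightarrow> (real \<Rightarrow> real) \<Rightarrow> real \<Rightarrow> real \<Rightarrow> ('a \<Rightarrow> real) \<Rightarrow> bool" where
  "has_stoch_integral M X f a b Y \<longleftrightarrow>
     Y \<in> borel_measurable M \<and>
     (\<exists>S. (\<forall>n. step_on a b (S n)) \<and>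
          (AE u in lborel. u \<in> {a..b} \<longrightarrow> (\<lambda>n. step_fun (S n) u) \<longlonglongrightarrow> f u) \<and>
          mean_Cauchy M X a b S \<and>
          tendsto_prob M (\<lambda>n. step_integral X (S n)) Y)"


section \<open>Hull-White processes\<close>

definition locally_integrable :: "(real \<Rightarrow> real) \<Rightarrow> bool" where
  "locally_integrable f \<longleftrightarrow> (\<forall>T\<ge>0. set_integrable lborel {0..T} f)"

text \<open>
  The equation \<open>d\<lambda>\<^sub>t = (\<alpha> t - \<beta> t \<lambda>\<^sub>t) dt + \<sigma> t dX\<^sub>t\<close> in integrated form. The integrability of
  \<open>\<sigma>\<close> with respect to \<open>X\<close> is part of \<^const>\<open>has_stoch_integral\<close>.
\<close>

definition hw_solution ::
  "'a measure \<Rightarrow> (real \<Rightarrow> 'a measure) \<Rightarrow> (real \<Rightarrow> 'a \<Rightarrow> real) \<Rightarrow>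
   (real \<Rightarrow> real) \<Rightarrow> (real \<Rightarrow> real) \<Rightarrow> (real \<Rightarrow> real) \<Rightarrow> (real \<Rightarrow> 'a \<Rightarrow> real) \<Rightarrow> bool" where
  "hw_solution M F X \<alpha> \<beta> \<sigma> lam \<longleftrightarrow>
     adapted F lam \<and>
     (\<forall>\<omega>\<in>space M. cadlag (\<lambda>t. lam t \<omega>)) \<and>
     (\<forall>t\<ge>0. has_stoch_integral M X \<sigma> 0 t
        (\<lambda>\<omega>. lam t \<omega> - lam 0 \<omega> - (LBINT u=0..t. \<alpha> u - \<beta> u * lam u \<omega>)))"

definition hull_white_process ::
  "'a measure \<Rightarrow> (real \<Rightarrow> 'a measure) \<Rightarrow> (real \<Rightarrow> 'a \<Rightarrow> real) \<Rightarrow>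
   (real \<Rightarrow> real) \<Rightarrow> (real \<Rightarrow> real) \<Rightarrow> (real \<Rightarrow> real) \<Rightarrow> (real \<Rightarrow> 'a \<Rightarrow> real) \<Rightarrow> bool" where
  "hull_white_process M F X \<alpha> \<beta> \<sigma> lam \<longleftrightarrow>
     hw_solution M F X \<alpha> \<beta> \<sigma> lam \<and>
     (\<forall>lam'. hw_solution M F X \<alpha> \<beta> \<sigma> lam' \<and> (AE \<omega> in M. lam' 0 \<omega> = lam 0 \<omega>) \<longrightarrow>
        (AE \<omega> in M. \<forall>t\<ge>0. lam' t \<omega> = lam t \<omega>))"

text \<open>
  The interval integral is oriented, so \<open>hw_G \<beta> r s\<close> is \<open>1 / hw_G \<beta> s r\<close> also for \<open>r \<ge> s\<close>.
\<close>

definition hw_G :: "(real \<Rightarrow> real) \<Rightarrow> real \<Rightarrow> real \<Rightarrow> real" where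
  "hw_G \<beta> s t = exp (- (LBINT u=s..t. \<beta> u))"

definition hw_I :: "(real \<Rightarrow> real) \<Rightarrow> (real \<Rightarrow> real) \<Rightarrow> real \<Rightarrow> real \<Rightarrow> real" where
  "hw_I \<alpha> \<beta> s u = (LBINT r=s..u. \<alpha> r * hw_G \<beta> r s)"

text \<open>The argument \<open>l\<close> stands for the value of \<open>\<lambda>\<^sub>s\<close>.\<close>

definition hw_M :: "(real \<Rightarrow> real) \<Rightarrow> (real \<Rightarrow> real) \<Rightarrow> real \<Rightarrow> real \<Rightarrow> real \<Rightarrow> real" where
  "hw_M \<alpha> \<beta> s t l =
     (t - s) * l +
     (LBINT u=s..t. (t - u) * (\<alpha> u - \<beta> u * hw_G \<beta> s u * (l + hw_I \<alpha> \<beta> s u)))"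

definition hw_Lambda :: "(real \<Rightarrow> 'a \<Rightarrow> real) \<Rightarrow> real \<Rightarrow> real \<Rightarrow> 'a \<Rightarrow> real" where
  "hw_Lambda lam s t \<omega> = (LBINT u=s..t. lam u \<omega>)"


section \<open>Conditional log-characteristic functions\<close>

definition complex_cond_exp :: "'a measure \<Rightarrow> 'a measure \<Rightarrow> ('a \<Rightarrow> complex) \<Rightarrow> 'a \<Rightarrow> complex" where
  "complex_cond_exp M N f \<omega> =
     Complex (real_cond_exp M N (\<lambda>\<omega>. Re (f \<omega>)) \<omega>) (real_cond_exp M N (\<lambda>\<omega>. Im (f \<omega>)) \<omega>)"

text \<open>
  \<open>cond_log_char M Y Z \<Psi>\<close>: \<open>\<Psi> x = ln E[exp (i x Y) | Z]\<close> for the branch of the logarithm that is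
  continuous in \<open>x\<close> and vanishes at \<open>x = 0\<close>. Conditional expectations are only defined almost
  surely, hence a predicate. It determines \<open>\<Psi>\<close> up to one null set common to all \<open>x\<close>: two such
  \<open>\<Psi>\<close> have equal exponentials at all rational \<open>x\<close> outside a null set, and hence, by continuity, at
  all \<open>x\<close>, and continuous logarithms of the same function that agree at 0 are equal.
\<close>

definition cond_log_char ::
  "'a measure \<Rightarrow> ('a \<Rightarrow> real) \<Rightarrow> ('a \<Rightarrow> real) \<Rightarrow> (real \<Rightarrow> 'a \<Rightarrow> complex) \<Rightarrow> bool" where
  "cond_log_char M Y Z \<Psi> \<longleftrightarrow>
     (\<forall>x. \<Psi> x \<in> borel_measurable (generated M Z)) \<and>
     (AE \<omega> in M. continuous_on UNIV (\<lambda>x. \<Psi> x \<omega>) \<and> \<Psi> 0 \<omega> = 0) \<and>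
     (\<forall>x. AE \<omega> in M.
        exp (\<Psi> x \<omega>) = complex_cond_exp M (generated M Z) (\<lambda>\<omega>. iexp (x * Y \<omega>)) \<omega>)"

end

theory Submission
  imports Defs
begin

text \<open>
  Let \<open>H u = \<integral>\<^sub>u\<^sup>t G(u, v) dv\<close> and \<open>Z u = \<integral>\<^sub>0\<^sup>u \<sigma> dX\<close>. Path by path, the equation is a linear Volterra
  equation driven by \<open>Z\<close>, and integration by parts gives
  \<open>\<Lambda> - M(s, t) = \<integral>\<^sub>s\<^sup>t (Z u - Z s) (1 - \<beta> u H u) du\<close>. Since \<open>H' = \<beta> H - 1\<close> and \<open>H t = 0\<close>, this is
  the limit of the sums \<open>\<Sum> H(u\<^sub>k) (Z(u\<^sub>k\<^sub>+\<^sub>1) - Z(u\<^sub>k))\<close>, which are stochastic integrals of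
  \<open>H\<^sub>n \<sigma>\<close> for step functions \<open>H\<^sub>n\<close> that tend to \<open>H\<close>.

  For a step function \<open>h\<close> on \<open>[s, t]\<close>, independence and stationarity of the increments give
  \<open>E (W exp (i \<integral>h dX)) = E W \<cdot> exp (\<integral>\<psi>(h u) du)\<close> for \<open>F\<^sub>s\<close>-measurable \<open>W\<close>. To extend this to
  limits, let \<open>\<psi>\<^sup>* y = sup {\<bar>\<psi>(\<theta> y)\<bar> | \<bar>\<theta>\<bar> \<le> 1}\<close>. It satisfies
  \<open>\<psi>\<^sup>*(y + z) \<le> 2 \<psi>\<^sup>* y + 2 \<psi>\<^sup>* z\<close>, and sequences that are Cauchy for the Daniell mean are Cauchy
  for \<open>f \<mapsto> \<integral>\<psi>\<^sup>*(f u) du\<close>. Hence \<open>\<psi>\<^sup>*(\<sigma>)\<close> is integrable; it dominates \<open>\<psi>(x H\<^sub>n \<sigma>)\<close> up to a constant.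
\<close>


section \<open>Primitives of integrable functions\<close>

text \<open>The coefficients are merely integrable, so the calculus behind the pathwise formula is
  done with \<open>primitive_on\<close>, that is, with absolutely continuous functions represented
  by their integrals. A cadlag noise path need not have bounded variation; summation by parts
  therefore puts every difference on \<open>H\<close>. The equation supplies stochastic integrals of
  \<open>\<sigma>\<close> from 0 to each time, and says nothing about \<open>H \<sigma>\<close> or
  about integrability of \<psi> along it. This forces the approximation by step multiples of
  \<open>\<sigma>\<close>, which are reached by linearity. It also explains the maximal function:
  \<bar>\<psi>\<bar> need not be monotone in \<bar>y\<bar>, whereas its maximal version is, so
  smallness survives domination, sums and scaling. A further obstacle is the time \<open>s\<close>:
  step functions that approximate an integrand vanishing up to \<open>s\<close> may themselves be
  nonzero before \<open>s\<close>, where their integrals can depend on \<open>F s\<close>. They are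
  cut at \<open>s\<close>, and the early part is shown to be negligible. Conditioning is then
  carried by a bounded \<open>F s\<close>-measurable factor \<open>W\<close>, into which both the
  test event and the factor with \<open>M(s, t)\<close> are absorbed.\<close>

definition primitive_on :: "real \<Rightarrow> real \<Rightarrow> (real \<Rightarrow> real) \<Rightarrow> (real \<Rightarrow> real) \<Rightarrow> bool" where
  "primitive_on a b F f \<longleftrightarrow>
     set_integrable lborel {a..b} f \<and> (\<forall>u\<in>{a..b}. F u = F a + (LBINT v:{a..u}. f v))"

text \<open>Fubini for the product \<open>f v * k w\<close>, with the plane split along the diagonal
  into \<open>w \<le> v\<close> and \<open>v < w\<close>. This is integration by parts in integrated
  form, and \<open>primitive_on_mult\<close> rests on it.\<close>

lemma integral_times_integral_triangle:
  fixes f k :: "real \<Rightarrow> real"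
  assumes f: "integrable lborel f" and k: "integrable lborel k"
  shows "(LBINT v. f v) * (LBINT v. k v) =
    (LBINT v. f v * (LBINT w:{..v}. k w)) + (LBINT w. k w * (LBINT v:{..w}. f v))"
    and "integrable lborel (\<lambda>v. f v * (LBINT w:{..v}. k w))"
proof -
  have [measurable]: "f \<in> borel_measurable borel" "k \<in> borel_measurable borel"
    using f k by auto
  define P where "P = (\<lambda>(v, w). f v * k w)"
  define P1 where "P1 = (\<lambda>(v, w). f v * (indicator {..v} w * k w))"
  define P2 where "P2 = (\<lambda>(v, w). k w * (indicator {v<..} w * f v))"
  have [measurable]: "P \<in> borel_measurable (borel \<Otimes>\<^sub>M borel)"
    unfolding P_def by measurable
  have "Measurable.pred (borel \<Otimes>\<^sub>M borel) (\<lambda>p :: real \<times> real. snd p \<le> fst p)"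
    by measurable
  then have P1m: "P1 \<in> borel_measurable (borel \<Otimes>\<^sub>M borel)"
    unfolding P1_def indicator_def by (auto simp: split_def)
  have P2m: "P2 \<in> borel_measurable (borel \<Otimes>\<^sub>M borel)"
    unfolding P2_def indicator_def by (auto simp: split_def)
  have P: "integrable (lborel \<Otimes>\<^sub>M lborel) P"
  proof (rule lborel_pair.Fubini_integrable)
    show "P \<in> borel_measurable (lborel \<Otimes>\<^sub>M lborel)" by (simp add: cong: measurable_cong_sets)
    show "integrable lborel (\<lambda>x. LBINT y. norm (P (x, y)))"
      using f k unfolding P_def by (simp add: abs_mult)
    show "AE x in lborel. integrable lborel (\<lambda>y. P (x, y))"
      using k unfolding P_def by simp
  qed
  have P1: "integrable (lborel \<Otimes>\<^sub>M lborel) P1"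
    by (rule Bochner_Integration.integrable_bound[OF P])
      (use P1m in \<open>auto simp: P_def P1_def indicator_def cong: measurable_cong_sets\<close>)
  have P2: "integrable (lborel \<Otimes>\<^sub>M lborel) P2"
    by (rule Bochner_Integration.integrable_bound[OF P])
      (use P2m in \<open>auto simp: P_def P2_def indicator_def abs_mult split_def cong: measurable_cong_sets\<close>)
  have "(LBINT v. f v) * (LBINT v. k v) = (LBINT v. LBINT w. P (v, w))"
    unfolding P_def by simp
  also have "\<dots> = (\<integral>p. P p \<partial>(lborel \<Otimes>\<^sub>M lborel))"
    by (rule lborel_pair.integral_fst'[OF P])
  also have "\<dots> = (\<integral>p. P1 p + P2 p \<partial>(lborel \<Otimes>\<^sub>M lborel))"
    by (rule Bochner_Integration.integral_cong) (auto simp: P_def P1_def P2_def indicator_def)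
  also have "\<dots> = (\<integral>p. P1 p \<partial>(lborel \<Otimes>\<^sub>M lborel)) + (\<integral>p. P2 p \<partial>(lborel \<Otimes>\<^sub>M lborel))"
    using P1 P2 by simp
  also have "(\<integral>p. P1 p \<partial>(lborel \<Otimes>\<^sub>M lborel)) = (LBINT v. LBINT w. P1 (v, w))"
    by (rule lborel_pair.integral_fst'[OF P1, symmetric])
  also have "\<dots> = (LBINT v. f v * (LBINT w:{..v}. k w))"
    unfolding P1_def set_lebesgue_integral_def by simp
  also have "(\<integral>p. P2 p \<partial>(lborel \<Otimes>\<^sub>M lborel)) = (LBINT w. LBINT v. P2 (v, w))"
    using lborel_pair.integral_snd[of "\<lambda>v w. P2 (v, w)"] P2 by simp
  also have "\<dots> = (LBINT w. k w * (LBINT v:{..w}. f v))"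
  proof (rule Bochner_Integration.integral_cong[OF refl])
    fix w
    have "(LBINT v. P2 (v, w)) = k w * (LBINT v. indicator {v<..} w * f v)"
      unfolding P2_def by simp
    \<comment> \<open>The strict and the weak inequality differ only at the null point
      \<open>v = w\<close>; closing the interval here makes the two halves symmetric.\<close>
    also have "(LBINT v. indicator {v<..} w * f v) = (LBINT v. indicator {..w} v * f v)"
      using AE_lborel_singleton[of w]
      by (intro integral_cong_AE) (auto simp: indicator_def)
    finally show "(LBINT v. P2 (v, w)) = k w * (LBINT v:{..w}. f v)"
      unfolding set_lebesgue_integral_def by simp
  qed
  finally show "(LBINT v. f v) * (LBINT v. k v) =
    (LBINT v. f v * (LBINT w:{..v}. k w)) + (LBINT w. k w * (LBINT v:{..w}. f v))" .
  have "integrable lborel (\<lambda>v. LBINT w. P1 (v, w))"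
    using lborel_pair.integrable_fst'[OF P1] .
  then show "integrable lborel (\<lambda>v. f v * (LBINT w:{..v}. k w))"
    unfolding P1_def set_lebesgue_integral_def by simp
qed

lemma set_integrable_mult_bounded:
  fixes f g :: "real \<Rightarrow> real"
  assumes f: "set_integrable lborel S f"
    and g: "set_borel_measurable lborel S g" and S: "S \<in> sets borel"
    and bd: "\<And>u. u \<in> S \<Longrightarrow> \<bar>g u\<bar> \<le> C"
  shows "set_integrable lborel S (\<lambda>u. f u * g u)"
proof -
  have "integrable lborel (\<lambda>u. C * \<bar>indicator S u * f u\<bar>)"
    using f unfolding set_integrable_def by (intro integrable_mult_right integrable_abs) simp
  then show ?thesis
    unfolding set_integrable_def
  proof (rule Bochner_Integration.integrable_bound)
    have "(\<lambda>u. indicator S u *\<^sub>R f u) \<in> borel_measurable lborel"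
      using f unfolding set_integrable_def by (rule borel_measurable_integrable)
    then have "(\<lambda>u. (indicator S u *\<^sub>R f u) * (indicator S u *\<^sub>R g u)) \<in> borel_measurable lborel"
      using g unfolding set_borel_measurable_def by (rule borel_measurable_times)
    then show "(\<lambda>u. indicator S u *\<^sub>R (f u * g u)) \<in> borel_measurable lborel"
      by (rule measurable_cong[THEN iffD1, rotated]) (auto simp: indicator_def)
    have "\<bar>f u\<bar> * \<bar>g u\<bar> \<le> C * \<bar>f u\<bar>" if "u \<in> S" for u
      using mult_right_mono[OF bd[OF that], of "\<bar>f u\<bar>"] by (simp add: mult.commute)
    then have "norm (indicator S u *\<^sub>R (f u * g u)) \<le> norm (C * \<bar>indicator S u * f u\<bar>)" for u
      using bd[of u] by (auto simp: indicator_def abs_mult)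
    then show "AE u in lborel. norm (indicator S u *\<^sub>R (f u * g u)) \<le> norm (C * \<bar>indicator S u * f u\<bar>)"
      by simp
  qed
qed

lemma set_integrable_mult_continuous:
  fixes f g :: "real \<Rightarrow> real"
  assumes f: "set_integrable lborel {a..b} f" and g: "continuous_on {a..b} g"
  shows "set_integrable lborel {a..b} (\<lambda>u. f u * g u)"
proof -
  have "bounded (g ` {a..b})"
    by (intro compact_imp_bounded compact_continuous_image g compact_Icc)
  then obtain C where "\<forall>x\<in>g ` {a..b}. norm x \<le> C"
    unfolding bounded_iff by auto
  then show ?thesis
    by (intro set_integrable_mult_bounded[where C = C] f)
      (use borel_measurable_continuous_on_indicator[OF _ g] in
        \<open>auto simp: set_borel_measurable_def\<close>)
qed

lemma primitive_on_integrable: "primitive_on a b F f \<Longrightarrow> set_integrable lborel {a..b} f"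
  unfolding primitive_on_def by simp

lemma primitive_onD: "primitive_on a b F f \<Longrightarrow> u \<in> {a..b} \<Longrightarrow> F u = F a + (LBINT v:{a..u}. f v)"
  unfolding primitive_on_def by blast

lemma primitive_on_continuous:
  assumes "primitive_on a b F f" shows "continuous_on {a..b} F"
proof -
  have f: "set_integrable lborel {a..b} f" using assms primitive_on_integrable by simp
  have "continuous_on {a..b} (\<lambda>u. F a + integral {a..u} f)"
    by (intro continuous_intros indefinite_integral_continuous_1 set_borel_integral_eq_integral f)
  moreover have "F u = F a + integral {a..u} f" if "u \<in> {a..b}" for u
  proof -
    have "set_integrable lborel {a..u} f"
      by (rule set_integrable_subset[OF f]) (use that in auto)
    then show ?thesis
      using primitive_onD[OF assms that] by (simp only: set_borel_integral_eq_integral(2))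
  qed
  ultimately show ?thesis by (metis (no_types, lifting) continuous_on_cong)
qed

lemma primitive_on_linear:
  assumes "primitive_on a b F f" "primitive_on a b K k"
  shows "primitive_on a b (\<lambda>u. c * F u + d * K u) (\<lambda>u. c * f u + d * k u)"
  unfolding primitive_on_def
proof (intro conjI ballI)
  show "set_integrable lborel {a..b} (\<lambda>u. c * f u + d * k u)"
    using assms by (auto simp: primitive_on_def)
  fix u assume u: "u \<in> {a..b}"
  have "set_integrable lborel {a..u} f" "set_integrable lborel {a..u} k"
    using assms[THEN primitive_on_integrable] u by (auto elim: set_integrable_subset)
  then have "(LBINT v:{a..u}. c * f v + d * k v) = c * (LBINT v:{a..u}. f v) + d * (LBINT v:{a..u}. k v)"
    by simp
  then show "c * F u + d * K u = c * F a + d * K a + (LBINT v:{a..u}. c * f v + d * k v)"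
    unfolding assms[THEN primitive_onD, OF u] by (simp only: algebra_simps)
qed

lemma primitive_on_cong:
  assumes "primitive_on a b F f" "\<And>u. u \<in> {a..b} \<Longrightarrow> f u = g u" "\<And>u. u \<in> {a..b} \<Longrightarrow> F u = H u"
  shows "primitive_on a b H g"
proof -
  have "set_integrable lborel {a..b} g"
    using primitive_on_integrable[OF assms(1)] assms(2)
    by (simp only: set_integrable_cong[OF refl refl, of "{a..b}" f g])
  moreover have "H u = H a + (LBINT v:{a..u}. g v)" if u: "u \<in> {a..b}" for u
  proof -
    have "(LBINT v:{a..u}. f v) = (LBINT v:{a..u}. g v)"
      using assms(2) u by (intro set_lebesgue_integral_cong) auto
    moreover have "F u = H u" "F a = H a"
      using assms(3) u by auto
    ultimately show ?thesis
      using primitive_onD[OF assms(1) u] by (simp only:)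
  qed
  ultimately show ?thesis
    unfolding primitive_on_def by blast
qed

lemma affine_mult_expand:
  fixes A B :: real
  shows "(A + x) * (B + y) = A * B + (B * x + A * y + x * y)"
  by (simp add: algebra_simps)

text \<open>Product rule. Both primitives are written as initial value plus integral of a density
  cut off to \<open>{a..u}\<close>; the constants give the linear terms, and the product of the two
  increments is the triangle identity.\<close>

lemma primitive_on_mult:
  assumes F: "primitive_on a b F f" and K: "primitive_on a b K k"
  shows "primitive_on a b (\<lambda>u. F u * K u) (\<lambda>u. f u * K u + k u * F u)"
  unfolding primitive_on_def
proof (intro conjI ballI)
  note cont = primitive_on_continuous[OF F] primitive_on_continuous[OF K]
  note int = primitive_on_integrable[OF F] primitive_on_integrable[OF K]
  show "set_integrable lborel {a..b} (\<lambda>u. f u * K u + k u * F u)"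
    using set_integrable_mult_continuous[OF int(1) cont(2)]
      set_integrable_mult_continuous[OF int(2) cont(1)] by simp
  fix u assume u: "u \<in> {a..b}"
  have int': "set_integrable lborel {a..u} f" "set_integrable lborel {a..u} k"
    using int u by (auto elim: set_integrable_subset)
  define g where "g = (\<lambda>v. indicator {a..u} v * f v)"
  define h where "h = (\<lambda>v. indicator {a..u} v * k v)"
  have gh: "integrable lborel g" "integrable lborel h"
    using int' unfolding set_integrable_def g_def h_def by auto
  have ghI: "(LBINT v. g v) = (LBINT v:{a..u}. f v)" "(LBINT v. h v) = (LBINT v:{a..u}. k v)"
    unfolding set_lebesgue_integral_def g_def h_def by auto
  have tri: "(LBINT w:{..v}. indicator {a..u} w * q w) = (LBINT w:{a..v}. q w)"
    if "v \<in> {a..u}" for v and q :: "real \<Rightarrow> real"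
    unfolding set_lebesgue_integral_def
    using that by (intro Bochner_Integration.integral_cong) (auto simp: indicator_def)
  have FK: "F v = F a + (LBINT w:{..v}. g w)" "K v = K a + (LBINT w:{..v}. h w)" if "v \<in> {a..u}" for v
    using primitive_onD[OF F] primitive_onD[OF K] that u unfolding g_def h_def tri[OF that]
    by (meson atLeastAtMost_iff order_trans)+
  have "(LBINT v:{a..u}. f v * K v + k v * F v) =
    (LBINT v. (K a * g v + F a * h v) + (g v * (LBINT w:{..v}. h w) + h v * (LBINT w:{..v}. g w)))"
    unfolding set_lebesgue_integral_def[of lborel "{a..u}"]
  proof (rule Bochner_Integration.integral_cong[OF refl])
    fix v
    show "indicator {a..u} v *\<^sub>R (f v * K v + k v * F v) =
      (K a * g v + F a * h v) + (g v * (LBINT w:{..v}. h w) + h v * (LBINT w:{..v}. g w))"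
    proof (cases "v \<in> {a..u}")
      case True
      have "f v = g v" "k v = h v" using True by (auto simp: g_def h_def)
      then show ?thesis unfolding FK[OF True] using True by (simp add: algebra_simps)
    qed (simp add: g_def h_def)
  qed
  also have "\<dots> = (LBINT v. K a * g v + F a * h v) +
      (LBINT v. g v * (LBINT w:{..v}. h w) + h v * (LBINT w:{..v}. g w))"
    by (intro Bochner_Integration.integral_add Bochner_Integration.integrable_add
        integrable_mult_right gh integral_times_integral_triangle(2)[OF gh]
        integral_times_integral_triangle(2)[OF gh(2,1)])
  also have "(LBINT v. g v * (LBINT w:{..v}. h w) + h v * (LBINT w:{..v}. g w)) =
      (LBINT v. g v) * (LBINT v. h v)"
    unfolding integral_times_integral_triangle(1)[OF gh]
    by (intro Bochner_Integration.integral_add integral_times_integral_triangle(2)[OF gh]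
        integral_times_integral_triangle(2)[OF gh(2,1)])
  also have "(LBINT v. K a * g v + F a * h v) = K a * (LBINT v. g v) + F a * (LBINT v. h v)"
    using gh by simp
  finally have "(LBINT v:{a..u}. f v * K v + k v * F v) =
    K a * (LBINT v. g v) + F a * (LBINT v. h v) + (LBINT v. g v) * (LBINT v. h v)" .
  moreover have "F u = F a + (LBINT v. g v)"
    using primitive_onD[OF F u] unfolding ghI .
  moreover have "K u = K a + (LBINT v. h v)"
    using primitive_onD[OF K u] unfolding ghI .
  ultimately show "F u * K u = F a * K a + (LBINT v:{a..u}. f v * K v + k v * F v)"
    by (simp only: affine_mult_expand)
qed


section \<open>The pathwise solution of the Hull-White equation\<close>

lemma set_integral_singleton: "(LBINT v:{a}. f v) = (0::real)" for a :: real and f :: "real \<Rightarrow> real"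
  using interval_integral_Icc[of a a f] by simp

lemma primitive_on_indefinite:
  assumes "set_integrable lborel {a..b} f"
  shows "primitive_on a b (\<lambda>u. c + (LBINT v:{a..u}. f v)) f"
  using assms by (simp add: primitive_on_def set_integral_singleton)

lemma primitive_on_const: "primitive_on a b (\<lambda>u. c) (\<lambda>u. 0)"
  by (simp add: primitive_on_def set_lebesgue_integral_def set_integrable_def)

lemma primitive_on_diff_right: "primitive_on a b (\<lambda>u. c - u) (\<lambda>u. -1)"
proof -
  have "set_integrable lborel {a..b} (\<lambda>u. -1 :: real)"
    by (intro borel_integrable_atLeastAtMost') auto
  then have "primitive_on a b (\<lambda>u. (c - a) + (LBINT v:{a..u}. -1)) (\<lambda>u. -1)"
    by (rule primitive_on_indefinite)
  then show ?thesis
    by (rule primitive_on_cong) (auto simp: set_lebesgue_integral_def)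
qed

lemma primitive_on_power:
  assumes "primitive_on a b B \<beta>"
  shows "primitive_on a b (\<lambda>u. B u ^ Suc n) (\<lambda>u. real (Suc n) * (\<beta> u * B u ^ n))"
proof (induction n)
  case 0 show ?case using assms by simp
next
  case (Suc n)
  show ?case
    by (rule primitive_on_cong[OF primitive_on_mult[OF assms Suc]]) (auto simp: algebra_simps)
qed

text \<open>The chain rule for \<open>exp\<close> comes from the product rule alone: powers of
  \<open>B\<close> by induction, hence the partial sums \<open>p\<close> of the exponential series,
  whose derivative lowers the index by one. Dominated convergence with bound
  \<open>\<bar>\<beta>\<bar> * exp \<bar>B\<bar>\<close> passes to the limit.\<close>

lemma primitive_on_exp:
  assumes B: "primitive_on a b B \<beta>"
  shows "primitive_on a b (\<lambda>u. exp (B u)) (\<lambda>u. \<beta> u * exp (B u))"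
proof -
  define p where "p = (\<lambda>N x. \<Sum>n<N. x ^ n / fact n :: real)"
  have prim: "primitive_on a b (\<lambda>u. p (Suc N) (B u)) (\<lambda>u. \<beta> u * p N (B u))" for N
  proof (induction N)
    case 0
    show ?case by (rule primitive_on_cong[OF primitive_on_const[of a b 1]]) (auto simp: p_def)
  next
    case (Suc N)
    show ?case
    proof (rule primitive_on_cong[OF primitive_on_linear[where c = 1 and d = "1 / fact (Suc N)",
            OF Suc primitive_on_power[OF B, of N]]])
      fix u
      have "1 / fact (Suc N) * (real (Suc N) * (\<beta> u * B u ^ N)) = \<beta> u * (B u ^ N / fact N)"
        by (simp add: field_simps del: of_nat_Suc)
      then show "1 * (\<beta> u * p N (B u)) + 1 / fact (Suc N) * (real (Suc N) * (\<beta> u * B u ^ N)) =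
          \<beta> u * p (Suc N) (B u)"
        by (simp add: p_def distrib_left)
      show "1 * p (Suc N) (B u) + 1 / fact (Suc N) * B u ^ Suc N = p (Suc (Suc N)) (B u)"
        by (simp add: p_def)
    qed
  qed
  have plim: "(\<lambda>N. p N x) \<longlonglongrightarrow> exp x" for x
    using exp_converges[of x] unfolding sums_def p_def by (simp add: divide_inverse mult.commute)
  have pbound: "\<bar>p N x\<bar> \<le> exp \<bar>x\<bar>" for N x
  proof -
    have "\<bar>p N x\<bar> \<le> p N \<bar>x\<bar>"
      unfolding p_def by (rule order_trans[OF sum_abs]) (simp add: power_abs)
    also have "\<dots> \<le> exp \<bar>x\<bar>"
      using incseq_le[OF _ plim[of "\<bar>x\<bar>"], of N] by (auto simp: incseq_Suc_iff p_def)
    finally show ?thesis .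
  qed
  have cont: "continuous_on {a..b} B" using primitive_on_continuous[OF B] .
  show ?thesis
    unfolding primitive_on_def
  proof (intro conjI ballI)
    show "set_integrable lborel {a..b} (\<lambda>u. \<beta> u * exp (B u))"
      by (intro set_integrable_mult_continuous primitive_on_integrable[OF B] continuous_intros cont)
    fix u assume u: "u \<in> {a..b}"
    have int: "set_integrable lborel {a..u} \<beta>"
      using primitive_on_integrable[OF B] by (rule set_integrable_subset) (use u in auto)
    have cont': "continuous_on {a..u} B" by (rule continuous_on_subset[OF cont]) (use u in auto)
    have "(\<lambda>N. LBINT v:{a..u}. \<beta> v * p N (B v)) \<longlonglongrightarrow> (LBINT v:{a..u}. \<beta> v * exp (B v))"
      unfolding set_lebesgue_integral_def
    proof (rule integral_dominated_convergence[where w = "\<lambda>v. \<bar>indicator {a..u} v *\<^sub>R (\<beta> v * exp \<bar>B v\<bar>)\<bar>"])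
      have pc: "continuous_on {a..u} (\<lambda>v. p N (B v))" for N
        unfolding p_def by (intro continuous_intros cont') auto
      show "(\<lambda>v. indicator {a..u} v *\<^sub>R (\<beta> v * p N (B v))) \<in> borel_measurable lborel" for N
        using set_integrable_mult_continuous[OF int pc] unfolding set_integrable_def
        by (rule borel_measurable_integrable)
      show "(\<lambda>v. indicator {a..u} v *\<^sub>R (\<beta> v * exp (B v))) \<in> borel_measurable lborel"
        using set_integrable_mult_continuous[OF int continuous_on_exp[OF cont']] unfolding set_integrable_def
        by (rule borel_measurable_integrable)
      have "set_integrable lborel {a..u} (\<lambda>v. \<beta> v * exp \<bar>B v\<bar>)"
        by (intro set_integrable_mult_continuous int continuous_intros cont')
      then show "integrable lborel (\<lambda>v. \<bar>indicator {a..u} v *\<^sub>R (\<beta> v * exp \<bar>B v\<bar>)\<bar>)"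
        unfolding set_integrable_def by (rule integrable_abs)
      show "AE v in lborel. (\<lambda>N. indicator {a..u} v *\<^sub>R (\<beta> v * p N (B v))) \<longlonglongrightarrow>
          indicator {a..u} v *\<^sub>R (\<beta> v * exp (B v))"
        by (intro AE_I2 tendsto_intros plim)
      show "AE v in lborel. norm (indicator {a..u} v *\<^sub>R (\<beta> v * p N (B v))) \<le>
          \<bar>indicator {a..u} v *\<^sub>R (\<beta> v * exp \<bar>B v\<bar>)\<bar>" for N
        using pbound by (intro AE_I2) (auto simp: abs_mult indicator_def intro!: mult_left_mono)
    qed
    moreover have "(LBINT v:{a..u}. \<beta> v * p N (B v)) = p (Suc N) (B u) - p (Suc N) (B a)" for N
      using primitive_onD[OF prim u, of N] by (simp only: add_diff_cancel_left')
    ultimately have "(\<lambda>N. p (Suc N) (B u) - p (Suc N) (B a)) \<longlonglongrightarrow> (LBINT v:{a..u}. \<beta> v * exp (B v))"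
      by (simp only:)
    moreover have "(\<lambda>N. p (Suc N) (B u) - p (Suc N) (B a)) \<longlonglongrightarrow> exp (B u) - exp (B a)"
      by (intro tendsto_diff LIMSEQ_Suc plim)
    ultimately have "(LBINT v:{a..u}. \<beta> v * exp (B v)) = exp (B u) - exp (B a)"
      using LIMSEQ_unique by blast
    then show "exp (B u) = exp (B a) + (LBINT v:{a..u}. \<beta> v * exp (B v))" by linarith
  qed
qed

lemma primitive_on_end:
  assumes "primitive_on a b F f" "a \<le> b"
  shows "(LBINT v:{a..b}. f v) = F b - F a"
  using primitive_onD[OF assms(1), of b] assms(2) by auto

lemma primitive_on_diff:
  assumes F: "primitive_on a b F f" and "a \<le> u" "u \<le> v" "v \<le> b"
  shows "F v - F u = (LBINT w:{u<..v}. f w)"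
proof -
  have int: "set_integrable lborel {a..u} f" "set_integrable lborel {u<..v} f"
    by (rule set_integrable_subset[OF primitive_on_integrable[OF F]]; use assms in auto)+
  have "{a..v} = {a..u} \<union> {u<..v}" "{a..u} \<inter> {u<..v} = {}" using assms by auto
  then have "(LBINT w:{a..v}. f w) = (LBINT w:{a..u}. f w) + (LBINT w:{u<..v}. f w)"
    using set_integral_Un[OF _ int] by (simp only:)
  then show ?thesis
    using primitive_onD[OF F, of u] primitive_onD[OF F, of v] assms by auto
qed

text \<open>Both orientations of \<open>hw_G\<close> are expressed through one primitive
  \<open>B\<close> started at \<open>s\<close>, so that \<open>G\<close> separates into a factor in
  \<open>u\<close> and a factor in \<open>v\<close>.\<close>

lemma hw_G_eq:
  assumes "set_integrable lborel {s..t} \<beta>" and B: "\<And>u. B u = (LBINT v:{s..u}. \<beta> v)"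
    and uv: "s \<le> u" "u \<le> v" "v \<le> t"
  shows "hw_G \<beta> u v = exp (B u - B v)" "hw_G \<beta> v u = exp (B v - B u)"
proof -
  have *: "(LBINT w:{u..v}. \<beta> w) = B v - B u"
  proof -
    have int: "set_integrable lborel {s..v} \<beta>" "set_integrable lborel {s..u} \<beta>" "set_integrable lborel {u..v} \<beta>"
      by (rule set_integrable_subset[OF assms(1)]; use uv in auto)+
    have "integral {s..u} \<beta> + integral {u..v} \<beta> = integral {s..v} \<beta>"
      using uv by (intro Henstock_Kurzweil_Integration.integral_combine set_borel_integral_eq_integral(1) int) auto
    then show ?thesis
      unfolding B set_borel_integral_eq_integral(2)[OF int(1)] set_borel_integral_eq_integral(2)[OF int(2)]
        set_borel_integral_eq_integral(2)[OF int(3)] by linarith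
  qed
  show "hw_G \<beta> u v = exp (B u - B v)"
    unfolding hw_G_def interval_integral_Icc[OF uv(2)] * by simp
  show "hw_G \<beta> v u = exp (B v - B u)"
    unfolding hw_G_def interval_integral_endpoints_reverse[of v u] interval_integral_Icc[OF uv(2)] * by simp
qed

text \<open>Since \<open>G(u, v) = exp (B u) * exp (- B v)\<close>, the integral is
  \<open>exp (B u) * (K t - K u)\<close> for a primitive \<open>K\<close> of
  \<open>exp (- B v)\<close>. The product rule then gives the equation
  \<open>H' = \<beta> H - 1\<close>.\<close>

lemma primitive_on_hw_G_integral:
  assumes st: "s \<le> t" and \<beta>: "set_integrable lborel {s..t} \<beta>"
  shows "primitive_on s t (\<lambda>u. LBINT v=u..t. hw_G \<beta> u v)
    (\<lambda>u. \<beta> u * (LBINT v=u..t. hw_G \<beta> u v) - 1)"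
proof -
  define B where "B = (\<lambda>u. LBINT v:{s..u}. \<beta> v)"
  have B: "primitive_on s t B \<beta>"
    by (rule primitive_on_cong[OF primitive_on_indefinite[OF \<beta>, of 0]]) (auto simp: B_def)
  define K where "K = (\<lambda>u. LBINT v:{s..u}. exp (- B v))"
  have int: "set_integrable lborel {s..t} (\<lambda>v. exp (- B v))"
    by (intro borel_integrable_atLeastAtMost' continuous_intros primitive_on_continuous[OF B])
  have K: "primitive_on s t K (\<lambda>v. exp (- B v))"
    by (rule primitive_on_cong[OF primitive_on_indefinite[OF int, of 0]]) (auto simp: K_def)
  have H: "(LBINT v=u..t. hw_G \<beta> u v) = exp (B u) * (K t - K u)" if u: "u \<in> {s..t}" for u
  proof -
    have "(LBINT v=u..t. hw_G \<beta> u v) = (LBINT v:{u..t}. hw_G \<beta> u v)"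
      using u by (simp add: interval_integral_Icc)
    also have "\<dots> = (LBINT v:{u..t}. exp (B u) * exp (- B v))"
      using u by (intro set_lebesgue_integral_cong)
        (auto simp: hw_G_eq[OF \<beta> B_def[THEN fun_cong]] exp_add[symmetric])
    also have "\<dots> = exp (B u) * (LBINT v:{u..t}. exp (- B v))"
      by simp
    also have "(LBINT v:{u..t}. exp (- B v)) = (LBINT v:{u<..t}. exp (- B v))"
      by (rule set_integral_discrete_difference[where X = "{u}"]) auto
    also have "\<dots> = K t - K u"
      using primitive_on_diff[OF K, of u t] u by auto
    finally show ?thesis .
  qed
  have "primitive_on s t (\<lambda>u. K t - K u) (\<lambda>u. - exp (- B u))"
    by (rule primitive_on_cong[OF primitive_on_linear[OF K primitive_on_const[of s t "K t"], of "-1" 1]]) auto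
  from primitive_on_mult[OF primitive_on_exp[OF B] this] show ?thesis
  proof (rule primitive_on_cong)
    fix u assume u: "u \<in> {s..t}"
    have "exp (- B u) * exp (B u) = 1" by (simp add: exp_minus)
    then show "\<beta> u * exp (B u) * (K t - K u) + - exp (- B u) * exp (B u) =
        \<beta> u * (LBINT v=u..t. hw_G \<beta> u v) - 1"
      unfolding H[OF u] by (simp add: algebra_simps)
  qed (simp add: H)
qed

text \<open>\<open>m l\<close> is the noise-free solution, started from \<open>l\<close> at time
  \<open>s\<close>, by variation of constants. Integrating \<open>(t - u) * m l u\<close> by parts,
  with boundary values \<open>(t - s) * l\<close> and 0, identifies \<open>hw_M\<close> as its time
  integral.\<close>

lemma hw_M_eq_integral:
  assumes st: "s \<le> t" and \<alpha>: "set_integrable lborel {s..t} \<alpha>" and \<beta>: "set_integrable lborel {s..t} \<beta>"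
  defines "m \<equiv> \<lambda>l u. hw_G \<beta> s u * (l + hw_I \<alpha> \<beta> s u)"
  shows "primitive_on s t (m l) (\<lambda>u. \<alpha> u - \<beta> u * m l u)" (is ?A)
    and "m l s = l" (is ?B)
    and "hw_M \<alpha> \<beta> s t l = (LBINT u:{s..t}. m l u)" (is ?C)
proof -
  define B where "B = (\<lambda>u. LBINT v:{s..u}. \<beta> v)"
  note G = hw_G_eq[OF \<beta> B_def[THEN fun_cong]]
  have B0: "B s = 0" by (simp add: B_def set_integral_singleton)
  have B: "primitive_on s t B \<beta>"
    by (rule primitive_on_cong[OF primitive_on_indefinite[OF \<beta>, of 0]]) (auto simp: B_def)
  have negB: "primitive_on s t (\<lambda>u. - B u) (\<lambda>u. - \<beta> u)"
    by (rule primitive_on_cong[OF primitive_on_linear[OF B B, of "-1" 0]]) auto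
  have int: "set_integrable lborel {s..t} (\<lambda>v. \<alpha> v * exp (B v))"
    by (intro set_integrable_mult_continuous \<alpha> continuous_intros primitive_on_continuous[OF B])
  have I: "hw_I \<alpha> \<beta> s u = (LBINT v:{s..u}. \<alpha> v * exp (B v))" if u: "u \<in> {s..t}" for u
  proof -
    have "hw_I \<alpha> \<beta> s u = (LBINT r:{s..u}. \<alpha> r * hw_G \<beta> r s)"
      unfolding hw_I_def using u by (simp add: interval_integral_Icc)
    also have "\<dots> = (LBINT v:{s..u}. \<alpha> v * exp (B v))"
      using u by (intro set_lebesgue_integral_cong) (auto simp: G B0)
    finally show ?thesis .
  qed
  have Gs: "hw_G \<beta> s u = exp (- B u)" if u: "u \<in> {s..t}" for u
    using G(1)[of s u] u B0 by simp
  have "primitive_on s t (\<lambda>u. exp (- B u) * (l + (LBINT v:{s..u}. \<alpha> v * exp (B v))))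
     (\<lambda>u. - \<beta> u * exp (- B u) * (l + (LBINT v:{s..u}. \<alpha> v * exp (B v))) +
       \<alpha> u * exp (B u) * exp (- B u))"
    by (rule primitive_on_mult[OF primitive_on_exp[OF negB] primitive_on_indefinite[OF int, of l]])
  then show A: ?A
  proof (rule primitive_on_cong)
    fix u assume u: "u \<in> {s..t}"
    have "exp (- B u) * exp (B u) = 1" by (simp add: exp_minus)
    then show "- \<beta> u * exp (- B u) * (l + (LBINT v:{s..u}. \<alpha> v * exp (B v))) +
       \<alpha> u * exp (B u) * exp (- B u) = \<alpha> u - \<beta> u * m l u"
      unfolding m_def I[OF u] Gs[OF u] by (simp add: algebra_simps)
    show "exp (- B u) * (l + (LBINT v:{s..u}. \<alpha> v * exp (B v))) = m l u"
      unfolding m_def I[OF u] Gs[OF u] ..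
  qed
  show ms: ?B
    using st by (simp add: m_def Gs B0 I set_integral_singleton)
  have M: "primitive_on s t (\<lambda>u. (t - u) * m l u) (\<lambda>u. - 1 * m l u + (\<alpha> u - \<beta> u * m l u) * (t - u))"
    by (rule primitive_on_mult[OF primitive_on_diff_right A])
  have im: "set_integrable lborel {s..t} (m l)"
    by (intro borel_integrable_atLeastAtMost' primitive_on_continuous[OF A])
  have ia: "set_integrable lborel {s..t} (\<lambda>u. (t - u) * (\<alpha> u - \<beta> u * m l u))"
    using set_integrable_mult_continuous[OF primitive_on_integrable[OF A], of "\<lambda>u. t - u"]
    by (simp add: mult.commute continuous_intros)
  have "- (t - s) * l = (LBINT u:{s..t}. (t - u) * (\<alpha> u - \<beta> u * m l u) - m l u)"
    using primitive_on_end[OF M st] ms by (simp add: algebra_simps)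
  also have "\<dots> = (LBINT u:{s..t}. (t - u) * (\<alpha> u - \<beta> u * m l u)) - (LBINT u:{s..t}. m l u)"
    by (rule set_integral_diff[OF ia im])
  finally show ?C
    unfolding hw_M_def m_def using st by (simp add: interval_integral_Icc mult.assoc left_diff_distrib)
qed

text \<open>No equation is imposed on \<open>L\<close>: its deviation from the equation is the first
  factor under the integral. With \<open>D = L - m\<close> and \<open>V\<close> the integral of
  \<open>\<beta> D\<close>, this deviation is \<open>D + V\<close>, and
  \<open>(D + V) * (1 - \<beta> H) = D - (H V)'\<close>. As \<open>V s = 0\<close> and
  \<open>H t = 0\<close>, the last term integrates to 0.\<close>

lemma hull_white_path_integral:
  fixes L :: "real \<Rightarrow> real"
  assumes st: "s \<le> t" and \<alpha>: "set_integrable lborel {s..t} \<alpha>" and \<beta>: "set_integrable lborel {s..t} \<beta>"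
    and L: "set_borel_measurable lborel {s..t} L" and bd: "\<And>u. u \<in> {s..t} \<Longrightarrow> \<bar>L u\<bar> \<le> C"
  shows "(LBINT u=s..t. L u) = hw_M \<alpha> \<beta> s t (L s) +
    (LBINT u:{s..t}. (L u - L s - (LBINT v:{s..u}. \<alpha> v - \<beta> v * L v)) *
       (1 - \<beta> u * (LBINT v=u..t. hw_G \<beta> u v)))"
proof -
  define H where "H = (\<lambda>u. LBINT v=u..t. hw_G \<beta> u v)"
  define m where "m = (\<lambda>u. hw_G \<beta> s u * (L s + hw_I \<alpha> \<beta> s u))"
  define V where "V = (\<lambda>u. LBINT v:{s..u}. \<beta> v * (L v - m v))"
  have m: "primitive_on s t m (\<lambda>u. \<alpha> u - \<beta> u * m u)" "m s = L s"
    "hw_M \<alpha> \<beta> s t (L s) = (LBINT u:{s..t}. m u)"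
    using hw_M_eq_integral[OF st \<alpha> \<beta>, of "L s"] unfolding m_def by blast+
  have H: "primitive_on s t H (\<lambda>u. \<beta> u * H u - 1)"
    using primitive_on_hw_G_integral[OF st \<beta>] unfolding H_def .
  have Ht: "H t = 0" unfolding H_def by simp
  have "set_integrable lborel {s..t} (\<lambda>_. 1 :: real)"
    by (intro borel_integrable_atLeastAtMost') auto
  from set_integrable_mult_bounded[OF this L _ bd] have iL: "set_integrable lborel {s..t} L"
    by simp
  have ibL: "set_integrable lborel {s..t} (\<lambda>u. \<beta> u * L u)"
    by (rule set_integrable_mult_bounded[OF \<beta> L _ bd]) auto
  have im: "set_integrable lborel {s..t} m"
    by (intro borel_integrable_atLeastAtMost' primitive_on_continuous[OF m(1)])
  have ibm: "set_integrable lborel {s..t} (\<lambda>u. \<beta> u * m u)"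
    by (intro set_integrable_mult_continuous \<beta> primitive_on_continuous[OF m(1)])
  have iV: "set_integrable lborel {s..t} (\<lambda>u. \<beta> u * (L u - m u))"
    using set_integral_diff(1)[OF ibL ibm] by (simp add: algebra_simps)
  have V: "primitive_on s t V (\<lambda>u. \<beta> u * (L u - m u))"
    by (rule primitive_on_cong[OF primitive_on_indefinite[OF iV, of 0]]) (auto simp: V_def)
  have Vs: "V s = 0" by (simp add: V_def set_integral_singleton)
  have \<zeta>: "L u - L s - (LBINT v:{s..u}. \<alpha> v - \<beta> v * L v) = (L u - m u) + V u" if u: "u \<in> {s..t}" for u
  proof -
    have i: "set_integrable lborel {s..u} \<alpha>" "set_integrable lborel {s..u} (\<lambda>u. \<beta> u * L u)"
       "set_integrable lborel {s..u} (\<lambda>u. \<beta> u * m u)"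
      by (rule set_integrable_subset[OF \<alpha>] set_integrable_subset[OF ibL] set_integrable_subset[OF ibm];
          use u in auto)+
    have "V u = (LBINT v:{s..u}. \<beta> v * L v) - (LBINT v:{s..u}. \<beta> v * m v)"
      unfolding V_def right_diff_distrib by (rule set_integral_diff(2)[OF i(2,3)])
    moreover have "m u = L s + (LBINT v:{s..u}. \<alpha> v - \<beta> v * m v)"
      using primitive_onD[OF m(1) u] m(2) by (simp only:)
    ultimately show ?thesis
      using set_integral_diff(2)[OF i(1,2)] set_integral_diff(2)[OF i(1,3)] by linarith
  qed
  have HV: "primitive_on s t (\<lambda>u. H u * V u) (\<lambda>u. (\<beta> u * H u - 1) * V u + \<beta> u * (L u - m u) * H u)"
    by (rule primitive_on_mult[OF H V])
  have "(LBINT u:{s..t}. (L u - L s - (LBINT v:{s..u}. \<alpha> v - \<beta> v * L v)) * (1 - \<beta> u * H u)) =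
    (LBINT u:{s..t}. (L u - m u) - ((\<beta> u * H u - 1) * V u + \<beta> u * (L u - m u) * H u))"
    by (rule set_lebesgue_integral_cong, simp, intro allI impI, subst \<zeta>, assumption)
      (simp add: algebra_simps)
  also have "\<dots> = (LBINT u:{s..t}. L u - m u) - (LBINT u:{s..t}. (\<beta> u * H u - 1) * V u + \<beta> u * (L u - m u) * H u)"
    by (rule set_integral_diff(2)[OF set_integral_diff(1)[OF iL im] primitive_on_integrable[OF HV]])
  also have "(LBINT u:{s..t}. (\<beta> u * H u - 1) * V u + \<beta> u * (L u - m u) * H u) = 0"
    using primitive_on_end[OF HV st] Ht Vs by simp
  also have "(LBINT u:{s..t}. L u - m u) = (LBINT u:{s..t}. L u) - (LBINT u:{s..t}. m u)"
    by (rule set_integral_diff(2)[OF iL im])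
  finally show ?thesis
    unfolding m(3) H_def using st by (simp add: interval_integral_Icc)
qed


section \<open>Cadlag paths and Riemann sums\<close>

text \<open>One-sided limits bound the path near each point, and the value at the point itself is
  added to the bound; compactness leaves finitely many neighbourhoods.\<close>

lemma cadlag_bounded:
  assumes f: "cadlag f" shows "\<exists>C. \<forall>u\<in>{0..T}. \<bar>f u\<bar> \<le> C"
proof -
  have loc: "\<exists>d>0. \<exists>C. \<forall>u\<in>ball x d \<inter> {0..}. \<bar>f u\<bar> \<le> C" if x: "x \<ge> 0" for x
  proof -
    have near: "eventually (\<lambda>u. \<bar>f u\<bar> \<le> \<bar>l\<bar> + 1) F" if "(f \<longlongrightarrow> l) F" for l F
      by (rule eventually_mono[OF tendstoD[OF that, of 1]]) (auto simp: dist_real_def)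
    have "(f \<longlongrightarrow> f x) (at_right x)" using f x unfolding cadlag_def by auto
    from near[OF this] obtain b where b: "b > x" "\<And>u. x < u \<Longrightarrow> u < b \<Longrightarrow> \<bar>f u\<bar> \<le> \<bar>f x\<bar> + 1"
      unfolding eventually_at_right_field by blast
    show ?thesis
    proof (cases "x = 0")
      case True
      have "\<bar>f u\<bar> \<le> \<bar>f x\<bar> + 1" if "u \<in> ball x b \<inter> {0..}" for u
        using that b(2)[of u] True by (cases "u = 0") (auto simp: dist_real_def)
      then show ?thesis using b(1) True by blast
    next
      case False
      with x f obtain l where "(f \<longlongrightarrow> l) (at_left x)" unfolding cadlag_def by force
      from near[OF this] obtain a where a: "a < x" "\<And>u. a < u \<Longrightarrow> u < x \<Longrightarrow> \<bar>f u\<bar> \<le> \<bar>l\<bar> + 1"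
        unfolding eventually_at_left_field by blast
      have "\<bar>f u\<bar> \<le> \<bar>f x\<bar> + \<bar>l\<bar> + 1" if "u \<in> ball x (min (b - x) (x - a))" for u
        using that a(2)[of u] b(2)[of u] by (cases u x rule: linorder_cases) (auto simp: dist_real_def)
      moreover have "min (b - x) (x - a) > 0" using a b by simp
      ultimately show ?thesis by blast
    qed
  qed
  then obtain d where d: "\<And>x. x \<ge> 0 \<Longrightarrow> d x > 0"
    "\<And>x. x \<ge> 0 \<Longrightarrow> \<exists>C. \<forall>u\<in>ball x (d x) \<inter> {0..}. \<bar>f u\<bar> \<le> C" by metis
  obtain D where D: "D \<subseteq> {0..T}" "finite D" "{0..T} \<subseteq> (\<Union>x\<in>D. ball x (d x))"
  proof (rule compactE_image[of "{0..T}" "{0..T}" "\<lambda>x. ball x (d x)"])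
    show "{0..T} \<subseteq> (\<Union>x\<in>{0..T}. ball x (d x))"
      using d(1) by fastforce
  qed auto
  obtain C where C: "\<And>x u. x \<in> D \<Longrightarrow> u \<in> ball x (d x) \<Longrightarrow> u \<ge> 0 \<Longrightarrow> \<bar>f u\<bar> \<le> C x"
    using d(2) D(1) by (metis IntI atLeastAtMost_iff atLeast_iff subsetD)
  have "\<bar>f u\<bar> \<le> (\<Sum>x\<in>D. \<bar>C x\<bar>)" if u: "u \<in> {0..T}" for u
  proof -
    obtain x where x: "x \<in> D" "u \<in> ball x (d x)" using D(3) u by blast
    have "\<bar>f u\<bar> \<le> \<bar>C x\<bar>" using C[OF x] u by auto
    also have "\<dots> \<le> (\<Sum>x\<in>D. \<bar>C x\<bar>)" by (rule member_le_sum[OF x(1) _ D(2)]) auto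
    finally show ?thesis .
  qed
  then show ?thesis by blast
qed

text \<open>The function is a pointwise limit of its values at grid points to the right, which
  depend on \<open>u\<close> only through an integer.\<close>

lemma right_continuous_measurable:
  fixes f :: "real \<Rightarrow> real"
  assumes f: "\<And>u. u \<in> {a..} \<Longrightarrow> (f \<longlongrightarrow> f u) (at_right u)"
  shows "set_borel_measurable lborel {a..} f"
  unfolding set_borel_measurable_def
proof (rule borel_measurable_LIMSEQ_real)
  \<comment> \<open>Adding 1 to the floor puts \<open>r n u\<close> strictly to the right of
    \<open>u\<close>, even if \<open>u\<close> is a grid point, so the limit at
    \<open>at_right u\<close> applies.\<close>
  define r where "r = (\<lambda>n u. (of_int \<lfloor>u * real (Suc n)\<rfloor> + 1) / real (Suc n))"
  show "(\<lambda>u. indicator {a..} u *\<^sub>R f (r n u)) \<in> borel_measurable lborel" for n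
  proof -
    have "(\<lambda>u. \<lfloor>u * real (Suc n)\<rfloor>) \<in> measurable borel (count_space UNIV)"
      by measurable
    then have "(\<lambda>u. (\<lambda>k::int. f ((of_int k + 1) / real (Suc n))) \<lfloor>u * real (Suc n)\<rfloor>) \<in> borel_measurable borel"
      by (rule measurable_compose) simp
    then show ?thesis unfolding r_def by measurable
  qed
  fix u :: real
  have r_gt: "r n u > u" for n
    using floor_correct[of "u * real (Suc n)"] unfolding r_def
    by (simp add: field_simps del: of_nat_Suc)
  have r_le: "r n u \<le> u + 1 / real (Suc n)" for n
    using floor_correct[of "u * real (Suc n)"] unfolding r_def
    by (simp add: field_simps del: of_nat_Suc)
  have "(\<lambda>n. r n u) \<longlonglongrightarrow> u"
  proof (rule tendsto_sandwich[of "\<lambda>_. u" _ _ "\<lambda>n. u + 1 / real (Suc n)"])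
    show "(\<lambda>n. u + 1 / real (Suc n)) \<longlonglongrightarrow> u"
      using tendsto_add[OF tendsto_const[of u] LIMSEQ_inverse_real_of_nat] by (simp add: divide_inverse)
  qed (use r_gt r_le in \<open>auto intro: always_eventually less_imp_le\<close>)
  then have "filterlim (\<lambda>n. r n u) (at_right u) sequentially"
    unfolding filterlim_at using r_gt by (auto simp: less_imp_neq[symmetric])
  then show "(\<lambda>n. indicator {a..} u *\<^sub>R f (r n u)) \<longlonglongrightarrow> indicator {a..} u *\<^sub>R f u"
    using filterlim_compose[OF f[of u]] by (cases "u \<in> {a..}") (auto simp: indicator_def)
qed

lemma cadlag_measurable:
  assumes f: "cadlag f" and "0 \<le> a"
  shows "set_borel_measurable lborel {a..b} f"
proof -
  have "set_borel_measurable lborel {a..} f"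
    by (rule right_continuous_measurable) (use assms in \<open>auto simp: cadlag_def\<close>)
  then show ?thesis
    by (rule set_borel_measurable_subset) auto
qed

section \<open>Sums over the half-open cells of a partition\<close>

lemma grid_exists:
  fixes U :: "nat \<Rightarrow> real"
  assumes "v \<in> {U 0<..U n}" shows "\<exists>k<n. v \<in> {U k<..U (Suc k)}"
  using assms
proof (induction n)
  case (Suc n)
  then show ?case by (cases "v \<le> U n") (auto intro: less_SucI)
qed auto

lemma grid_indicator_sum:
  fixes U :: "nat \<Rightarrow> real" and c :: "nat \<Rightarrow> 'b :: real_algebra_1"
  assumes "incseq U" "k < n" "v \<in> {U k<..U (Suc k)}"
  shows "(\<Sum>j<n. c j * indicator {U j<..U (Suc j)} v) = c k"
proof -
  have "j = k" if "v \<in> {U j<..U (Suc j)}" for j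
  proof (rule ccontr)
    assume "j \<noteq> k"
    then consider "Suc j \<le> k" | "Suc k \<le> j" by linarith
    then show False
      using that assms(3) incseqD[OF assms(1), of "Suc j" k] incseqD[OF assms(1), of "Suc k" j]
      by cases auto
  qed
  then have "indicator {U j<..U (Suc j)} v = (if j = k then 1 else 0 :: 'b)" for j
    using assms(3) by (metis indicator_simps)
  then have "c j * indicator {U j<..U (Suc j)} v = (if j = k then c k else 0)" for j
    by simp
  then show ?thesis using assms(2) by (simp only: sum.delta) simp
qed

lemma grid_indicator_sum_outside:
  fixes U :: "nat \<Rightarrow> real" and c :: "nat \<Rightarrow> 'b :: real_algebra_1"
  assumes "incseq U" "v \<notin> {U 0<..U n}"
  shows "(\<Sum>j<n. c j * indicator {U j<..U (Suc j)} v) = 0"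
proof (rule sum.neutral, intro ballI)
  fix j assume "j \<in> {..<n}"
  then have "U 0 \<le> U j" "U (Suc j) \<le> U n" using incseqD[OF assms(1)] by auto
  then show "c j * indicator {U j<..U (Suc j)} v = 0"
    using assms(2) by (auto simp: indicator_def)
qed

text \<open>There are \<open>Suc n\<close> cells, so the mesh is defined for every \<open>n\<close>.
  Indices beyond \<open>Suc n\<close> continue past \<open>t\<close>, which keeps the sequence
  monotone on all of \<open>nat\<close>.\<close>

definition equi :: "real \<Rightarrow> real \<Rightarrow> nat \<Rightarrow> nat \<Rightarrow> real" where
  "equi s t n k = s + (t - s) * (real k / real (Suc n))"

lemma equi_0: "equi s t n 0 = s" and equi_end: "equi s t n (Suc n) = t"
  by (simp_all add: equi_def del: of_nat_Suc)

lemma incseq_equi: "s \<le> t \<Longrightarrow> incseq (equi s t n)"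
  by (auto simp: incseq_def equi_def intro!: mult_left_mono divide_right_mono)

lemma equi_in: "s \<le> t \<Longrightarrow> k \<le> Suc n \<Longrightarrow> equi s t n k \<in> {s..t}"
  using incseqD[OF incseq_equi, of s t 0 k n] incseqD[OF incseq_equi, of s t k "Suc n" n]
  by (simp add: equi_0 equi_end)

lemma equi_Suc: "equi s t n (Suc k) = equi s t n k + (t - s) / real (Suc n)"
  by (simp add: equi_def field_simps add_divide_distrib del: of_nat_Suc) (simp add: algebra_simps)

text \<open>The right endpoints of the cells around \<open>u\<close> approach \<open>u\<close> from
  the right or equal it. At \<open>u = t\<close> the endpoint is \<open>t\<close> itself, which is
  why the limit condition is restricted to \<open>u < t\<close>.\<close>

lemma equi_right_sum_tendsto:
  fixes f :: "real \<Rightarrow> real"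
  assumes st: "s \<le> t" and u: "u \<in> {s<..t}" and f: "u < t \<Longrightarrow> (f \<longlongrightarrow> f u) (at_right u)"
  shows "(\<lambda>n. \<Sum>k<Suc n. f (equi s t n (Suc k)) * indicator {equi s t n k<..equi s t n (Suc k)} u)
    \<longlonglongrightarrow> f u"
proof (rule tendstoI)
  fix e :: real assume e: "e > 0"
  obtain b where b: "b > u" "\<And>v. u \<le> v \<Longrightarrow> v < b \<Longrightarrow> v \<le> t \<Longrightarrow> dist (f v) (f u) < e"
  proof (cases "u < t")
    case True
    from tendstoD[OF f[OF True] e] obtain b where "b > u" "\<And>v. u < v \<Longrightarrow> v < b \<Longrightarrow> dist (f v) (f u) < e"
      unfolding eventually_at_right_field by blast
    then show ?thesis using that[of b] e by (metis dist_self order_le_less)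
  next
    case False
    then show ?thesis using that[of "u + 1"] u e by force
  qed
  have "(\<lambda>n. (t - s) / real (Suc n)) \<longlonglongrightarrow> 0"
    using tendsto_mult[OF tendsto_const[of "t - s"] LIMSEQ_inverse_real_of_nat] by (simp add: divide_inverse)
  then have "\<forall>\<^sub>F n in sequentially. (t - s) / real (Suc n) < b - u"
    using b(1) by (intro order_tendstoD) auto
  then show "\<forall>\<^sub>F n in sequentially. dist (\<Sum>k<Suc n. f (equi s t n (Suc k)) *
      indicator {equi s t n k<..equi s t n (Suc k)} u) (f u) < e"
  proof eventually_elim
    case (elim n)
    obtain k where k: "k < Suc n" "u \<in> {equi s t n k<..equi s t n (Suc k)}"
      using grid_exists[of u "equi s t n" "Suc n"] u by (auto simp: equi_0 equi_end)
    have "dist (f (equi s t n (Suc k))) (f u) < e"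
      using b(2)[of "equi s t n (Suc k)"] k elim equi_Suc[of s t n k] equi_in[OF st, of "Suc k" n] by auto
    then show ?case
      using grid_indicator_sum[OF incseq_equi[OF st] k, of "\<lambda>k. f (equi s t n (Suc k))"] by simp
  qed
qed

lemma equi_left_sum_tendsto:
  fixes f :: "real \<Rightarrow> real"
  assumes st: "s \<le> t" and u: "u \<in> {s<..t}" and f: "continuous_on {s..t} f"
  shows "(\<lambda>n. \<Sum>k<Suc n. f (equi s t n k) * indicator {equi s t n k<..equi s t n (Suc k)} u)
    \<longlonglongrightarrow> f u"
proof (rule tendstoI)
  fix e :: real assume e: "e > 0"
  obtain d where d: "d > 0" "\<And>v. v \<in> {s..t} \<Longrightarrow> dist v u < d \<Longrightarrow> dist (f v) (f u) < e"
    using f[unfolded continuous_on_iff] u e by (metis atLeastAtMost_iff greaterThanAtMost_iff less_imp_le)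
  have "(\<lambda>n. (t - s) / real (Suc n)) \<longlonglongrightarrow> 0"
    using tendsto_mult[OF tendsto_const[of "t - s"] LIMSEQ_inverse_real_of_nat] by (simp add: divide_inverse)
  then have "\<forall>\<^sub>F n in sequentially. (t - s) / real (Suc n) < d"
    using d(1) by (intro order_tendstoD) auto
  then show "\<forall>\<^sub>F n in sequentially. dist (\<Sum>k<Suc n. f (equi s t n k) *
      indicator {equi s t n k<..equi s t n (Suc k)} u) (f u) < e"
  proof eventually_elim
    case (elim n)
    obtain k where k: "k < Suc n" "u \<in> {equi s t n k<..equi s t n (Suc k)}"
      using grid_exists[of u "equi s t n" "Suc n"] u by (auto simp: equi_0 equi_end)
    have "dist (f (equi s t n k)) (f u) < e"
      using d(2)[of "equi s t n k"] k elim equi_Suc[of s t n k] equi_in[OF st, of k n]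
      by (auto simp: dist_real_def)
    then show ?case
      using grid_indicator_sum[OF incseq_equi[OF st] k, of "\<lambda>k. f (equi s t n k)"] by simp
  qed
qed

lemma sum_by_parts_vanishing:
  fixes z h :: "nat \<Rightarrow> real"
  assumes "z 0 = 0" "h n = 0"
  shows "(\<Sum>k<n. h k * (z (Suc k) - z k)) = (\<Sum>k<n. z (Suc k) * (h k - h (Suc k)))"
proof -
  have "(\<Sum>k<n. h k * (z (Suc k) - z k)) - (\<Sum>k<n. z (Suc k) * (h k - h (Suc k))) =
     (\<Sum>k<n. h (Suc k) * z (Suc k) - h k * z k)"
    by (simp add: sum_subtractf[symmetric] algebra_simps)
  also have "\<dots> = 0"
    using sum_lessThan_telescope[of "\<lambda>k. h k * z k" n] assms by simp
  finally show ?thesis by simp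
qed

text \<open>Summation by parts, with vanishing boundary terms, moves the differences to
  \<open>H\<close>, whose increments are integrals of \<open>- q\<close>. The sum becomes the
  integral of \<open>q\<close> against the step function of right-endpoint values of \<zeta>, so
  boundedness and right continuity of \<zeta> suffice for dominated convergence.\<close>

lemma riemann_stieltjes_sum_tendsto:
  fixes \<zeta> H q :: "real \<Rightarrow> real"
  assumes st: "s \<le> t" and H: "primitive_on s t H (\<lambda>u. - q u)" and Ht: "H t = 0"
    and \<zeta>s: "\<zeta> s = 0" and bd: "\<And>u. u \<in> {s..t} \<Longrightarrow> \<bar>\<zeta> u\<bar> \<le> C"
    and rc: "\<And>u. u \<in> {s..<t} \<Longrightarrow> (\<zeta> \<longlongrightarrow> \<zeta> u) (at_right u)"
  shows "(\<lambda>n. \<Sum>k<Suc n. H (equi s t n k) * (\<zeta> (equi s t n (Suc k)) - \<zeta> (equi s t n k)))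
    \<longlonglongrightarrow> (LBINT u:{s..t}. \<zeta> u * q u)"
proof -
  have q: "set_integrable lborel {s..t} q"
    using primitive_on_integrable[OF H] by (simp add: set_integrable_def)
  define g where "g = (\<lambda>n u. \<Sum>k<Suc n. \<zeta> (equi s t n (Suc k)) * indicator {equi s t n k<..equi s t n (Suc k)} u)"
  have C0: "C \<ge> 0" using bd[of s] st by force
  have g0: "g n u = 0" if "u \<notin> {s<..t}" for n u
    unfolding g_def
    by (rule grid_indicator_sum_outside[OF incseq_equi[OF st]]) (use that in \<open>simp only: equi_0 equi_end not_False_eq_True\<close>)
  have gb: "\<bar>g n u\<bar> \<le> C" for n u
  proof (cases "u \<in> {s<..t}")
    case True
    then obtain k where k: "k < Suc n" "u \<in> {equi s t n k<..equi s t n (Suc k)}"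
      using grid_exists[of u "equi s t n" "Suc n"] by (auto simp: equi_0 equi_end)
    then show ?thesis
      using grid_indicator_sum[OF incseq_equi[OF st] k, of "\<lambda>k. \<zeta> (equi s t n (Suc k))"] k
        bd[OF equi_in[OF st, of "Suc k" n]] by (simp add: g_def)
  next
    case False
    then show ?thesis using g0 C0 by simp
  qed
  have gm: "g n \<in> borel_measurable borel" for n unfolding g_def by measurable
  have eq: "(\<Sum>k<Suc n. H (equi s t n k) * (\<zeta> (equi s t n (Suc k)) - \<zeta> (equi s t n k))) =
      (LBINT u:{s..t}. g n u * q u)" for n
  proof -
    let ?u = "equi s t n"
    have ui: "?u k \<in> {s..t}" if "k < Suc n" for k using equi_in[OF st, of k n] that by simp
    have sub: "{?u k<..?u (Suc k)} \<subseteq> {s..t}" if "k < Suc n" for k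
      using equi_in[OF st, of k n] equi_in[OF st, of "Suc k" n] that by auto
    have "(\<Sum>k<Suc n. H (?u k) * (\<zeta> (?u (Suc k)) - \<zeta> (?u k))) =
        (\<Sum>k<Suc n. \<zeta> (?u (Suc k)) * (H (?u k) - H (?u (Suc k))))"
      by (rule sum_by_parts_vanishing[of "\<lambda>k. \<zeta> (?u k)" "\<lambda>k. H (?u k)"]) (simp_all only: equi_0 equi_end \<zeta>s Ht)
    also have "\<dots> = (\<Sum>k<Suc n. \<zeta> (?u (Suc k)) * (LBINT v:{?u k<..?u (Suc k)}. q v))"
    proof (rule sum.cong[OF refl])
      fix k assume k: "k \<in> {..<Suc n}"
      have "H (?u (Suc k)) - H (?u k) = (LBINT v:{?u k<..?u (Suc k)}. - q v)"
        using equi_in[OF st, of k n] equi_in[OF st, of "Suc k" n] incseqD[OF incseq_equi[OF st, of n], of k "Suc k"] k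
        by (intro primitive_on_diff[OF H]) auto
      then show "\<zeta> (?u (Suc k)) * (H (?u k) - H (?u (Suc k))) = \<zeta> (?u (Suc k)) * (LBINT v:{?u k<..?u (Suc k)}. q v)"
        by (simp add: set_lebesgue_integral_def)
    qed
    also have "\<dots> = (\<Sum>k<Suc n. LBINT v. \<zeta> (?u (Suc k)) * (indicator {?u k<..?u (Suc k)} v * q v))"
      by (simp add: set_lebesgue_integral_def)
    also have "\<dots> = (LBINT v. \<Sum>k<Suc n. \<zeta> (?u (Suc k)) * (indicator {?u k<..?u (Suc k)} v * q v))"
    proof (rule Bochner_Integration.integral_sum[symmetric])
      fix k assume k: "k \<in> {..<Suc n}"
      have "set_integrable lborel {?u k<..?u (Suc k)} q"
        by (rule set_integrable_subset[OF q]) (use sub k in auto)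
      then show "integrable lborel (\<lambda>v. \<zeta> (?u (Suc k)) * (indicator {?u k<..?u (Suc k)} v * q v))"
        by (simp add: set_integrable_def)
    qed
    also have "\<dots> = (LBINT u:{s..t}. g n u * q u)"
      unfolding set_lebesgue_integral_def
    proof (rule Bochner_Integration.integral_cong[OF refl])
      fix v
      have "(\<Sum>k<Suc n. \<zeta> (?u (Suc k)) * (indicator {?u k<..?u (Suc k)} v * q v)) = g n v * q v"
        by (simp only: g_def sum_distrib_right mult.assoc)
      also have "\<dots> = indicator {s..t} v *\<^sub>R (g n v * q v)"
        using g0[of v n] by (cases "v \<in> {s..t}") auto
      finally show "(\<Sum>k<Suc n. \<zeta> (?u (Suc k)) * (indicator {?u k<..?u (Suc k)} v * q v)) =
          indicator {s..t} v *\<^sub>R (g n v * q v)" .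
    qed
    finally show ?thesis .
  qed
  have "(\<lambda>n. LBINT u:{s..t}. g n u * q u) \<longlonglongrightarrow> (LBINT u:{s..t}. \<zeta> u * q u)"
    unfolding set_lebesgue_integral_def
  proof (rule integral_dominated_convergence[where w = "\<lambda>u. C * \<bar>indicator {s..t} u * q u\<bar>"])
    have qm: "(\<lambda>u. indicator {s..t} u * q u) \<in> borel_measurable borel"
      using q by (simp add: set_integrable_def borel_measurable_integrable[of lborel, simplified])
    have "(\<lambda>u. g n u * (indicator {s..t} u * q u)) \<in> borel_measurable borel" for n
      using gm qm by (rule borel_measurable_times)
    then show m: "(\<lambda>u. indicator {s..t} u *\<^sub>R (g n u * q u)) \<in> borel_measurable lborel" for n
      by (simp add: mult.left_commute)
    have lim: "(\<lambda>n. indicator {s..t} u *\<^sub>R (g n u * q u)) \<longlonglongrightarrow> indicator {s..t} u *\<^sub>R (\<zeta> u * q u)" for u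
    proof (cases "u \<in> {s<..t}")
      case True
      show ?thesis unfolding g_def
        by (intro tendsto_intros equi_right_sum_tendsto[OF st True] rc) (use True in auto)
    next
      case False
      then have "g n u = 0" for n by (rule g0)
      \<comment> \<open>The half-open cells miss \<open>u = s\<close>, where the step functions are
        0; this agrees with \<open>\<zeta> s = 0\<close>.\<close>
      then show ?thesis using False \<zeta>s by (cases "u = s") auto
    qed
    \<comment> \<open>Measurability of \<zeta> is not among the assumptions; that of the product is
      inherited from the approximations.\<close>
    show "(\<lambda>u. indicator {s..t} u *\<^sub>R (\<zeta> u * q u)) \<in> borel_measurable lborel"
      by (rule borel_measurable_LIMSEQ_real[OF lim m])
    show "integrable lborel (\<lambda>u. C * \<bar>indicator {s..t} u * q u\<bar>)"
      using q unfolding set_integrable_def by (intro integrable_mult_right integrable_abs) simp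
    show "AE u in lborel. (\<lambda>n. indicator {s..t} u *\<^sub>R (g n u * q u)) \<longlonglongrightarrow> indicator {s..t} u *\<^sub>R (\<zeta> u * q u)"
      using lim by simp
    show "AE u in lborel. norm (indicator {s..t} u *\<^sub>R (g n u * q u)) \<le> C * \<bar>indicator {s..t} u * q u\<bar>" for n
      using gb[of n] by (intro AE_I2) (auto simp: indicator_def abs_mult intro: mult_right_mono)
  qed
  then show ?thesis unfolding eq .
qed


section \<open>The characteristic exponent\<close>

text \<open>With \<open>w = \<psi> x\<close> this recovers the exponent from characteristic
  functions at short times, without choosing a branch of the logarithm. Inequalities for
  \<open>1 - \<phi>\<close> thereby become inequalities for \<psi>.\<close>

lemma exp_quotient_tendsto:
  fixes w :: complex
  shows "(\<lambda>n. of_nat (Suc n) * (1 - exp (of_real (1 / real (Suc n)) * w))) \<longlonglongrightarrow> - w"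
proof -
  have "((\<lambda>h. exp (h * w)) has_field_derivative w) (at 0)"
    by (auto intro!: derivative_eq_intros)
  then have "((\<lambda>h. (exp (h * w) - 1) / h) \<longlongrightarrow> w) (at 0)"
    by (simp add: DERIV_def)
  moreover have "filterlim (\<lambda>n. complex_of_real (1 / real (Suc n))) (at 0) sequentially"
    unfolding filterlim_at
    using tendsto_of_real[OF LIMSEQ_inverse_real_of_nat, where 'a = complex]
    by (auto simp: divide_inverse simp del: of_nat_Suc)
  ultimately have "(\<lambda>n. (exp (of_real (1 / real (Suc n)) * w) - 1) / of_real (1 / real (Suc n))) \<longlonglongrightarrow> w"
    by (rule filterlim_compose)
  from tendsto_minus[OF this] show ?thesis
    by (rule filterlim_cong[THEN iffD1, OF refl refl, rotated])
      (auto simp: field_simps simp del: of_nat_Suc)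
qed

lemma mult_le_weighted_squares:
  fixes \<eta> a b :: real
  assumes "\<eta> > 0" "a \<ge> 0" "b \<ge> 0"
  shows "a * b \<le> \<eta> * (a\<^sup>2 / 2) + (b\<^sup>2 / 2) / \<eta>"
proof -
  have "0 \<le> (\<eta> * a - b)\<^sup>2 / (2 * \<eta>)" using assms by simp
  also have "\<dots> = \<eta> * (a\<^sup>2 / 2) + (b\<^sup>2 / 2) / \<eta> - a * b"
    using assms by (simp add: power2_eq_square field_simps)
  finally show ?thesis by simp
qed

text \<open>This turns a square into a quantity linear in the exponential, whose expectation is the
  real part of one minus a characteristic function.\<close>

lemma cmod_one_minus_iexp: "(cmod (1 - iexp x))\<^sup>2 / 2 = Re (1 - iexp x)"
proof -
  have "(cmod (1 - iexp x))\<^sup>2 = (1 - cos x)\<^sup>2 + (sin x)\<^sup>2"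
    by (simp add: cmod_power2 Re_exp Im_exp)
  also have "\<dots> = 2 - 2 * cos x"
    using sin_cos_squared_add[of x] by (simp add: power2_eq_square algebra_simps)
  finally show ?thesis by (simp add: Re_exp)
qed

locale levy = prob_space M for M :: "'a measure" +
  fixes F :: "real \<Rightarrow> 'a measure" and X :: "real \<Rightarrow> 'a \<Rightarrow> real" and \<psi> :: "real \<Rightarrow> complex"
  assumes filtered: "filtered_prob_space M F"
    and levy: "levy_process M F X"
    and exponent: "char_exponent M X \<psi>"
begin

section \<open>Measurability along the filtration and characteristic functions of increments\<close>

lemma subalgebra_F: "0 \<le> r \<Longrightarrow> subalgebra M (F r)"
  using filtered unfolding filtered_prob_space_def by simp

lemma measurable_F_mono:
  assumes "W \<in> measurable (F r) N" "0 \<le> r" "r \<le> r'" shows "W \<in> measurable (F r') N"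
proof -
  have "subalgebra (F r') (F r)"
    using filtered subalgebra_F[of r] subalgebra_F[of r'] assms
    unfolding filtered_prob_space_def subalgebra_def by auto
  then show ?thesis using assms(1) by (rule measurable_from_subalg)
qed

lemma measurable_F: "W \<in> measurable (F r) N \<Longrightarrow> 0 \<le> r \<Longrightarrow> W \<in> measurable M N"
  using measurable_from_subalg subalgebra_F by blast

lemma measurable_X: "0 \<le> r \<Longrightarrow> X r \<in> borel_measurable (F r)"
  using levy unfolding levy_process_def adapted_def by simp

lemma measurable_X_M: "0 \<le> r \<Longrightarrow> X r \<in> borel_measurable M"
  using measurable_X measurable_F by blast

lemma expectation_iexp_X:
  assumes "0 \<le> r" shows "(CLINT \<omega>|M. iexp (x * X r \<omega>)) = exp (complex_of_real r * \<psi> x)"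
proof -
  have "char (distr M borel (X r)) x = (CLINT \<omega>|M. iexp (x * X r \<omega>))"
    unfolding char_def using measurable_X_M[OF assms] by (subst integral_distr) auto
  then show ?thesis using exponent assms unfolding char_exponent_def by metis
qed

lemma expectation_iexp_increment:
  assumes "0 \<le> r" "r \<le> r'"
  shows "(CLINT \<omega>|M. iexp (x * (X r' \<omega> - X r \<omega>))) = exp (complex_of_real (r' - r) * \<psi> x)"
proof -
  have [measurable]: "X r \<in> borel_measurable M" "X r' \<in> borel_measurable M" "X (r' - r) \<in> borel_measurable M"
    using measurable_X_M assms by auto
  have "(CLINT \<omega>|M. iexp (x * (X r' \<omega> - X r \<omega>))) = (CLINT y|distr M borel (\<lambda>\<omega>. X r' \<omega> - X r \<omega>). iexp (x * y))"
    by (subst integral_distr) auto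
  also have "distr M borel (\<lambda>\<omega>. X r' \<omega> - X r \<omega>) = distr M borel (X (r' - r))"
    using levy assms unfolding levy_process_def by blast
  also have "(CLINT y|distr M borel (X (r' - r)). iexp (x * y)) = (CLINT \<omega>|M. iexp (x * X (r' - r) \<omega>))"
    by (subst integral_distr) auto
  finally show ?thesis using expectation_iexp_X[of "r' - r" x] assms by simp
qed

lemma norm_exp_exponent_le: "0 \<le> r \<Longrightarrow> cmod (exp (complex_of_real r * \<psi> x)) \<le> 1"
proof -
  assume r: "0 \<le> r"
  interpret D: real_distribution "distr M borel (X r)"
    using measurable_X_M[OF r] by (rule real_distribution_distr)
  show ?thesis using D.cmod_char_le_1[of x] exponent r unfolding char_exponent_def by metis
qed

lemma exponent_quotient_tendsto:
  "(\<lambda>n. of_nat (Suc n) * (1 - (CLINT \<omega>|M. iexp (x * X (1 / real (Suc n)) \<omega>)))) \<longlonglongrightarrow> - \<psi> x"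
  using exp_quotient_tendsto[of "\<psi> x"] by (subst expectation_iexp_X) auto

lemma exponent_0: "\<psi> 0 = 0"
proof -
  have "(\<lambda>n. 0) \<longlonglongrightarrow> - \<psi> 0"
    using exponent_quotient_tendsto[of 0] by (simp add: prob_space)
  then show ?thesis using LIMSEQ_unique tendsto_const by fastforce
qed

text \<open>The defect of additivity of \<open>1 - \<phi>\<close> is, up to sign, the expectation of
  \<open>(1 - iexp (y X)) * (1 - iexp (z X))\<close>. Weighted squares bound it by the real parts of
  \<open>1 - \<phi>\<close> at \<open>y\<close> and \<open>z\<close>; multiplying by
  \<open>Suc n\<close> at time \<open>1 / Suc n\<close> and letting \<open>n\<close> grow gives the
  claim. The free weight \<eta> is what later allows an arbitrarily small coefficient at
  \<open>\<psi> y\<close>.\<close>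

lemma exponent_add_diff:
  assumes \<eta>: "\<eta> > 0"
  shows "cmod (\<psi> (y + z) - \<psi> y - \<psi> z) \<le> \<eta> * cmod (\<psi> y) + cmod (\<psi> z) / \<eta>"
proof -
  define \<phi> where "\<phi> = (\<lambda>n x. CLINT \<omega>|M. iexp (x * X (1 / real (Suc n)) \<omega>))"
  have main: "cmod ((1 - \<phi> n (y + z)) - (1 - \<phi> n y) - (1 - \<phi> n z)) \<le>
     \<eta> * cmod (1 - \<phi> n y) + cmod (1 - \<phi> n z) / \<eta>" for n
  proof -
    let ?X = "X (1 / real (Suc n))"
    have X: "?X \<in> borel_measurable M" by (rule measurable_X_M) simp
    let ?p = "\<lambda>\<omega>. 1 - iexp (y * ?X \<omega>)" and ?q = "\<lambda>\<omega>. 1 - iexp (z * ?X \<omega>)"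
    have int: "integrable M (\<lambda>\<omega>. iexp (x * ?X \<omega>))" for x
      by (rule integrable_iexp) (use X in measurable)
    have ip: "integrable M ?p" "integrable M ?q" using int by auto
    have ipq: "integrable M (\<lambda>\<omega>. iexp ((y + z) * ?X \<omega>) - iexp (y * ?X \<omega>) - iexp (z * ?X \<omega>) + 1)"
      by (intro Bochner_Integration.integrable_add Bochner_Integration.integrable_diff int integrable_const)
    have pq: "?p \<omega> * ?q \<omega> = iexp ((y + z) * ?X \<omega>) - iexp (y * ?X \<omega>) - iexp (z * ?X \<omega>) + 1" for \<omega>
      by (simp add: algebra_simps exp_add[symmetric])
    have "(CLINT \<omega>|M. ?p \<omega> * ?q \<omega>) = \<phi> n (y + z) - \<phi> n y - \<phi> n z + 1"
      unfolding pq \<phi>_def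
      by (simp add: prob_space int Bochner_Integration.integrable_diff
          del: of_real_add of_real_mult of_nat_Suc)
    then have "(1 - \<phi> n (y + z)) - (1 - \<phi> n y) - (1 - \<phi> n z) = - (CLINT \<omega>|M. ?p \<omega> * ?q \<omega>)"
      by (simp only:) simp
    then have "cmod ((1 - \<phi> n (y + z)) - (1 - \<phi> n y) - (1 - \<phi> n z)) = cmod (CLINT \<omega>|M. ?p \<omega> * ?q \<omega>)"
      by (simp only: norm_minus_cancel)
    also have "\<dots> \<le> (\<integral>\<omega>. cmod (?p \<omega> * ?q \<omega>) \<partial>M)"
      by (rule integral_norm_bound)
    also have "\<dots> \<le> (\<integral>\<omega>. \<eta> * Re (?p \<omega>) + Re (?q \<omega>) / \<eta> \<partial>M)"
    proof (rule integral_mono)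
      show "integrable M (\<lambda>\<omega>. cmod (?p \<omega> * ?q \<omega>))" unfolding pq using ipq by (rule integrable_norm)
      show "integrable M (\<lambda>\<omega>. \<eta> * Re (?p \<omega>) + Re (?q \<omega>) / \<eta>)"
        by (intro Bochner_Integration.integrable_add integrable_mult_right integrable_divide integrable_Re ip)
      show "cmod (?p \<omega> * ?q \<omega>) \<le> \<eta> * Re (?p \<omega>) + Re (?q \<omega>) / \<eta>" for \<omega>
        using mult_le_weighted_squares[OF \<eta>, of "cmod (?p \<omega>)" "cmod (?q \<omega>)"]
        unfolding cmod_one_minus_iexp norm_mult by simp
    qed
    also have "\<dots> = \<eta> * Re (CLINT \<omega>|M. ?p \<omega>) + Re (CLINT \<omega>|M. ?q \<omega>) / \<eta>"
      using integrable_Re[OF ip(1)] integrable_Re[OF ip(2)]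
      by (simp only: integral_Re[OF ip(1), symmetric] integral_Re[OF ip(2), symmetric]
          Bochner_Integration.integral_add integrable_mult_right integrable_divide
          integral_mult_right_zero integral_divide_zero)
    also have "(CLINT \<omega>|M. ?p \<omega>) = 1 - \<phi> n y"
      using int by (simp add: \<phi>_def prob_space)
    also have "(CLINT \<omega>|M. ?q \<omega>) = 1 - \<phi> n z"
      using int by (simp add: \<phi>_def prob_space)
    finally show ?thesis
      using mult_left_mono[OF complex_Re_le_cmod, of \<eta> "1 - \<phi> n y"]
        divide_right_mono[OF complex_Re_le_cmod, of \<eta> "1 - \<phi> n z"] \<eta> by linarith
  qed
  have l: "(\<lambda>n. of_nat (Suc n) * (1 - \<phi> n x)) \<longlonglongrightarrow> - \<psi> x" for x
    using exponent_quotient_tendsto unfolding \<phi>_def .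
  have "cmod (- \<psi> (y + z) - - \<psi> y - - \<psi> z) \<le> \<eta> * cmod (- \<psi> y) + cmod (- \<psi> z) / \<eta>"
  proof (rule LIMSEQ_le)
    show "(\<lambda>n. cmod (of_nat (Suc n) * (1 - \<phi> n (y + z)) - of_nat (Suc n) * (1 - \<phi> n y) - of_nat (Suc n) * (1 - \<phi> n z)))
       \<longlonglongrightarrow> cmod (- \<psi> (y + z) - - \<psi> y - - \<psi> z)"
      by (intro tendsto_intros l)
    show "(\<lambda>n. \<eta> * cmod (of_nat (Suc n) * (1 - \<phi> n y)) + cmod (of_nat (Suc n) * (1 - \<phi> n z)) / \<eta>)
       \<longlonglongrightarrow> \<eta> * cmod (- \<psi> y) + cmod (- \<psi> z) / \<eta>"
      using \<eta> by (intro tendsto_intros l) auto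
    have "cmod (of_nat (Suc n) * (1 - \<phi> n (y + z)) - of_nat (Suc n) * (1 - \<phi> n y) - of_nat (Suc n) * (1 - \<phi> n z)) \<le>
        \<eta> * cmod (of_nat (Suc n) * (1 - \<phi> n y)) + cmod (of_nat (Suc n) * (1 - \<phi> n z)) / \<eta>" for n
    proof -
      have "real (Suc n) * cmod ((1 - \<phi> n (y + z)) - (1 - \<phi> n y) - (1 - \<phi> n z)) \<le>
         real (Suc n) * (\<eta> * cmod (1 - \<phi> n y) + cmod (1 - \<phi> n z) / \<eta>)"
        by (rule mult_left_mono[OF main]) simp
      then show ?thesis
        unfolding right_diff_distrib[symmetric] norm_mult norm_of_nat by (simp add: algebra_simps)
    qed
    then show "\<exists>N. \<forall>n\<ge>N. cmod (of_nat (Suc n) * (1 - \<phi> n (y + z)) - of_nat (Suc n) * (1 - \<phi> n y) - of_nat (Suc n) * (1 - \<phi> n z)) \<le>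
        \<eta> * cmod (of_nat (Suc n) * (1 - \<phi> n y)) + cmod (of_nat (Suc n) * (1 - \<phi> n z)) / \<eta>"
      by blast
  qed
  then show ?thesis
    by (simp add: norm_minus_commute algebra_simps)
qed

lemma exponent_add_le:
  "cmod (\<psi> (y + z)) \<le> 2 * cmod (\<psi> y) + 2 * cmod (\<psi> z)"
  using exponent_add_diff[of 1 y z] norm_triangle_ineq[of "\<psi> (y + z) - \<psi> y - \<psi> z" "\<psi> y + \<psi> z"]
    norm_triangle_ineq[of "\<psi> y" "\<psi> z"] by simp

text \<open>A modulus of continuity controlled by \<psi> at the difference of the arguments: \<eta>
  is chosen small against \<open>\<psi> y\<close> first, and only then is \<open>y'\<close> brought
  close to \<open>y\<close>.\<close>

lemma exponent_diff_le:
  assumes "\<eta> > 0"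
  shows "cmod (\<psi> y' - \<psi> y) \<le> \<eta> * cmod (\<psi> y) + (1 + 1 / \<eta>) * cmod (\<psi> (y' - y))"
  using exponent_add_diff[OF assms, of y "y' - y"]
    norm_triangle_ineq[of "\<psi> y' - \<psi> y - \<psi> (y' - y)" "\<psi> (y' - y)"] by (simp add: algebra_simps)

text \<open>Since \<open>\<psi> z \<cdot> \<integral>\<^sub>0\<^sup>T E (exp (i z X\<^sub>r)) dr = exp (T \<psi> z) - 1\<close> is bounded by 2 and the integral
  tends to \<open>T\<close> as \<open>z \<rightarrow> 0\<close>, the limit superior of \<open>\<bar>\<psi> z\<bar>\<close> is at most \<open>2 / T\<close>, for every \<open>T\<close>.\<close>

lemma isCont_exponent_0: "isCont \<psi> 0"
proof -
  have "(\<lambda>n. \<psi> (z n)) \<longlonglongrightarrow> 0" if z: "z \<longlonglongrightarrow> 0" for z :: "nat \<Rightarrow> real"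
  proof (rule LIMSEQ_I)
    fix e :: real assume e: "e > 0"
    \<comment> \<open>With \<open>cmod (J n) > T / 2\<close>, the product bound 2 gives
      \<open>cmod (\<psi> (z n)) \<le> 4 / T\<close>, which equals \<open>e / 2\<close> for this
      \<open>T\<close>.\<close>
    define T where "T = 8 / e"
    have T: "T > 0" using e by (simp add: T_def)
    define J where "J = (\<lambda>n. integral {0..T} (\<lambda>r. exp (complex_of_real r * \<psi> (z n))))"
    have hi: "((\<lambda>r. \<psi> (z n) * exp (complex_of_real r * \<psi> (z n))) has_integral
        exp (complex_of_real T * \<psi> (z n)) - exp (complex_of_real 0 * \<psi> (z n))) {0..T}" for n
    proof (rule fundamental_theorem_of_calculus)
      fix r assume "r \<in> {0..T}"
      have "((\<lambda>w. exp (w * \<psi> (z n))) has_field_derivative \<psi> (z n) * exp (complex_of_real r * \<psi> (z n)))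
          (at (complex_of_real r))"
        by (auto intro!: derivative_eq_intros)
      then show "((\<lambda>r. exp (complex_of_real r * \<psi> (z n))) has_vector_derivative
          \<psi> (z n) * exp (complex_of_real r * \<psi> (z n))) (at r within {0..T})"
        by (rule has_vector_derivative_real_field)
    qed (use T in simp)
    have cont: "(\<lambda>r. exp (complex_of_real r * \<psi> (z n))) integrable_on {0..T}" for n
      by (intro integrable_continuous_interval continuous_intros)
    have J: "\<psi> (z n) * J n = exp (complex_of_real T * \<psi> (z n)) - 1" for n
      using integral_unique[OF hi[of n]] unfolding J_def by (simp add: integral_mult_right)
    have "J \<longlonglongrightarrow> integral {0..T} (\<lambda>r. 1)"
      unfolding J_def
    proof (rule dominated_convergence(2)[OF cont, where h = "\<lambda>_. 1"])
      fix r assume r: "r \<in> {0..T}"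
      interpret D: real_distribution "distr M borel (X r)"
        using measurable_X_M r by (intro real_distribution_distr) auto
      have "(\<lambda>n. char (distr M borel (X r)) (z n)) \<longlonglongrightarrow> char (distr M borel (X r)) 0"
        by (rule isCont_tendsto_compose[OF D.isCont_char z])
      then show "(\<lambda>n. exp (complex_of_real r * \<psi> (z n))) \<longlonglongrightarrow> 1"
        using exponent r unfolding char_exponent_def by (simp add: D.char_zero exponent_0)
    qed (use norm_exp_exponent_le in auto)
    then have "(\<lambda>n. cmod (J n)) \<longlonglongrightarrow> T"
      using tendsto_norm T by fastforce
    then have "\<forall>\<^sub>F n in sequentially. cmod (J n) > T / 2"
      using T by (intro order_tendstoD) auto
    then have "\<forall>\<^sub>F n in sequentially. norm (\<psi> (z n) - 0) < e"
    proof eventually_elim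
      case (elim n)
      have "cmod (\<psi> (z n)) * cmod (J n) \<le> 2"
        unfolding norm_mult[symmetric] J
        using norm_triangle_ineq4[of "exp (complex_of_real T * \<psi> (z n))" 1] norm_exp_exponent_le[of T "z n"] T
        by (simp del: norm_exp_eq_Re)
      moreover have "cmod (\<psi> (z n)) * cmod (J n) \<ge> cmod (\<psi> (z n)) * (T / 2)"
        using elim by (intro mult_left_mono) auto
      ultimately have "cmod (\<psi> (z n)) * (T / 2) \<le> 2" by linarith
      then show ?case using e by (simp add: T_def field_simps)
    qed
    then show "\<exists>N. \<forall>n\<ge>N. norm (\<psi> (z n) - 0) < e"
      unfolding eventually_sequentially .
  qed
  then show ?thesis
    unfolding continuous_at_sequentially by (simp add: o_def exponent_0)
qed

text \<open>Continuity at 0 is transported to \<open>y\<close> by \<open>exponent_diff_le\<close>.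
  The 1 added in the denominator of \<eta> covers the case \<open>\<psi> y = 0\<close>.\<close>

lemma isCont_exponent: "isCont \<psi> y"
  unfolding continuous_at_sequentially
proof (intro allI impI)
  fix z :: "nat \<Rightarrow> real" assume z: "z \<longlonglongrightarrow> y"
  have "(\<lambda>n. z n - y) \<longlonglongrightarrow> 0" using z by (simp add: LIM_zero)
  from isCont_tendsto_compose[OF isCont_exponent_0 this]
  have d: "(\<lambda>n. \<psi> (z n - y)) \<longlonglongrightarrow> 0" by (simp add: exponent_0)
  show "(\<psi> \<circ> z) \<longlonglongrightarrow> \<psi> y"
    unfolding o_def
  proof (rule LIMSEQ_I)
    fix e :: real assume e: "e > 0"
    define \<eta> where "\<eta> = e / (2 * (cmod (\<psi> y) + 1))"
    have \<eta>: "\<eta> > 0" using e by (simp add: \<eta>_def add_nonneg_pos)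
    have "\<eta> * cmod (\<psi> y) \<le> \<eta> * (cmod (\<psi> y) + 1)" using \<eta> by simp
    also have "\<dots> = e / 2"
      unfolding \<eta>_def using norm_ge_zero[of "\<psi> y"] by (simp add: field_simps add_nonneg_eq_0_iff)
    finally have h: "\<eta> * cmod (\<psi> y) \<le> e / 2" .
    have "(\<lambda>n. (1 + 1 / \<eta>) * cmod (\<psi> (z n - y))) \<longlonglongrightarrow> (1 + 1 / \<eta>) * cmod 0"
      by (intro tendsto_intros d)
    then have "\<forall>\<^sub>F n in sequentially. (1 + 1 / \<eta>) * cmod (\<psi> (z n - y)) < e / 2"
      using e by (intro order_tendstoD) auto
    then have "\<forall>\<^sub>F n in sequentially. norm (\<psi> (z n) - \<psi> y) < e"
      by eventually_elim (use exponent_diff_le[OF \<eta>, of _ y] h in \<open>smt (verit, best) field_sum_of_halves\<close>)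
    then show "\<exists>N. \<forall>n\<ge>N. norm (\<psi> (z n) - \<psi> y) < e"
      unfolding eventually_sequentially .
  qed
qed

lemma continuous_on_exponent: "continuous_on S \<psi>"
  using isCont_exponent continuous_at_imp_continuous_on by blast

lemma continuous_on_exponent_compose:
  "continuous_on S g \<Longrightarrow> continuous_on S (\<lambda>x. \<psi> (g x))"
  by (rule continuous_on_compose2[OF continuous_on_exponent[of UNIV]]) auto

lemma measurable_exponent [measurable]: "\<psi> \<in> borel_measurable borel"
  by (intro borel_measurable_continuous_onI continuous_on_exponent)

text \<open>The function \<psi>* of the overview. Taking in all \<theta> of both signs makes it even
  and monotone in \<bar>y\<bar>, matching the condition
  \<open>\<bar>h\<bar> \<le> \<bar>g\<bar>\<close> in the Daniell mean.\<close>

definition psi_sup :: "real \<Rightarrow> real" where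
  "psi_sup y = (SUP \<theta>\<in>{-1..1}. cmod (\<psi> (\<theta> * y)))"

text \<open>Continuity on a compact interval. A maximizing \<theta> replaces the supremum by a
  single value of \<psi>: as a multiplier of step heights in \<open>psi_mean_step_le\<close>, and as
  a fixed factor when passing to limits in
  \<open>has_stoch_integral_imp_psi_integral\<close>.\<close>

lemma psi_sup_attained: "\<exists>\<theta>\<in>{-1..1}. psi_sup y = cmod (\<psi> (\<theta> * y))"
  and psi_sup_upper: "\<bar>\<theta>\<bar> \<le> 1 \<Longrightarrow> cmod (\<psi> (\<theta> * y)) \<le> psi_sup y"
proof -
  have c: "continuous_on {-1..1} (\<lambda>\<theta>. cmod (\<psi> (\<theta> * y)))"
    by (intro continuous_intros continuous_on_exponent_compose)
  have "compact {-1..1 :: real}" "{-1..1 :: real} \<noteq> {}" by auto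
  from continuous_attains_sup[OF this c]
  obtain \<theta>0 where \<theta>0: "\<theta>0 \<in> {-1..1}" "\<And>\<theta>. \<theta> \<in> {-1..1} \<Longrightarrow> cmod (\<psi> (\<theta> * y)) \<le> cmod (\<psi> (\<theta>0 * y))"
    by blast
  have eq: "psi_sup y = cmod (\<psi> (\<theta>0 * y))"
    unfolding psi_sup_def using \<theta>0 by (intro cSup_eq_maximum) auto
  then show "\<exists>\<theta>\<in>{-1..1}. psi_sup y = cmod (\<psi> (\<theta> * y))" using \<theta>0 by blast
  show "cmod (\<psi> (\<theta> * y)) \<le> psi_sup y" if "\<bar>\<theta>\<bar> \<le> 1"
    using eq \<theta>0(2)[of \<theta>] that by (auto simp: abs_le_iff)
qed

lemma psi_sup_ge: "cmod (\<psi> y) \<le> psi_sup y"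
  using psi_sup_upper[of 1 y] by simp

lemma psi_sup_nonneg: "0 \<le> psi_sup y"
  using psi_sup_ge[of y] norm_ge_zero[of "\<psi> y"] by linarith

lemma psi_sup_0: "psi_sup 0 = 0"
  using psi_sup_attained[of 0] by (simp add: exponent_0)

lemma psi_sup_mono:
  assumes "\<bar>y\<bar> \<le> \<bar>z\<bar>" shows "psi_sup y \<le> psi_sup z"
proof (cases "z = 0")
  case False
  obtain \<theta> where \<theta>: "\<theta> \<in> {-1..1}" "psi_sup y = cmod (\<psi> (\<theta> * y))" using psi_sup_attained by blast
  have "\<bar>\<theta> * (y / z)\<bar> \<le> 1"
    unfolding abs_mult using \<theta> assms False by (intro mult_le_one) (auto simp: abs_le_iff)
  from psi_sup_upper[OF this, of z] show ?thesis using \<theta>(2) False by simp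
qed (use assms in auto)

lemma psi_sup_add: "psi_sup (y + z) \<le> 2 * psi_sup y + 2 * psi_sup z"
proof -
  obtain \<theta> where \<theta>: "\<theta> \<in> {-1..1}" "psi_sup (y + z) = cmod (\<psi> (\<theta> * (y + z)))" using psi_sup_attained by blast
  have "cmod (\<psi> (\<theta> * (y + z))) \<le> 2 * cmod (\<psi> (\<theta> * y)) + 2 * cmod (\<psi> (\<theta> * z))"
    using exponent_add_le[of "\<theta> * y" "\<theta> * z"] by (simp add: distrib_left)
  then show ?thesis
    using \<theta> psi_sup_upper[of \<theta> y] psi_sup_upper[of \<theta> z] by (auto simp: abs_le_iff)
qed

text \<open>Doubling the argument costs a factor 4 by \<open>psi_sup_add\<close>; finitely many
  doublings exceed \<open>R\<close>, and monotonicity covers the smaller factors.\<close>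

lemma psi_sup_scale: "\<exists>C\<ge>0. \<forall>x y. \<bar>x\<bar> \<le> R \<longrightarrow> psi_sup (x * y) \<le> C * psi_sup y"
proof -
  have p2: "psi_sup (2 ^ n * y) \<le> 4 ^ n * psi_sup y" for n y
  proof (induction n)
    case (Suc n)
    have "psi_sup (2 ^ Suc n * y) \<le> 4 * psi_sup (2 ^ n * y)"
      using psi_sup_add[of "2 ^ n * y" "2 ^ n * y"] by (simp add: algebra_simps)
    then show ?case using Suc by simp
  qed simp
  obtain n where n: "R < 2 ^ n" using real_arch_pow[of 2 R] by auto
  have "psi_sup (x * y) \<le> 4 ^ n * psi_sup y" if "\<bar>x\<bar> \<le> R" for x y
  proof -
    have "psi_sup (x * y) \<le> psi_sup (2 ^ n * y)"
      using that n by (intro psi_sup_mono) (auto simp: abs_mult intro!: mult_right_mono)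
    then show ?thesis using p2[of n y] by linarith
  qed
  then show ?thesis by (intro exI[of _ "4 ^ n"]) auto
qed

text \<open>The supremum runs over uncountably many \<theta>; measurability comes instead from
  monotonicity on the half-line and evenness.\<close>

lemma measurable_psi_sup [measurable]: "psi_sup \<in> borel_measurable borel"
proof -
  have "mono (\<lambda>y. psi_sup (max 0 y))"
    by (intro monoI psi_sup_mono) auto
  then have "(\<lambda>y. psi_sup (max 0 y)) \<in> borel_measurable borel"
    by (rule borel_measurable_mono)
  then have "(\<lambda>y. psi_sup (max 0 \<bar>y\<bar>)) \<in> borel_measurable borel"
    by measurable
  moreover have "psi_sup (max 0 \<bar>y\<bar>) = psi_sup y" for y
    by (intro antisym psi_sup_mono) auto
  ultimately show ?thesis by simp
qed

end


section \<open>Step integrals\<close>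

lemma step_fun_simps [simp]:
  "step_fun [] v = 0" "step_fun ((c, p, q) # h) v = c * indicator {p<..q} v + step_fun h v"
  "step_fun (h @ h') v = step_fun h v + step_fun h' v"
  by (simp_all add: step_fun_def)

lemma step_integral_simps [simp]:
  "step_integral X [] \<omega> = 0" "step_integral X ((c, p, q) # h) \<omega> = c * (X q \<omega> - X p \<omega>) + step_integral X h \<omega>"
  "step_integral X (h @ h') \<omega> = step_integral X h \<omega> + step_integral X h' \<omega>"
  by (simp_all add: step_integral_def)

lemma step_on_simps [simp]:
  "step_on a b []" "step_on a b ((c, p, q) # h) \<longleftrightarrow> a \<le> p \<and> p \<le> q \<and> q \<le> b \<and> step_on a b h"
  "step_on a b (h @ h') \<longleftrightarrow> step_on a b h \<and> step_on a b h'"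
  by (simp_all add: step_on_def ball_Un conj_assoc)

lemma step_on_mono: "step_on a b h \<Longrightarrow> a' \<le> a \<Longrightarrow> b \<le> b' \<Longrightarrow> step_on a' b' h"
  by (fastforce simp: step_on_def)

text \<open>One operation for both uses: \<open>f\<close> rescales heights, while \<open>g\<close>
  moves endpoints, in particular by clamping them at a given time.\<close>

definition step_map :: "(real \<Rightarrow> real) \<Rightarrow> (real \<Rightarrow> real) \<Rightarrow> step \<Rightarrow> step" where
  "step_map f g h = map (\<lambda>(c, p, q). (f c, g p, g q)) h"

lemma step_map_simps [simp]:
  "step_map f g [] = []" "step_map f g ((c, p, q) # h) = (f c, g p, g q) # step_map f g h"
  by (simp_all add: step_map_def)

abbreviation step_scale :: "real \<Rightarrow> step \<Rightarrow> step" where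
  "step_scale r \<equiv> step_map ((*) r) id"

lemma step_scale:
  "step_on a b h \<Longrightarrow> step_on a b (step_scale r h)"
  "step_fun (step_scale r h) v = r * step_fun h v"
  "step_integral X (step_scale r h) \<omega> = r * step_integral X h \<omega>"
  by (induction h) (auto simp: algebra_simps)

text \<open>Clamping endpoints with \<open>min r\<close> or \<open>max r\<close> collapses the
  intervals on the wrong side to empty ones, whose increments vanish. An interval that contains
  \<open>r\<close> is cut there, and its increment telescopes.\<close>

lemma step_truncate:
  assumes "step_on a b h" "a \<le> r" "r \<le> b"
  shows "step_on a r (step_map id (min r) h)" "step_on r b (step_map id (max r) h)"
    "step_fun (step_map id (min r) h) v = indicator {..r} v * step_fun h v"
    "step_fun (step_map id (max r) h) v = indicator {r<..} v * step_fun h v"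
    "step_integral X h \<omega> = step_integral X (step_map id (min r) h) \<omega> + step_integral X (step_map id (max r) h) \<omega>"
proof -
  show "step_on a r (step_map id (min r) h)" "step_on r b (step_map id (max r) h)"
    using assms by (induction h) auto
  show "step_fun (step_map id (min r) h) v = indicator {..r} v * step_fun h v"
    "step_fun (step_map id (max r) h) v = indicator {r<..} v * step_fun h v"
    by (induction h) (auto simp: algebra_simps indicator_def)
  show "step_integral X h \<omega> = step_integral X (step_map id (min r) h) \<omega> + step_integral X (step_map id (max r) h) \<omega>"
    by (induction h) (auto simp: algebra_simps min_def max_def)
qed

lemma measurable_step_fun [measurable]: "step_fun h \<in> borel_measurable borel"
proof (induction h)
  case (Cons x h)
  then show ?case by (cases x) (simp add: step_fun_simps(2)[abs_def])
qed (simp add: step_fun_simps(1)[abs_def])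

lemma step_fun_outside: "step_on a b h \<Longrightarrow> v \<notin> {a<..b} \<Longrightarrow> step_fun h v = 0"
  by (induction h) (auto simp: indicator_def)

lemma step_fun_bounded: "\<bar>step_fun h v\<bar> \<le> (\<Sum>(c, p, q)\<leftarrow>h. \<bar>c\<bar>)"
proof (induction h)
  case (Cons x h)
  then show ?case by (cases x) (auto simp: indicator_def intro: order_trans[OF abs_triangle_ineq])
qed simp

lemma finite_set_enumeration:
  fixes P :: "real set"
  assumes P: "finite P" "a \<in> P" "b \<in> P" "P \<subseteq> {a..b}"
  obtains U :: "nat \<Rightarrow> real" and n where "incseq U" "U 0 = a" "U n = b" "P = U ` {..n}"
    "strict_mono_on {..n} U"
proof -
  define xs where "xs = sorted_list_of_set P"
  have xs: "set xs = P" "sorted xs" "distinct xs" "xs \<noteq> []"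
    using P by (auto simp: xs_def)
  define n where "n = length xs - 1"
  \<comment> \<open>The index saturates at \<open>n\<close>, so that \<open>U\<close> is monotone on
    all of \<open>nat\<close>, as the grid lemmas require.\<close>
  define U where "U = (\<lambda>k. xs ! min k n)"
  have len: "length xs = Suc n" using xs by (simp add: n_def)
  have inc: "incseq U"
    unfolding incseq_def U_def using xs len by (auto intro!: sorted_nth_mono)
  have im: "P = U ` {..n}"
    unfolding xs(1)[symmetric] set_conv_nth len U_def by (force simp: less_Suc_eq_le image_iff)
  have "strict_mono_on {..n} U"
  proof (rule strict_mono_onI)
    fix i j assume "i \<in> {..n}" "j \<in> {..n}" "i < j"
    then have "U i \<le> U j" "U i \<noteq> U j"
      using incseqD[OF inc, of i j] xs(3) len by (auto simp: U_def nth_eq_iff_index_eq)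
    then show "U i < U j" by simp
  qed
  moreover have "U 0 = a"
  proof -
    obtain i where "a = U i" "i \<le> n" using P(2) im by auto
    then show ?thesis using incseqD[OF inc, of 0 i] P(4) im by force
  qed
  moreover have "U n = b"
  proof -
    obtain i where "b = U i" "i \<le> n" using P(3) im by auto
    then show ?thesis using incseqD[OF inc, of i n] P(4) im by force
  qed
  ultimately show ?thesis using that inc im by blast
qed

text \<open>All endpoints together give a common refinement with disjoint cells. The same
  coefficients represent the function and the integral, so pointwise operations on the function can
  be followed in the integral despite overlaps in the list.\<close>

lemma step_grid:
  fixes X :: "real \<Rightarrow> 'b \<Rightarrow> real"
  assumes h: "step_on a b h" and ab: "a \<le> b"
  obtains U :: "nat \<Rightarrow> real" and n c where "incseq U" "U 0 = a" "U n = b"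
    "\<forall>v. step_fun h v = (\<Sum>k<n. c k * indicator {U k<..U (Suc k)} v)"
    "\<forall>\<omega>. step_integral X h \<omega> = (\<Sum>k<n. c k * (X (U (Suc k)) \<omega> - X (U k) \<omega>))"
proof -
  define P where "P = insert a (insert b ((\<lambda>x. fst (snd x)) ` set h \<union> (\<lambda>x. snd (snd x)) ` set h))"
  have P: "finite P" "a \<in> P" "b \<in> P" "P \<subseteq> {a..b}"
    using h ab by (fastforce simp: P_def step_on_def)+
  obtain U n where U: "incseq U" "U 0 = a" "U n = b" "P = U ` {..n}" "strict_mono_on {..n} U"
    using finite_set_enumeration[OF P] by blast
  have less_iff: "U i < U j \<longleftrightarrow> i < j" if "i \<le> n" "j \<le> n" for i j
    using strict_mono_on_less[OF U(5)] that by auto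
  have le_iff: "U i \<le> U j \<longleftrightarrow> i \<le> j" if "i \<le> n" "j \<le> n" for i j
    using less_iff[of j i] that by (auto simp: not_less[symmetric])
  \<comment> \<open>The right endpoint belongs to its half-open cell, so it represents the constant
    value there.\<close>
  define c where "c = (\<lambda>k. step_fun h (U (Suc k)))"
  have hP: "\<forall>x\<in>set h. fst (snd x) \<in> U ` {..n} \<and> snd (snd x) \<in> U ` {..n} \<and> fst (snd x) \<le> snd (snd x)"
  proof (intro ballI conjI)
    fix x assume x: "x \<in> set h"
    then have "fst (snd x) \<in> P" "snd (snd x) \<in> P" by (auto simp: P_def)
    then show "fst (snd x) \<in> U ` {..n}" "snd (snd x) \<in> U ` {..n}" unfolding U(4) .
    show "fst (snd x) \<le> snd (snd x)" using h x by (cases x) (auto simp: step_on_def)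
  qed
  have "step_fun h v = (\<Sum>k<n. c k * indicator {U k<..U (Suc k)} v)" for v
  proof (cases "v \<in> {U 0<..U n}")
    case True
    then obtain k where k: "k < n" "v \<in> {U k<..U (Suc k)}" using grid_exists[OF True] by blast
    have "step_fun h v = step_fun h (U (Suc k))"
      using hP
    proof (induction h)
      case (Cons x h)
      obtain d p q where x: "x = (d, p, q)" by (cases x)
      from Cons.prems x obtain i j where ij: "p = U i" "q = U j" "i \<le> n" "j \<le> n" by auto
      \<comment> \<open>Both interval ends are grid points, so no end separates \<open>v\<close>
        from the right endpoint of its cell.\<close>
      have "U i < v \<longleftrightarrow> U i < U (Suc k)" "v \<le> U j \<longleftrightarrow> U (Suc k) \<le> U j"
        using k ij less_iff[of i "Suc k"] le_iff[of "Suc k" j] le_iff[of i k] less_iff[of k j]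
        by (auto simp: less_Suc_eq_le Suc_le_eq)
      then have "indicator {p<..q} v = (indicator {p<..q} (U (Suc k)) :: real)"
        unfolding ij indicator_def by simp
      then show ?case using Cons by (simp add: x)
    qed simp
    then show ?thesis using grid_indicator_sum[OF U(1) k, of c] by (simp add: c_def)
  next
    case False
    then show ?thesis
      using grid_indicator_sum_outside[OF U(1) False, of c] step_fun_outside[OF h, of v] U by simp
  qed
  moreover have "step_integral X h \<omega> = (\<Sum>k<n. c k * (X (U (Suc k)) \<omega> - X (U k) \<omega>))"
    for \<omega>
    unfolding c_def using hP
  proof (induction h)
    case (Cons x h)
    obtain d p q where x: "x = (d, p, q)" by (cases x)
    from Cons.prems x obtain i j where ij: "p = U i" "q = U j" "i \<le> n" "j \<le> n" "U i \<le> U j" by auto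
    have ij': "i \<le> j" using ij le_iff by blast
    have "(\<Sum>k<n. indicator {p<..q} (U (Suc k)) * (X (U (Suc k)) \<omega> - X (U k) \<omega>)) =
        (\<Sum>k\<in>{i..<j}. X (U (Suc k)) \<omega> - X (U k) \<omega>)"
    proof (rule sum.mono_neutral_cong_right)
      show "{i..<j} \<subseteq> {..<n}" using ij by auto
      show "\<forall>k\<in>{..<n} - {i..<j}. indicator {p<..q} (U (Suc k)) * (X (U (Suc k)) \<omega> - X (U k) \<omega>) = 0"
        using ij by (auto simp: indicator_def less_iff le_iff)
      show "indicator {p<..q} (U (Suc k)) * (X (U (Suc k)) \<omega> - X (U k) \<omega>) = X (U (Suc k)) \<omega> - X (U k) \<omega>"
        if "k \<in> {i..<j}" for k
        using that ij less_iff[of i "Suc k"] le_iff[of "Suc k" j] by (auto simp: indicator_def)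
    qed simp
    also have "\<dots> = X q \<omega> - X p \<omega>"
      unfolding ij using ij' by (rule sum_Suc_diff')
    finally have "d * (X q \<omega> - X p \<omega>) =
        (\<Sum>k<n. d * indicator {p<..q} (U (Suc k)) * (X (U (Suc k)) \<omega> - X (U k) \<omega>))"
      unfolding mult.assoc sum_distrib_left[symmetric] by (simp only:)
    moreover have "step_integral X h \<omega> = (\<Sum>k<n. step_fun h (U (Suc k)) * (X (U (Suc k)) \<omega> - X (U k) \<omega>))"
      using Cons by simp
    ultimately show ?case
      by (simp only: x step_integral_simps step_fun_simps distrib_right sum.distrib)
  qed simp
  ultimately show ?thesis using that U by blast
qed

lemma grid_step:
  assumes "incseq U"
  shows "step_on (U 0) (U n) (map (\<lambda>k. (c k, U k, U (Suc k))) [0..<n])"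
    "step_fun (map (\<lambda>k. (c k, U k, U (Suc k))) [0..<n]) v = (\<Sum>k<n. c k * indicator {U k<..U (Suc k)} v)"
    "step_integral X (map (\<lambda>k. (c k, U k, U (Suc k))) [0..<n]) \<omega> = (\<Sum>k<n. c k * (X (U (Suc k)) \<omega> - X (U k) \<omega>))"
proof -
  show "step_on (U 0) (U n) (map (\<lambda>k. (c k, U k, U (Suc k))) [0..<n])"
    using incseqD[OF assms] by (auto simp: step_on_def)
qed (simp_all add: step_fun_def step_integral_def o_def interv_sum_list_conv_sum_set_nat atLeast0LessThan)

text \<open>At most one summand is nonzero at each point; \<open>g 0 = 0\<close> settles the points
  outside the grid. It is applied to \<psi>, to \<open>psi_sup\<close> and to the absolute
  value.\<close>

lemma grid_compose:
  fixes g :: "real \<Rightarrow> 'b :: real_algebra_1" and U :: "nat \<Rightarrow> real"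
  assumes U: "incseq U" and g0: "g 0 = 0"
  shows "g (\<Sum>k<n. c k * indicator {U k<..U (Suc k)} v) = (\<Sum>k<n. g (c k) * indicator {U k<..U (Suc k)} v)"
proof (cases "v \<in> {U 0<..U n}")
  case True
  then obtain k where k: "k < n" "v \<in> {U k<..U (Suc k)}" using grid_exists[OF True] by blast
  show ?thesis
    using grid_indicator_sum[OF U k, of c] grid_indicator_sum[OF U k, of "\<lambda>k. g (c k)"] by simp
next
  case False
  show ?thesis
    using grid_indicator_sum_outside[OF U False, of c] grid_indicator_sum_outside[OF U False, of "\<lambda>k. g (c k)"] g0
    by simp
qed

lemma integral_grid:
  fixes g :: "nat \<Rightarrow> 'b :: {banach, second_countable_topology, real_algebra_1}"
  assumes U: "incseq U"
  shows "integrable lborel (\<lambda>v. \<Sum>k<n. g k * indicator {U k<..U (Suc k)} v)"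
    "(LBINT v. (\<Sum>k<n. g k * indicator {U k<..U (Suc k)} v)) = (\<Sum>k<n. (U (Suc k) - U k) *\<^sub>R g k)"
proof -
  have eq: "g k * indicator {U k<..U (Suc k)} v = indicator {U k<..U (Suc k)} v *\<^sub>R g k" for k v
    by (simp add: indicator_def)
  have int: "integrable lborel (\<lambda>v. indicator {U k<..U (Suc k)} v *\<^sub>R g k)" for k
    using incseqD[OF U, of k "Suc k"] by (intro integrable_scaleR_left integrable_real_indicator) auto
  show "integrable lborel (\<lambda>v. \<Sum>k<n. g k * indicator {U k<..U (Suc k)} v)"
    unfolding eq by (intro Bochner_Integration.integrable_sum int)
  show "(LBINT v. (\<Sum>k<n. g k * indicator {U k<..U (Suc k)} v)) = (\<Sum>k<n. (U (Suc k) - U k) *\<^sub>R g k)"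
    unfolding eq Bochner_Integration.integral_sum[OF int] using incseqD[OF U] by simp
qed

text \<open>A continuous path from 0 whose exponential stays near 1 cannot reach another period of
  \<open>exp\<close>. If it left the small disc, it would pass through a modulus \<open>r\<close> at
  which \<open>Ln\<close> still inverts \<open>exp\<close>, contradicting the linear bound on
  \<open>Ln\<close> near 1.\<close>

lemma norm_le_of_exp_close:
  fixes w :: "real \<Rightarrow> complex"
  assumes w: "continuous_on {0..1} w" "w 0 = 0"
    and close: "\<And>t. t \<in> {0..1} \<Longrightarrow> cmod (exp (w t) - 1) \<le> \<epsilon>" and \<epsilon>: "\<epsilon> < 1 / 2"
  shows "cmod (w 1) \<le> 2 * \<epsilon>"
proof (rule ccontr)
  assume "\<not> cmod (w 1) \<le> 2 * \<epsilon>"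
  \<comment> \<open>The cap at 1 keeps the imaginary part within the principal strip, and
    \<open>r > 2 * \<epsilon>\<close> still holds because \<open>\<epsilon> < 1 / 2\<close>.\<close>
  define r where "r = min 1 (cmod (w 1))"
  have r: "2 * \<epsilon> < r" "r \<le> cmod (w 1)" "r \<le> 1"
    using \<open>\<not> cmod (w 1) \<le> 2 * \<epsilon>\<close> \<epsilon> by (auto simp: r_def)
  have "\<epsilon> \<ge> 0" using close[of 0] w(2) by simp
  have "\<exists>t\<ge>0. t \<le> 1 \<and> cmod (w t) = r"
    using r \<open>\<epsilon> \<ge> 0\<close> w by (intro IVT') (auto intro: continuous_intros)
  then obtain t where t: "t \<in> {0..1}" "cmod (w t) = r" by auto
  have "\<bar>Im (w t)\<bar> \<le> 1" using abs_Im_le_cmod[of "w t"] t r by linarith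
  then have "Ln (exp (w t)) = w t"
    using pi_gt3 by (intro Ln_exp) auto
  moreover have "cmod (Ln (1 + (exp (w t) - 1))) \<le> 2 * cmod (exp (w t) - 1)"
    using close[OF t(1)] \<epsilon> by (intro norm_Ln_le) auto
  ultimately show False using close[OF t(1)] t r by simp
qed

text \<open>Cancellation is excluded by testing the subsets of fixed sign. One factor 2 comes from
  the two signs, the other from real and imaginary parts.\<close>

lemma sum_norm_le_of_subset_sums:
  fixes z :: "'b \<Rightarrow> complex"
  assumes A: "finite A" and sub: "\<And>J. J \<subseteq> A \<Longrightarrow> cmod (\<Sum>k\<in>J. z k) \<le> \<delta>"
  shows "(\<Sum>k\<in>A. cmod (z k)) \<le> 4 * \<delta>"
proof -
  have real: "(\<Sum>k\<in>A. \<bar>f k\<bar>) \<le> 2 * \<delta>" if f: "\<And>J. J \<subseteq> A \<Longrightarrow> \<bar>\<Sum>k\<in>J. f k\<bar> \<le> \<delta>" for f :: "'b \<Rightarrow> real"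
  proof -
    have "(\<Sum>k\<in>A. \<bar>f k\<bar>) = (\<Sum>k\<in>A \<inter> {k. f k \<ge> 0}. \<bar>f k\<bar>) + (\<Sum>k\<in>A - {k. f k \<ge> 0}. \<bar>f k\<bar>)"
      by (rule sum.Int_Diff[OF A])
    also have "(\<Sum>k\<in>A \<inter> {k. f k \<ge> 0}. \<bar>f k\<bar>) = (\<Sum>k\<in>A \<inter> {k. f k \<ge> 0}. f k)"
      by (rule sum.cong) auto
    also have "(\<Sum>k\<in>A - {k. f k \<ge> 0}. \<bar>f k\<bar>) = - (\<Sum>k\<in>A - {k. f k \<ge> 0}. f k)"
      unfolding sum_negf[symmetric] by (rule sum.cong) auto
    finally show ?thesis
      using f[of "A \<inter> {k. f k \<ge> 0}"] f[of "A - {k. f k \<ge> 0}"] by auto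
  qed
  have "(\<Sum>k\<in>A. cmod (z k)) \<le> (\<Sum>k\<in>A. \<bar>Re (z k)\<bar> + \<bar>Im (z k)\<bar>)"
    by (rule sum_mono) (rule cmod_le)
  also have "\<dots> \<le> 2 * \<delta> + 2 * \<delta>"
    unfolding sum.distrib
  proof (intro add_mono real)
    fix J assume J: "J \<subseteq> A"
    show "\<bar>\<Sum>k\<in>J. Re (z k)\<bar> \<le> \<delta>" "\<bar>\<Sum>k\<in>J. Im (z k)\<bar> \<le> \<delta>"
      using abs_Re_le_cmod[of "\<Sum>k\<in>J. z k"] abs_Im_le_cmod[of "\<Sum>k\<in>J. z k"] sub[OF J]
      by (simp_all only: Re_sum Im_sum)
  qed
  finally show ?thesis by simp
qed

lemma (in prob_space) expectation_iexp_minus_1_le: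
  assumes Y[measurable]: "Y \<in> borel_measurable M" and e: "e > 0"
  shows "(\<integral>\<omega>. cmod (iexp (Y \<omega>) - 1) \<partial>M) \<le> e + 2 * prob {\<omega> \<in> space M. \<bar>Y \<omega>\<bar> \<ge> e}"
proof -
  have int: "integrable M (\<lambda>\<omega>. iexp (Y \<omega>) - 1)"
    by (intro Bochner_Integration.integrable_diff integrable_iexp) auto
  let ?A = "{\<omega> \<in> space M. \<bar>Y \<omega>\<bar> \<ge> e}"
  have A: "?A \<in> sets M" by measurable
  have "(\<integral>\<omega>. cmod (iexp (Y \<omega>) - 1) \<partial>M) \<le> (\<integral>\<omega>. e + 2 * indicator ?A \<omega> \<partial>M)"
  proof (rule integral_mono)
    show "integrable M (\<lambda>\<omega>. cmod (iexp (Y \<omega>) - 1))" using int by (rule integrable_norm)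
    show "integrable M (\<lambda>\<omega>. e + 2 * indicator ?A \<omega>)" using A by (simp add: emeasure_eq_measure)
    fix \<omega> assume \<omega>: "\<omega> \<in> space M"
    have "cmod (iexp (Y \<omega>) - 1) \<le> \<bar>Y \<omega>\<bar>" using iexp_approx1[of "Y \<omega>" 0] by simp
    moreover have "cmod (iexp (Y \<omega>) - 1) \<le> 2"
      using norm_triangle_ineq4[of "iexp (Y \<omega>)" 1] by simp
    ultimately show "cmod (iexp (Y \<omega>) - 1) \<le> e + 2 * indicator ?A \<omega>"
      using \<omega> e by (auto simp: indicator_def)
  qed
  also have "\<dots> = e + 2 * prob ?A"
    using A by (subst Bochner_Integration.integral_add) (auto simp: prob_space emeasure_eq_measure)
  finally show ?thesis .
qed

section \<open>Expectations of exponentials of step integrals\<close>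

context levy
begin

text \<open>Independence holds between \<open>F r\<close> and the sigma-algebra of the increment; it
  descends to the smaller sigma-algebras generated by \<open>V\<close> and by the exponential, so
  the expectation factorizes.\<close>

lemma expectation_mult_increment:
  fixes V :: "'a \<Rightarrow> complex"
  assumes r: "0 \<le> r" "r \<le> r'" and V: "V \<in> borel_measurable (F r)" and bd: "\<And>\<omega>. cmod (V \<omega>) \<le> K"
  shows "(CLINT \<omega>|M. V \<omega> * iexp (c * (X r' \<omega> - X r \<omega>))) = (CLINT \<omega>|M. V \<omega>) * exp (complex_of_real (r' - r) * \<psi> c)"
proof -
  let ?D = "\<lambda>\<omega>. X r' \<omega> - X r \<omega>"
  have VM[measurable]: "V \<in> borel_measurable M" using measurable_F[OF V r(1)] .
  have [measurable]: "X r \<in> borel_measurable M" "X r' \<in> borel_measurable M"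
    using measurable_X_M r by auto
  have m': "(\<lambda>\<omega>. iexp (c * ?D \<omega>)) \<in> borel_measurable M" by measurable
  have "indep_set (sets (F r)) (sets (generated M ?D))"
    using levy r unfolding levy_process_def by blast
  then have "indep_set (sigma_sets (space M) {V -` A \<inter> space M | A. A \<in> sets borel})
     (sigma_sets (space M) {(\<lambda>\<omega>. iexp (c * ?D \<omega>)) -` A \<inter> space M | A. A \<in> sets borel})"
    unfolding indep_sets2_eq
  proof (elim conjE, intro conjI)
    assume sub: "sets (F r) \<subseteq> events" "sets (generated M ?D) \<subseteq> events"
      and ind: "\<forall>a\<in>sets (F r). \<forall>b\<in>sets (generated M ?D). prob (a \<inter> b) = prob a * prob b"
    have sp: "space (F r) = space M" using subalgebra_F[OF r(1)] by (simp add: subalgebra_def)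
    have 1: "sigma_sets (space M) {V -` A \<inter> space M | A. A \<in> sets borel} \<subseteq> sets (F r)"
      unfolding sp[symmetric] by (rule sets.sigma_sets_subset) (use measurable_sets[OF V] in auto)
    have "?D \<in> measurable (generated M ?D) borel"
      unfolding generated_def by (rule measurable_vimage_algebra1) simp
    then have m: "(\<lambda>\<omega>. iexp (c * ?D \<omega>)) \<in> borel_measurable (generated M ?D)" by measurable
    have sp': "space (generated M ?D) = space M" by (simp add: generated_def)
    have 2: "sigma_sets (space M) {(\<lambda>\<omega>. iexp (c * ?D \<omega>)) -` A \<inter> space M | A. A \<in> sets borel} \<subseteq> sets (generated M ?D)"
      unfolding sp'[symmetric] by (rule sets.sigma_sets_subset) (use measurable_sets[OF m] in auto)
    show "sigma_sets (space M) {V -` A \<inter> space M | A. A \<in> sets borel} \<subseteq> events"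
      "sigma_sets (space M) {(\<lambda>\<omega>. iexp (c * ?D \<omega>)) -` A \<inter> space M | A. A \<in> sets borel} \<subseteq> events"
      using 1 2 sub by auto
    show "\<forall>a\<in>sigma_sets (space M) {V -` A \<inter> space M | A. A \<in> sets borel}.
      \<forall>b\<in>sigma_sets (space M) {(\<lambda>\<omega>. iexp (c * ?D \<omega>)) -` A \<inter> space M | A. A \<in> sets borel}. prob (a \<inter> b) = prob a * prob b"
      using 1 2 ind by blast
  qed
  then have "indep_var borel V borel (\<lambda>\<omega>. iexp (c * ?D \<omega>))"
    unfolding indep_var_eq using VM m' by blast
  moreover have "integrable M V"
    by (rule integrable_const_bound[of _ K]) (use bd in auto)
  moreover have "integrable M (\<lambda>\<omega>. iexp (c * ?D \<omega>))"
    by (rule integrable_const_bound[of _ 1]) (use m' in auto)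
  ultimately have "(CLINT \<omega>|M. V \<omega> * iexp (c * ?D \<omega>)) = (CLINT \<omega>|M. V \<omega>) * (CLINT \<omega>|M. iexp (c * ?D \<omega>))"
    by (rule indep_var_lebesgue_integral)
  then show ?thesis unfolding expectation_iexp_increment[OF r] .
qed

text \<open>Induction over the cells: \<open>W\<close> times the exponential of the first
  \<open>n\<close> increments is measurable at time \<open>U n\<close> and bounded by
  \<open>K\<close>, so it serves as the past factor for the next increment.\<close>

lemma expectation_grid:
  fixes W :: "'a \<Rightarrow> complex"
  assumes U: "incseq U" "0 \<le> U 0" and W: "W \<in> borel_measurable (F (U 0))" and bd: "\<And>\<omega>. cmod (W \<omega>) \<le> K"
  shows "(CLINT \<omega>|M. W \<omega> * iexp (\<Sum>k<n. c k * (X (U (Suc k)) \<omega> - X (U k) \<omega>))) =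
    (CLINT \<omega>|M. W \<omega>) * exp (\<Sum>k<n. complex_of_real (U (Suc k) - U k) * \<psi> (c k))"
proof (induction n)
  case (Suc n)
  let ?S = "\<lambda>\<omega>. \<Sum>k<n. c k * (X (U (Suc k)) \<omega> - X (U k) \<omega>)"
  have U0: "0 \<le> U k" for k using incseqD[OF U(1), of 0 k] U(2) by linarith
  have X: "X (U k) \<in> borel_measurable (F (U n))" if "k \<le> n" for k
    using measurable_F_mono[OF measurable_X[OF U0] U0] incseqD[OF U(1) that] by blast
  have [measurable]: "?S \<in> borel_measurable (F (U n))"
    using X by (intro borel_measurable_sum borel_measurable_times borel_measurable_diff) auto
  have [measurable]: "W \<in> borel_measurable (F (U n))"
    using measurable_F_mono[OF W U(2)] incseqD[OF U(1), of 0 n] by blast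
  have "(CLINT \<omega>|M. (W \<omega> * iexp (?S \<omega>)) * iexp (c n * (X (U (Suc n)) \<omega> - X (U n) \<omega>))) =
    (CLINT \<omega>|M. W \<omega> * iexp (?S \<omega>)) * exp (complex_of_real (U (Suc n) - U n) * \<psi> (c n))"
  proof (rule expectation_mult_increment)
    show "(\<lambda>\<omega>. W \<omega> * iexp (?S \<omega>)) \<in> borel_measurable (F (U n))" by measurable
    show "cmod (W \<omega> * iexp (?S \<omega>)) \<le> K" for \<omega> using bd by (simp add: norm_mult)
  qed (use U0 incseqD[OF U(1), of n "Suc n"] in auto)
  then show ?case unfolding Suc.IH
    by (simp add: exp_add distrib_left mult.assoc)
qed simp

lemma measurable_step_integral:
  assumes "step_on a b h" "0 \<le> a" shows "step_integral X h \<in> borel_measurable M"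
  using assms
proof (induction h)
  case (Cons x h)
  obtain c p q where x: "x = (c, p, q)" by (cases x)
  have [measurable]: "step_integral X h \<in> borel_measurable M" "X p \<in> borel_measurable M" "X q \<in> borel_measurable M"
    using Cons measurable_X_M[of p] measurable_X_M[of q] by (auto simp: x)
  show ?case unfolding x step_integral_simps(2)[abs_def] by measurable
qed (simp add: step_integral_simps(1)[abs_def])

lemma integrable_exponent_step:
  assumes "step_on a b h" "a \<le> b" shows "integrable lborel (\<lambda>v. \<psi> (step_fun h v))"
proof -
  obtain U n c where U: "incseq U" "U 0 = a" "U n = b"
    and eq: "\<forall>v. step_fun h v = (\<Sum>k<n. c k * indicator {U k<..U (Suc k)} v)"
    "\<forall>\<omega>. step_integral X h \<omega> = (\<Sum>k<n. c k * (X (U (Suc k)) \<omega> - X (U k) \<omega>))"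
    by (rule step_grid[OF assms, of X])
  note eq = eq[rule_format]
  show ?thesis
    unfolding eq grid_compose[OF U(1), of \<psi>, OF exponent_0] by (rule integral_grid(1)[OF U(1)])
qed

lemma expectation_step:
  fixes W :: "'a \<Rightarrow> complex"
  assumes h: "step_on a b h" "0 \<le> a" "a \<le> b"
    and W: "W \<in> borel_measurable (F a)" and bd: "\<And>\<omega>. cmod (W \<omega>) \<le> K"
  shows "(CLINT \<omega>|M. W \<omega> * iexp (step_integral X h \<omega>)) = (CLINT \<omega>|M. W \<omega>) * exp (CLBINT v. \<psi> (step_fun h v))"
proof -
  obtain U n c where U: "incseq U" "U 0 = a" "U n = b"
    and eq: "\<forall>v. step_fun h v = (\<Sum>k<n. c k * indicator {U k<..U (Suc k)} v)"
    "\<forall>\<omega>. step_integral X h \<omega> = (\<Sum>k<n. c k * (X (U (Suc k)) \<omega> - X (U k) \<omega>))"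
    by (rule step_grid[OF h(1,3), of X])
  note eq = eq[rule_format]
  show ?thesis
    unfolding eq grid_compose[OF U(1), of \<psi>, OF exponent_0] integral_grid(2)[OF U(1)]
    using expectation_grid[OF U(1) _ _ bd, where n = n and c = c] U(2) h(2) W by (simp add: scaleR_conv_of_real)
qed

text \<open>With values in \<open>ennreal\<close> it is meaningful before integrability is known;
  finiteness is derived for step functions first and for their limits in
  \<open>psi_integral_finite\<close>.\<close>

definition psi_mean :: "(real \<Rightarrow> real) \<Rightarrow> ennreal" where
  "psi_mean f = (\<integral>\<^sup>+ v. ennreal (psi_sup (f v)) \<partial>lborel)"

text \<open>
  Replacing \<open>h\<close> on any set of grid intervals by \<open>\<theta> h\<close>, and by 0 on the others, gives an admissible
  \<open>h'\<close>. Scaling it by \<open>r \<in> [0, 1]\<close> gives a path of exponents from 0, so closeness of their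
  exponentials to 1 bounds the exponents themselves, not only modulo \<open>2 \<pi> i\<close>; the freedom in the
  choice of intervals then bounds the sum of their absolute values.
\<close>

lemma psi_mean_step_le:
  assumes h: "step_on a b h" "0 \<le> a" "a \<le> b" and \<epsilon>: "\<epsilon> < 1 / 2"
    and close: "\<And>h'. step_on a b h' \<Longrightarrow> (\<forall>v. \<bar>step_fun h' v\<bar> \<le> \<bar>step_fun h v\<bar>) \<Longrightarrow>
      cmod ((CLINT \<omega>|M. iexp (step_integral X h' \<omega>)) - 1) \<le> \<epsilon>"
  shows "psi_mean (step_fun h) \<le> ennreal (8 * \<epsilon>)"
proof -
  obtain U n c where U: "incseq U" "U 0 = a" "U n = b"
    and eq: "\<forall>v. step_fun h v = (\<Sum>k<n. c k * indicator {U k<..U (Suc k)} v)"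
    "\<forall>\<omega>. step_integral X h \<omega> = (\<Sum>k<n. c k * (X (U (Suc k)) \<omega> - X (U k) \<omega>))"
    by (rule step_grid[OF h(1,3), of X])
  note eq = eq[rule_format]
  have "\<forall>k. \<exists>t. t \<in> {-1..1} \<and> psi_sup (c k) = cmod (\<psi> (t * c k))"
    using psi_sup_attained by blast
  then obtain \<theta> where \<theta>: "\<And>k. \<theta> k \<in> {-1..1}" "\<And>k. psi_sup (c k) = cmod (\<psi> (\<theta> k * c k))"
    by (auto dest!: choice)
  have sums: "cmod (\<Sum>k\<in>J. complex_of_real (U (Suc k) - U k) * \<psi> (\<theta> k * c k)) \<le> 2 * \<epsilon>" if J: "J \<subseteq> {..<n}" for J
  proof -
    define d where "d = (\<lambda>t k. if k \<in> J then t * (\<theta> k * c k) else 0)"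
    define w where "w = (\<lambda>t. \<Sum>k<n. complex_of_real (U (Suc k) - U k) * \<psi> (d t k))"
    have "cmod (w 1) \<le> 2 * \<epsilon>"
    proof (rule norm_le_of_exp_close[OF _ _ _ \<epsilon>])
      have "continuous_on {0..1} (\<lambda>t. d t k)" for k
        unfolding d_def by (cases "k \<in> J") (auto intro!: continuous_intros)
      then show "continuous_on {0..1} w"
        unfolding w_def by (intro continuous_intros continuous_on_exponent_compose)
      have "d 0 k = 0" for k by (simp add: d_def)
      then show "w 0 = 0" by (simp add: w_def exponent_0)
      fix t :: real assume t: "t \<in> {0..1}"
      let ?h = "map (\<lambda>k. (d t k, U k, U (Suc k))) [0..<n]"
      have dk: "\<bar>d t k\<bar> \<le> \<bar>c k\<bar>" for k
      proof -
        have "\<bar>t\<bar> * (\<bar>\<theta> k\<bar> * \<bar>c k\<bar>) \<le> 1 * (1 * \<bar>c k\<bar>)"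
          using t \<theta>(1)[of k] by (intro mult_mono) (auto simp: abs_le_iff)
        then show ?thesis by (simp add: d_def abs_mult)
      qed
      have sub: "\<bar>step_fun ?h v\<bar> \<le> \<bar>step_fun h v\<bar>" for v
        unfolding eq grid_step(2)[OF U(1)] grid_compose[OF U(1), of abs, OF abs_zero]
        using dk by (intro sum_mono mult_right_mono) auto
      have "(CLINT \<omega>|M. iexp (step_integral X ?h \<omega>)) = exp (w t)"
        using expectation_grid[OF U(1), where W = "\<lambda>_. 1" and K = 1 and n = n and c = "d t"] h(2) U(2)
        by (simp add: grid_step(3)[OF U(1)] w_def prob_space)
      then show "cmod (exp (w t) - 1) \<le> \<epsilon>"
        using close[of ?h] sub grid_step(1)[OF U(1), of n "d t"] U by simp
    qed
    also have "w 1 = (\<Sum>k\<in>J. complex_of_real (U (Suc k) - U k) * \<psi> (\<theta> k * c k))"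
      unfolding w_def d_def using J
      by (intro sum.mono_neutral_cong_right) (auto simp: exponent_0)
    finally show ?thesis .
  qed
  have Ud: "U (Suc k) - U k \<ge> 0" for k using incseqD[OF U(1), of k "Suc k"] by simp
  have "(\<Sum>k<n. (U (Suc k) - U k) * psi_sup (c k)) = (\<Sum>k<n. cmod (complex_of_real (U (Suc k) - U k) * \<psi> (\<theta> k * c k)))"
    using Ud by (simp add: norm_mult \<theta>(2) abs_of_nonneg del: of_real_diff)
  \<comment> \<open>The 2 comes from \<open>norm_le_of_exp_close\<close>, the 4 from
    \<open>sum_norm_le_of_subset_sums\<close>; together they are the 8 of the conclusion.\<close>
  also have "\<dots> \<le> 4 * (2 * \<epsilon>)"
    by (rule sum_norm_le_of_subset_sums) (use sums in auto)
  finally have "(\<Sum>k<n. (U (Suc k) - U k) * psi_sup (c k)) \<le> 8 * \<epsilon>" by simp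
  moreover have "psi_mean (step_fun h) = ennreal (\<Sum>k<n. (U (Suc k) - U k) * psi_sup (c k))"
  proof -
    have "psi_mean (step_fun h) = ennreal (LBINT v. psi_sup (step_fun h v))"
      unfolding psi_mean_def
    proof (rule nn_integral_eq_integral)
      show "integrable lborel (\<lambda>v. psi_sup (step_fun h v))"
        unfolding eq grid_compose[OF U(1), of psi_sup, OF psi_sup_0] by (rule integral_grid(1)[OF U(1)])
    qed (simp add: psi_sup_nonneg)
    then show ?thesis
      unfolding eq grid_compose[OF U(1), of psi_sup, OF psi_sup_0] integral_grid(2)[OF U(1)] by simp
  qed
  ultimately show ?thesis by (simp add: ennreal_leI)
qed

end


section \<open>Stochastic integrals of deterministic integrands\<close>

lemma tendsto_squeeze_const:
  fixes f g :: "nat \<Rightarrow> 'b :: linorder_topology"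
  assumes "g \<longlonglongrightarrow> z" "\<And>n. z \<le> f n" "\<And>n. f n \<le> g n" shows "f \<longlonglongrightarrow> z"
  by (rule tendsto_sandwich[of "\<lambda>_. z" f _ g]) (use assms in auto)

section \<open>Convergence in probability and complex exponentials\<close>

context prob_space
begin

lemma tendsto_prob_add:
  assumes A: "tendsto_prob M A A'" and B: "tendsto_prob M B B'"
    and [measurable]: "\<And>n. A n \<in> borel_measurable M" "\<And>n. B n \<in> borel_measurable M"
      "A' \<in> borel_measurable M" "B' \<in> borel_measurable M"
  shows "tendsto_prob M (\<lambda>n \<omega>. A n \<omega> + B n \<omega>) (\<lambda>\<omega>. A' \<omega> + B' \<omega>)"
  unfolding tendsto_prob_def
proof (intro allI impI)
  fix e :: real assume e: "e > 0"
  have le: "prob {\<omega> \<in> space M. \<bar>A n \<omega> + B n \<omega> - (A' \<omega> + B' \<omega>)\<bar> \<ge> e} \<le>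
    prob {\<omega> \<in> space M. \<bar>A n \<omega> - A' \<omega>\<bar> \<ge> e / 2} + prob {\<omega> \<in> space M. \<bar>B n \<omega> - B' \<omega>\<bar> \<ge> e / 2}" for n
  proof -
    have "prob {\<omega> \<in> space M. \<bar>A n \<omega> + B n \<omega> - (A' \<omega> + B' \<omega>)\<bar> \<ge> e} \<le>
      prob ({\<omega> \<in> space M. \<bar>A n \<omega> - A' \<omega>\<bar> \<ge> e / 2} \<union> {\<omega> \<in> space M. \<bar>B n \<omega> - B' \<omega>\<bar> \<ge> e / 2})"
    proof (rule finite_measure_mono)
      have "\<bar>A n \<omega> - A' \<omega>\<bar> \<ge> e / 2 \<or> \<bar>B n \<omega> - B' \<omega>\<bar> \<ge> e / 2"
        if "\<bar>A n \<omega> + B n \<omega> - (A' \<omega> + B' \<omega>)\<bar> \<ge> e" for \<omega>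
        using that abs_triangle_ineq[of "A n \<omega> - A' \<omega>" "B n \<omega> - B' \<omega>"] by (simp add: algebra_simps) argo
      then show "{\<omega> \<in> space M. \<bar>A n \<omega> + B n \<omega> - (A' \<omega> + B' \<omega>)\<bar> \<ge> e} \<subseteq>
          {\<omega> \<in> space M. \<bar>A n \<omega> - A' \<omega>\<bar> \<ge> e / 2} \<union> {\<omega> \<in> space M. \<bar>B n \<omega> - B' \<omega>\<bar> \<ge> e / 2}"
        by blast
    qed measurable
    also have "\<dots> \<le> prob {\<omega> \<in> space M. \<bar>A n \<omega> - A' \<omega>\<bar> \<ge> e / 2} + prob {\<omega> \<in> space M. \<bar>B n \<omega> - B' \<omega>\<bar> \<ge> e / 2}"
      by (rule measure_Un_le) measurable
    finally show ?thesis .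
  qed
  have lim: "(\<lambda>n. prob {\<omega> \<in> space M. \<bar>A n \<omega> - A' \<omega>\<bar> \<ge> e / 2} + prob {\<omega> \<in> space M. \<bar>B n \<omega> - B' \<omega>\<bar> \<ge> e / 2}) \<longlonglongrightarrow> 0 + 0"
    by (intro tendsto_add A[unfolded tendsto_prob_def, rule_format] B[unfolded tendsto_prob_def, rule_format]
        half_gt_zero[OF e])
  show "(\<lambda>n. prob {\<omega> \<in> space M. \<bar>A n \<omega> + B n \<omega> - (A' \<omega> + B' \<omega>)\<bar> \<ge> e}) \<longlonglongrightarrow> 0"
    by (rule tendsto_squeeze_const[OF lim[unfolded mult_zero_right add_0_left] _ le]) simp
qed

lemma tendsto_prob_scale:
  assumes A: "tendsto_prob M A A'"
  shows "tendsto_prob M (\<lambda>n \<omega>. r * A n \<omega>) (\<lambda>\<omega>. r * A' \<omega>)"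
  unfolding tendsto_prob_def
proof (intro allI impI)
  fix e :: real assume e: "e > 0"
  show "(\<lambda>n. prob {\<omega> \<in> space M. \<bar>r * A n \<omega> - r * A' \<omega>\<bar> \<ge> e}) \<longlonglongrightarrow> 0"
  proof (cases "r = 0")
    case False
    have "\<bar>r * A n \<omega> - r * A' \<omega>\<bar> \<ge> e \<longleftrightarrow> \<bar>A n \<omega> - A' \<omega>\<bar> \<ge> e / \<bar>r\<bar>" for n \<omega>
      unfolding right_diff_distrib[symmetric] abs_mult using False by (simp add: pos_divide_le_eq mult.commute)
    then show ?thesis using A e False unfolding tendsto_prob_def by simp
  qed (use e in simp)
qed

text \<open>Factoring out a phase of modulus 1 reduces the difference to the expectation of
  \<open>cmod (iexp (Y n - Y') - 1)\<close>, which is small off an event of small probability and at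
  most 2 on it.\<close>

lemma expectation_iexp_tendsto_prob:
  fixes W :: "'a \<Rightarrow> complex"
  assumes Y: "tendsto_prob M Y Y'" and [measurable]: "\<And>n. Y n \<in> borel_measurable M" "Y' \<in> borel_measurable M"
    and [measurable]: "W \<in> borel_measurable M" and bd: "\<And>\<omega>. cmod (W \<omega>) \<le> 1"
  shows "(\<lambda>n. CLINT \<omega>|M. W \<omega> * iexp (Y n \<omega>)) \<longlonglongrightarrow> (CLINT \<omega>|M. W \<omega> * iexp (Y' \<omega>))"
proof (rule LIMSEQ_I)
  fix r :: real assume r: "r > 0"
  have int: "integrable M (\<lambda>\<omega>. W \<omega> * iexp (Z \<omega>))" if [measurable]: "Z \<in> borel_measurable M" for Z
    by (rule integrable_const_bound[of _ 1]) (use bd in \<open>auto simp: norm_mult\<close>)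
  have le: "cmod ((CLINT \<omega>|M. W \<omega> * iexp (Y n \<omega>)) - (CLINT \<omega>|M. W \<omega> * iexp (Y' \<omega>))) \<le>
      r / 2 + 2 * prob {\<omega> \<in> space M. \<bar>Y n \<omega> - Y' \<omega>\<bar> \<ge> r / 2}" for n
  proof -
    have "(CLINT \<omega>|M. W \<omega> * iexp (Y n \<omega>)) - (CLINT \<omega>|M. W \<omega> * iexp (Y' \<omega>)) =
        (CLINT \<omega>|M. W \<omega> * iexp (Y n \<omega>) - W \<omega> * iexp (Y' \<omega>))"
      by (rule Bochner_Integration.integral_diff[symmetric]) (auto intro: int)
    also have "cmod \<dots> \<le> (\<integral>\<omega>. cmod (W \<omega> * iexp (Y n \<omega>) - W \<omega> * iexp (Y' \<omega>)) \<partial>M)"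
      by (rule integral_norm_bound)
    also have "\<dots> \<le> (\<integral>\<omega>. cmod (iexp (Y n \<omega> - Y' \<omega>) - 1) \<partial>M)"
    proof (rule integral_mono)
      show "integrable M (\<lambda>\<omega>. cmod (W \<omega> * iexp (Y n \<omega>) - W \<omega> * iexp (Y' \<omega>)))"
        by (intro integrable_norm Bochner_Integration.integrable_diff int) auto
      show "integrable M (\<lambda>\<omega>. cmod (iexp (Y n \<omega> - Y' \<omega>) - 1))"
        by (intro integrable_norm Bochner_Integration.integrable_diff integrable_iexp) auto
      fix \<omega>
      have "W \<omega> * iexp (Y n \<omega>) - W \<omega> * iexp (Y' \<omega>) = W \<omega> * iexp (Y' \<omega>) * (iexp (Y n \<omega> - Y' \<omega>) - 1)"
        by (simp add: algebra_simps exp_add[symmetric])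
      also have "cmod \<dots> = cmod (W \<omega>) * cmod (iexp (Y n \<omega> - Y' \<omega>) - 1)"
        by (simp add: norm_mult)
      also have "\<dots> \<le> 1 * cmod (iexp (Y n \<omega> - Y' \<omega>) - 1)"
        by (rule mult_right_mono[OF bd]) simp
      finally show "cmod (W \<omega> * iexp (Y n \<omega>) - W \<omega> * iexp (Y' \<omega>)) \<le> cmod (iexp (Y n \<omega> - Y' \<omega>) - 1)" by simp
    qed
    also have "\<dots> \<le> r / 2 + 2 * prob {\<omega> \<in> space M. \<bar>Y n \<omega> - Y' \<omega>\<bar> \<ge> r / 2}"
      using r by (intro expectation_iexp_minus_1_le) auto
    finally show ?thesis .
  qed
  have "(\<lambda>n. prob {\<omega> \<in> space M. \<bar>Y n \<omega> - Y' \<omega>\<bar> \<ge> r / 2}) \<longlonglongrightarrow> 0"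
    by (rule Y[unfolded tendsto_prob_def, rule_format, OF half_gt_zero[OF r]])
  then have "\<forall>\<^sub>F n in sequentially. prob {\<omega> \<in> space M. \<bar>Y n \<omega> - Y' \<omega>\<bar> \<ge> r / 2} < r / 4"
    using r by (intro order_tendstoD) auto
  then have "\<forall>\<^sub>F n in sequentially. norm ((CLINT \<omega>|M. W \<omega> * iexp (Y n \<omega>)) - (CLINT \<omega>|M. W \<omega> * iexp (Y' \<omega>))) < r"
  proof eventually_elim
    case (elim n)
    then show ?case using le[of n] by linarith
  qed
  then show "\<exists>N. \<forall>n\<ge>N. norm ((CLINT \<omega>|M. W \<omega> * iexp (Y n \<omega>)) - (CLINT \<omega>|M. W \<omega> * iexp (Y' \<omega>))) < r"
    unfolding eventually_sequentially .
qed

text \<open>\<open>A\<close>, \<open>B\<close> and \<open>W\<close> may be dependent: that the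
  characteristic function of \<open>A\<close> is near 1 at the single argument 1 already makes
  \<open>iexp A\<close> close to 1 in mean, by weighted squares. This is what removes the part of an
  integral before time \<open>s\<close>.\<close>

lemma expectation_iexp_diff_le:
  fixes W :: "'a \<Rightarrow> complex"
  assumes [measurable]: "A \<in> borel_measurable M" "B \<in> borel_measurable M" "W \<in> borel_measurable M"
    and bd: "\<And>\<omega>. cmod (W \<omega>) \<le> 1" and \<eta>: "\<eta> > 0"
  shows "cmod ((CLINT \<omega>|M. W \<omega> * iexp (A \<omega> + B \<omega>)) - (CLINT \<omega>|M. W \<omega> * iexp (B \<omega>))) \<le>
    \<eta> / 2 + cmod (1 - (CLINT \<omega>|M. iexp (A \<omega>))) / \<eta>"
proof -
  have int: "integrable M (\<lambda>\<omega>. W \<omega> * iexp (Z \<omega>))" if [measurable]: "Z \<in> borel_measurable M" for Z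
    by (rule integrable_const_bound[of _ 1]) (use bd in \<open>auto simp: norm_mult\<close>)
  have i1: "integrable M (\<lambda>\<omega>. 1 - iexp (A \<omega>))"
    by (intro Bochner_Integration.integrable_diff integrable_iexp) auto
  have "(CLINT \<omega>|M. W \<omega> * iexp (A \<omega> + B \<omega>)) - (CLINT \<omega>|M. W \<omega> * iexp (B \<omega>)) =
      (CLINT \<omega>|M. W \<omega> * iexp (A \<omega> + B \<omega>) - W \<omega> * iexp (B \<omega>))"
    by (rule Bochner_Integration.integral_diff[symmetric]; rule int; measurable)
  also have "cmod \<dots> \<le> (\<integral>\<omega>. cmod (W \<omega> * iexp (A \<omega> + B \<omega>) - W \<omega> * iexp (B \<omega>)) \<partial>M)"
    by (rule integral_norm_bound)
  also have "\<dots> \<le> (\<integral>\<omega>. \<eta> / 2 + Re (1 - iexp (A \<omega>)) / \<eta> \<partial>M)"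
  proof (rule integral_mono)
    show "integrable M (\<lambda>\<omega>. cmod (W \<omega> * iexp (A \<omega> + B \<omega>) - W \<omega> * iexp (B \<omega>)))"
      by (intro integrable_norm Bochner_Integration.integrable_diff int) measurable
    show "integrable M (\<lambda>\<omega>. \<eta> / 2 + Re (1 - iexp (A \<omega>)) / \<eta>)"
      by (intro Bochner_Integration.integrable_add integrable_const integrable_divide integrable_Re i1)
    fix \<omega>
    have "W \<omega> * iexp (A \<omega> + B \<omega>) - W \<omega> * iexp (B \<omega>) = - (W \<omega> * iexp (B \<omega>) * (1 - iexp (A \<omega>)))"
      by (simp add: algebra_simps exp_add[symmetric])
    also have "cmod \<dots> = cmod (W \<omega>) * cmod (1 - iexp (A \<omega>))"
      by (simp add: norm_mult)
    also have "\<dots> \<le> 1 * cmod (1 - iexp (A \<omega>))"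
      by (rule mult_right_mono[OF bd]) simp
    also have "\<dots> \<le> \<eta> * (1\<^sup>2 / 2) + ((cmod (1 - iexp (A \<omega>)))\<^sup>2 / 2) / \<eta>"
      by (rule mult_le_weighted_squares[OF \<eta>]) auto
    finally show "cmod (W \<omega> * iexp (A \<omega> + B \<omega>) - W \<omega> * iexp (B \<omega>)) \<le> \<eta> / 2 + Re (1 - iexp (A \<omega>)) / \<eta>"
      unfolding cmod_one_minus_iexp by simp
  qed
  also have "\<dots> = \<eta> / 2 + Re (CLINT \<omega>|M. 1 - iexp (A \<omega>)) / \<eta>"
    unfolding integral_Re[OF i1, symmetric]
    by (subst Bochner_Integration.integral_add[OF integrable_const integrable_divide[OF integrable_Re[OF i1]]])
      (simp add: prob_space)
  also have "(CLINT \<omega>|M. 1 - iexp (A \<omega>)) = 1 - (CLINT \<omega>|M. iexp (A \<omega>))"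
    by (subst Bochner_Integration.integral_diff[OF integrable_const integrable_iexp]) (auto simp: prob_space)
  finally show ?thesis
    using divide_right_mono[OF complex_Re_le_cmod, of \<eta> "1 - (CLINT \<omega>|M. iexp (A \<omega>))"] \<eta> by linarith
qed

end

section \<open>The mean of the exponent and limits of step integrals\<close>

context levy
begin

lemma psi_mean_mono: "(\<And>v. \<bar>f v\<bar> \<le> \<bar>g v\<bar>) \<Longrightarrow> psi_mean f \<le> psi_mean g"
  unfolding psi_mean_def by (intro nn_integral_mono ennreal_leI psi_sup_mono) auto

lemma psi_mean_0: "psi_mean (\<lambda>v. 0) = 0"
  by (simp add: psi_mean_def psi_sup_0)

lemma psi_mean_add:
  assumes [measurable]: "f \<in> borel_measurable borel" "g \<in> borel_measurable borel"
  shows "psi_mean (\<lambda>v. f v + g v) \<le> 2 * psi_mean f + 2 * psi_mean g"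
proof -
  have "psi_mean (\<lambda>v. f v + g v) \<le> (\<integral>\<^sup>+ v. 2 * ennreal (psi_sup (f v)) + 2 * ennreal (psi_sup (g v)) \<partial>lborel)"
    unfolding psi_mean_def
  proof (rule nn_integral_mono)
    fix v
    have "ennreal (psi_sup (f v + g v)) \<le> ennreal (2 * psi_sup (f v) + 2 * psi_sup (g v))"
      by (rule ennreal_leI[OF psi_sup_add])
    also have "\<dots> = 2 * ennreal (psi_sup (f v)) + 2 * ennreal (psi_sup (g v))"
      by (simp add: ennreal_plus ennreal_mult psi_sup_nonneg)
    finally show "ennreal (psi_sup (f v + g v)) \<le> 2 * ennreal (psi_sup (f v)) + 2 * ennreal (psi_sup (g v))" .
  qed
  also have "\<dots> = 2 * psi_mean f + 2 * psi_mean g"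
    unfolding psi_mean_def by (simp add: nn_integral_add nn_integral_cmult)
  finally show ?thesis .
qed

lemma psi_mean_scale:
  "\<exists>C. \<forall>f \<in> borel_measurable borel. psi_mean (\<lambda>v. r * f v) \<le> ennreal C * psi_mean f"
proof -
  obtain C where C: "C \<ge> 0" "\<And>x y. \<bar>x\<bar> \<le> \<bar>r\<bar> \<Longrightarrow> psi_sup (x * y) \<le> C * psi_sup y"
    using psi_sup_scale[of "\<bar>r\<bar>"] by blast
  have "psi_mean (\<lambda>v. r * f v) \<le> ennreal C * psi_mean f" if [measurable]: "f \<in> borel_measurable borel" for f
  proof -
    have "psi_mean (\<lambda>v. r * f v) \<le> (\<integral>\<^sup>+ v. ennreal C * ennreal (psi_sup (f v)) \<partial>lborel)"
      unfolding psi_mean_def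
      by (intro nn_integral_mono) (simp add: C ennreal_mult[symmetric] psi_sup_nonneg ennreal_leI)
    then show ?thesis unfolding psi_mean_def by (simp add: nn_integral_cmult)
  qed
  then show ?thesis by blast
qed

lemma psi_mean_step_finite:
  assumes "step_on a b h" "a \<le> b" shows "psi_mean (step_fun h) < \<infinity>"
proof -
  define K where "K = (\<Sum>(c, p, q)\<leftarrow>h. \<bar>c\<bar>)"
  have "psi_sup (step_fun h v) \<le> psi_sup K * indicator {a<..b} v" for v
    using step_fun_outside[OF assms(1), of v] psi_sup_mono[of "step_fun h v" K] step_fun_bounded[of h v]
    by (cases "v \<in> {a<..b}") (auto simp: K_def psi_sup_0)
  then have "psi_mean (step_fun h) \<le> (\<integral>\<^sup>+ v. ennreal (psi_sup K) * indicator {a<..b} v \<partial>lborel)"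
    unfolding psi_mean_def
  proof (intro nn_integral_mono)
    fix v
    have "ennreal (psi_sup (step_fun h v)) \<le> ennreal (psi_sup K * indicator {a<..b} v)"
      by (rule ennreal_leI) fact
    then show "ennreal (psi_sup (step_fun h v)) \<le> ennreal (psi_sup K) * indicator {a<..b} v"
      by (cases "v \<in> {a<..b}") simp_all
  qed
  also have "\<dots> = ennreal (psi_sup K) * ennreal (b - a)"
    using assms(2) by (simp add: nn_integral_cmult_indicator)
  also have "\<dots> < \<infinity>" by (simp add: ennreal_mult_less_top)
  finally show ?thesis .
qed

lemma psi_mean_finiteD:
  assumes [measurable]: "f \<in> borel_measurable borel" and fin: "psi_mean f < \<infinity>"
  shows "integrable lborel (\<lambda>v. psi_sup (f v))" "psi_mean f = ennreal (LBINT v. psi_sup (f v))"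
    "integrable lborel (\<lambda>v. \<psi> (f v))"
proof -
  show i: "integrable lborel (\<lambda>v. psi_sup (f v))"
    using fin by (intro integrableI_bounded) (auto simp: psi_mean_def psi_sup_nonneg)
  show "psi_mean f = ennreal (LBINT v. psi_sup (f v))"
    unfolding psi_mean_def by (rule nn_integral_eq_integral[OF i]) (simp add: psi_sup_nonneg)
  show "integrable lborel (\<lambda>v. \<psi> (f v))"
    by (rule Bochner_Integration.integrable_bound[OF i]) (auto simp: psi_sup_ge psi_sup_nonneg)
qed

text \<open>Integrating \<open>exponent_diff_le\<close> bounds the error by \<eta> times the mean of
  \<open>f\<close> plus a multiple, depending on \<eta>, of the mean of the difference.\<close>

lemma integral_exponent_tendsto:
  assumes [measurable]: "f \<in> borel_measurable borel" "\<And>n. g n \<in> borel_measurable borel"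
    and f: "psi_mean f < \<infinity>" and lim: "(\<lambda>n. psi_mean (\<lambda>v. g n v - f v)) \<longlonglongrightarrow> 0"
    and g: "\<And>n. integrable lborel (\<lambda>v. \<psi> (g n v))"
  shows "(\<lambda>n. CLBINT v. \<psi> (g n v)) \<longlonglongrightarrow> (CLBINT v. \<psi> (f v))"
proof (rule LIMSEQ_I)
  fix e :: real assume e: "e > 0"
  note f' = psi_mean_finiteD[OF assms(1) f]
  define A where "A = (LBINT v. psi_sup (f v))"
  have A: "A \<ge> 0" unfolding A_def by (rule Bochner_Integration.integral_nonneg) (rule psi_sup_nonneg)
  \<comment> \<open>First \<eta> makes the term with \<open>f\<close> at most \<open>e / 2\<close>;
    then \<delta> is chosen against the factor \<open>1 + 1 / \<eta>\<close> to make the other term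
    less than \<open>e / 2\<close>.\<close>
  define \<eta> where "\<eta> = e / (2 * (A + 1))"
  have \<eta>: "\<eta> > 0" using e A by (simp add: \<eta>_def)
  have \<eta>A: "\<eta> * A \<le> e / 2"
  proof -
    have "\<eta> * A \<le> \<eta> * (A + 1)" using \<eta> by simp
    also have "\<dots> = e / 2" unfolding \<eta>_def using A by (simp add: field_simps)
    finally show ?thesis .
  qed
  define k where "k = 1 + 1 / \<eta>"
  have k: "k > 0" using \<eta> by (simp add: k_def add_pos_pos)
  define \<delta> where "\<delta> = e / 2 / k"
  have \<delta>: "\<delta> > 0" "k * \<delta> = e / 2" using e k by (simp_all add: \<delta>_def)
  have "\<forall>\<^sub>F n in sequentially. psi_mean (\<lambda>v. g n v - f v) < ennreal \<delta>"
    using \<delta> by (intro order_tendstoD(2)[OF lim]) auto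
  then have "\<forall>\<^sub>F n in sequentially. norm ((CLBINT v. \<psi> (g n v)) - (CLBINT v. \<psi> (f v))) < e"
  proof eventually_elim
    case (elim n)
    then have "psi_mean (\<lambda>v. g n v - f v) < \<infinity>" using order_less_trans[OF _ ennreal_less_top] by auto
    from psi_mean_finiteD[OF _ this]
    have d: "integrable lborel (\<lambda>v. psi_sup (g n v - f v))"
      "psi_mean (\<lambda>v. g n v - f v) = ennreal (LBINT v. psi_sup (g n v - f v))" by auto
    have "0 \<le> (LBINT v. psi_sup (g n v - f v))"
      by (rule Bochner_Integration.integral_nonneg) (rule psi_sup_nonneg)
    then have less: "(LBINT v. psi_sup (g n v - f v)) < \<delta>"
      using elim unfolding d(2) by (simp add: ennreal_less_iff)
    have "norm ((CLBINT v. \<psi> (g n v)) - (CLBINT v. \<psi> (f v))) = norm (CLBINT v. \<psi> (g n v) - \<psi> (f v))"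
      by (simp add: Bochner_Integration.integral_diff[OF g f'(3)])
    also have "\<dots> \<le> (LBINT v. cmod (\<psi> (g n v) - \<psi> (f v)))"
      by (rule integral_norm_bound)
    also have "\<dots> \<le> (LBINT v. \<eta> * psi_sup (f v) + (1 + 1 / \<eta>) * psi_sup (g n v - f v))"
    proof (rule integral_mono)
      show "integrable lborel (\<lambda>v. cmod (\<psi> (g n v) - \<psi> (f v)))"
        by (intro integrable_norm Bochner_Integration.integrable_diff g f')
      show "integrable lborel (\<lambda>v. \<eta> * psi_sup (f v) + (1 + 1 / \<eta>) * psi_sup (g n v - f v))"
        by (intro Bochner_Integration.integrable_add integrable_mult_right f' d)
      fix v
      have "\<eta> * cmod (\<psi> (f v)) \<le> \<eta> * psi_sup (f v)"
        using \<eta> by (intro mult_left_mono psi_sup_ge) auto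
      moreover have "(1 + 1 / \<eta>) * cmod (\<psi> (g n v - f v)) \<le> (1 + 1 / \<eta>) * psi_sup (g n v - f v)"
        using \<eta> by (intro mult_left_mono psi_sup_ge) auto
      ultimately show "cmod (\<psi> (g n v) - \<psi> (f v)) \<le> \<eta> * psi_sup (f v) + (1 + 1 / \<eta>) * psi_sup (g n v - f v)"
        using exponent_diff_le[OF \<eta>, of "g n v" "f v"] by linarith
    qed
    also have "\<dots> = \<eta> * A + (1 + 1 / \<eta>) * (LBINT v. psi_sup (g n v - f v))"
      unfolding A_def using f'(1) d(1) by simp
    also have "\<dots> < e / 2 + e / 2"
    proof (rule add_le_less_mono[OF \<eta>A])
      have "(1 + 1 / \<eta>) * (LBINT v. psi_sup (g n v - f v)) < (1 + 1 / \<eta>) * \<delta>"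
        using less \<eta> by (intro mult_strict_left_mono) (auto intro: add_pos_pos)
      then show "(1 + 1 / \<eta>) * (LBINT v. psi_sup (g n v - f v)) < e / 2"
        unfolding k_def[symmetric] \<delta>(2) .
    qed
    finally show ?case by simp
  qed
  then show "\<exists>N. \<forall>n\<ge>N. norm ((CLBINT v. \<psi> (g n v)) - (CLBINT v. \<psi> (f v))) < e"
    unfolding eventually_sequentially .
qed

text \<open>\<open>S m - S n\<close> is itself a step function, and the competitors in the Daniell
  mean are exactly the functions \<open>h'\<close> that \<open>psi_mean_step_le\<close> tests;
  smallness in probability makes their characteristic functions close to 1.\<close>

lemma mean_Cauchy_psi_mean:
  assumes S: "\<And>n. step_on a b (S n)" and C: "mean_Cauchy M X a b S" and ab: "0 \<le> a" "a \<le> b"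
    and e: "0 < e" "e < 4"
  shows "\<exists>N. \<forall>m\<ge>N. \<forall>n\<ge>N. psi_mean (\<lambda>v. step_fun (S m) v - step_fun (S n) v) \<le> ennreal e"
proof -
  \<comment> \<open>The two contributions are \<open>e / 16 + 2 * (e / 32) = e / 8\<close>, and the
    factor 8 of \<open>psi_mean_step_le\<close> restores \<open>e\<close>; its requirement
    \<open>e / 8 < 1 / 2\<close> is \<open>e < 4\<close>.\<close>
  have e': "e / 16 > 0" "e / 32 > 0" using e by auto
  obtain N where N: "\<And>m n h. m \<ge> N \<Longrightarrow> n \<ge> N \<Longrightarrow> step_on a b h \<Longrightarrow>
      (\<forall>u. \<bar>step_fun h u\<bar> \<le> \<bar>step_fun (S m) u - step_fun (S n) u\<bar>) \<Longrightarrow>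
      prob {\<omega> \<in> space M. \<bar>step_integral X h \<omega>\<bar> \<ge> e / 16} < e / 32"
    using C[unfolded mean_Cauchy_def, rule_format, OF e'] by blast
  have "psi_mean (\<lambda>v. step_fun (S m) v - step_fun (S n) v) \<le> ennreal e" if mn: "m \<ge> N" "n \<ge> N" for m n
  proof -
    define h where "h = S m @ step_scale (- 1) (S n)"
    have h: "step_on a b h" "step_fun h v = step_fun (S m) v - step_fun (S n) v" for v
      using S[of m] S[of n] by (simp_all add: h_def step_scale)
    have "psi_mean (step_fun h) \<le> ennreal (8 * (e / 8))"
    proof (rule psi_mean_step_le[OF h(1) ab])
      show "e / 8 < 1 / 2" using e by simp
      fix h' assume h': "step_on a b h'" "\<forall>v. \<bar>step_fun h' v\<bar> \<le> \<bar>step_fun h v\<bar>"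
      have m[measurable]: "step_integral X h' \<in> borel_measurable M"
        by (rule measurable_step_integral[OF h'(1) ab(1)])
      have "cmod ((CLINT \<omega>|M. iexp (step_integral X h' \<omega>)) - 1) = cmod (CLINT \<omega>|M. iexp (step_integral X h' \<omega>) - 1)"
        by (subst Bochner_Integration.integral_diff[OF integrable_iexp integrable_const]) (auto simp: prob_space)
      also have "\<dots> \<le> (\<integral>\<omega>. cmod (iexp (step_integral X h' \<omega>) - 1) \<partial>M)"
        by (rule integral_norm_bound)
      also have "\<dots> \<le> e / 16 + 2 * prob {\<omega> \<in> space M. \<bar>step_integral X h' \<omega>\<bar> \<ge> e / 16}"
        by (rule expectation_iexp_minus_1_le[OF m e'(1)])
      also have "\<dots> \<le> e / 16 + 2 * (e / 32)"
        using N[OF mn h'(1)] h'(2) unfolding h(2) by simp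
      finally show "cmod ((CLINT \<omega>|M. iexp (step_integral X h' \<omega>)) - 1) \<le> e / 8" by simp
    qed
    then show ?thesis by (simp add: h(2)[abs_def])
  qed
  then show ?thesis by blast
qed

text \<open>
  Unlike \<^const>\<open>has_stoch_integral\<close>, this relation is visibly linear in \<open>(f, Y)\<close>.
\<close>

definition psi_integral :: "real \<Rightarrow> (real \<Rightarrow> real) \<Rightarrow> ('a \<Rightarrow> real) \<Rightarrow> bool" where
  "psi_integral T f Y \<longleftrightarrow> f \<in> borel_measurable borel \<and> Y \<in> borel_measurable M \<and>
    (\<exists>S. (\<forall>n. step_on 0 T (S n)) \<and> (\<lambda>n. psi_mean (\<lambda>v. step_fun (S n) v - f v)) \<longlonglongrightarrow> 0 \<and>
      tendsto_prob M (\<lambda>n. step_integral X (S n)) Y)"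

lemma psi_integral_mono: "psi_integral T f Y \<Longrightarrow> T \<le> T' \<Longrightarrow> psi_integral T' f Y"
  unfolding psi_integral_def by (meson order_refl step_on_mono)

text \<open>Fatou: the Cauchy bound for \<open>S n - S m\<close> passes, as \<open>m\<close> grows,
  to the almost everywhere limit \<open>S n - f\<close>. The pointwise input is lower semicontinuity
  of \<open>psi_sup\<close>.\<close>

lemma has_stoch_integral_imp_psi_integral:
  assumes Y: "has_stoch_integral M X f 0 T Y" and T: "0 \<le> T"
    and f: "(\<lambda>v. indicator {0..T} v * f v) \<in> borel_measurable borel"
  shows "psi_integral T (\<lambda>v. indicator {0..T} v * f v) Y"
proof -
  let ?f = "\<lambda>v. indicator {0..T} v * f v"
  note [measurable] = f
  obtain S where S: "\<And>n. step_on 0 T (S n)"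
    "AE u in lborel. u \<in> {0..T} \<longrightarrow> (\<lambda>n. step_fun (S n) u) \<longlonglongrightarrow> f u"
    "mean_Cauchy M X 0 T S" "tendsto_prob M (\<lambda>n. step_integral X (S n)) Y"
    and Ym: "Y \<in> borel_measurable M"
    using Y unfolding has_stoch_integral_def by blast
  have lim: "AE u in lborel. (\<lambda>n. step_fun (S n) u) \<longlonglongrightarrow> ?f u"
    using S(2)
  proof eventually_elim
    case (elim u)
    then show ?case using step_fun_outside[OF S(1), of u] by (cases "u \<in> {0..T}") auto
  qed
  have "(\<lambda>n. psi_mean (\<lambda>v. step_fun (S n) v - ?f v)) \<longlonglongrightarrow> 0"
  proof (rule order_tendstoI)
    fix a :: ennreal assume "0 < a"
    then obtain e where e: "0 < e" "e < 4" "ennreal e < a"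
    proof -
      obtain b where b: "0 < b" "b < min a 1" using \<open>0 < a\<close> dense[of 0 "min a 1"] by auto
      then obtain e where "b = ennreal e" "e \<ge> 0" by (cases b) auto
      then show ?thesis using b that[of e] by (auto simp: ennreal_less_one_iff)
    qed
    obtain N where N: "\<And>m n. m \<ge> N \<Longrightarrow> n \<ge> N \<Longrightarrow> psi_mean (\<lambda>v. step_fun (S m) v - step_fun (S n) v) \<le> ennreal e"
      using mean_Cauchy_psi_mean[OF S(1,3) _ T e(1,2)] by auto
    have "psi_mean (\<lambda>v. step_fun (S n) v - ?f v) < a" if n: "n \<ge> N" for n
    proof -
      have "psi_mean (\<lambda>v. step_fun (S n) v - ?f v) \<le>
        (\<integral>\<^sup>+ v. liminf (\<lambda>m. ennreal (psi_sup (step_fun (S n) v - step_fun (S m) v))) \<partial>lborel)"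
        unfolding psi_mean_def
      proof (rule nn_integral_mono_AE, use lim in eventually_elim)
        case (elim v)
        \<comment> \<open>The maximizer at the limit point is kept fixed along the sequence: its
          values converge by continuity of \<psi> and stay below \<open>psi_sup\<close>.\<close>
        obtain \<theta> where \<theta>: "\<bar>\<theta>\<bar> \<le> 1" "psi_sup (step_fun (S n) v - ?f v) = cmod (\<psi> (\<theta> * (step_fun (S n) v - ?f v)))"
          using psi_sup_attained[of "step_fun (S n) v - ?f v"] by (auto simp: abs_le_iff)
        have "(\<lambda>m. \<theta> * (step_fun (S n) v - step_fun (S m) v)) \<longlonglongrightarrow> \<theta> * (step_fun (S n) v - ?f v)"
          by (intro tendsto_intros elim)
        then have "(\<lambda>m. ennreal (cmod (\<psi> (\<theta> * (step_fun (S n) v - step_fun (S m) v))))) \<longlonglongrightarrow>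
            ennreal (psi_sup (step_fun (S n) v - ?f v))"
          unfolding \<theta>(2) by (intro tendsto_ennrealI tendsto_norm isCont_tendsto_compose[OF isCont_exponent])
        from lim_imp_Liminf[OF _ this]
        have "ennreal (psi_sup (step_fun (S n) v - ?f v)) =
            liminf (\<lambda>m. ennreal (cmod (\<psi> (\<theta> * (step_fun (S n) v - step_fun (S m) v)))))" by simp
        also have "\<dots> \<le> liminf (\<lambda>m. ennreal (psi_sup (step_fun (S n) v - step_fun (S m) v)))"
          by (intro Liminf_mono always_eventually allI ennreal_leI psi_sup_upper \<theta>(1))
        finally show ?case .
      qed
      also have "\<dots> \<le> liminf (\<lambda>m. psi_mean (\<lambda>v. step_fun (S n) v - step_fun (S m) v))"
        unfolding psi_mean_def by (rule nn_integral_liminf) measurable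
      also have "\<dots> \<le> limsup (\<lambda>m. psi_mean (\<lambda>v. step_fun (S n) v - step_fun (S m) v))"
        by (rule Liminf_le_Limsup) simp
      also have "\<dots> \<le> ennreal e"
        by (rule Limsup_bounded, rule eventually_mono[OF eventually_ge_at_top[of N]]) (rule N[OF n])
      finally show ?thesis using e(3) by (rule order_le_less_trans)
    qed
    then show "\<forall>\<^sub>F n in sequentially. psi_mean (\<lambda>v. step_fun (S n) v - ?f v) < a"
      using eventually_ge_at_top[of N] by (rule eventually_mono[rotated]) auto
  qed auto
  then show ?thesis using S Ym f unfolding psi_integral_def by blast
qed

lemma psi_integral_add:
  assumes f: "psi_integral T f Y" and g: "psi_integral T g Z"
  shows "psi_integral T (\<lambda>v. f v + g v) (\<lambda>\<omega>. Y \<omega> + Z \<omega>)"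
proof -
  obtain S where S: "\<And>n. step_on 0 T (S n)" "(\<lambda>n. psi_mean (\<lambda>v. step_fun (S n) v - f v)) \<longlonglongrightarrow> 0"
      "tendsto_prob M (\<lambda>n. step_integral X (S n)) Y"
    and [measurable]: "f \<in> borel_measurable borel" "Y \<in> borel_measurable M"
    using f unfolding psi_integral_def by blast
  obtain R where R: "\<And>n. step_on 0 T (R n)" "(\<lambda>n. psi_mean (\<lambda>v. step_fun (R n) v - g v)) \<longlonglongrightarrow> 0"
      "tendsto_prob M (\<lambda>n. step_integral X (R n)) Z"
    and [measurable]: "g \<in> borel_measurable borel" "Z \<in> borel_measurable M"
    using g unfolding psi_integral_def by blast
  have [measurable]: "step_integral X (S n) \<in> borel_measurable M" "step_integral X (R n) \<in> borel_measurable M" for n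
    using measurable_step_integral[OF S(1)] measurable_step_integral[OF R(1)] by auto
  have le: "psi_mean (\<lambda>v. step_fun (S n @ R n) v - (f v + g v)) \<le>
      2 * psi_mean (\<lambda>v. step_fun (S n) v - f v) + 2 * psi_mean (\<lambda>v. step_fun (R n) v - g v)" for n
    using psi_mean_add[of "\<lambda>v. step_fun (S n) v - f v" "\<lambda>v. step_fun (R n) v - g v"]
    by (simp add: algebra_simps)
  have lim: "(\<lambda>n. 2 * psi_mean (\<lambda>v. step_fun (S n) v - f v) + 2 * psi_mean (\<lambda>v. step_fun (R n) v - g v)) \<longlonglongrightarrow> 2 * 0 + 2 * 0"
    by (intro tendsto_add ennreal_tendsto_cmult S R) auto
  have "(\<lambda>n. psi_mean (\<lambda>v. step_fun (S n @ R n) v - (f v + g v))) \<longlonglongrightarrow> 0"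
    by (rule tendsto_squeeze_const[OF lim[unfolded mult_zero_right add_0_left] _ le]) simp
  moreover have "tendsto_prob M (\<lambda>n. step_integral X (S n @ R n)) (\<lambda>\<omega>. Y \<omega> + Z \<omega>)"
    using tendsto_prob_add[OF S(3) R(3)] by (simp add: step_integral_simps(3)[abs_def])
  moreover have "step_on 0 T (S n @ R n)" for n using S(1) R(1) by simp
  ultimately show ?thesis
    unfolding psi_integral_def by (intro conjI exI[of _ "\<lambda>n. S n @ R n"]) auto
qed

lemma psi_integral_scale:
  assumes f: "psi_integral T f Y"
  shows "psi_integral T (\<lambda>v. r * f v) (\<lambda>\<omega>. r * Y \<omega>)"
proof -
  obtain S where S: "\<And>n. step_on 0 T (S n)" "(\<lambda>n. psi_mean (\<lambda>v. step_fun (S n) v - f v)) \<longlonglongrightarrow> 0"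
      "tendsto_prob M (\<lambda>n. step_integral X (S n)) Y"
    and [measurable]: "f \<in> borel_measurable borel" "Y \<in> borel_measurable M"
    using f unfolding psi_integral_def by blast
  obtain C where C: "\<And>f. f \<in> borel_measurable borel \<Longrightarrow> psi_mean (\<lambda>v. r * f v) \<le> ennreal C * psi_mean f"
    using psi_mean_scale[of r] by blast
  have le: "psi_mean (\<lambda>v. step_fun (step_scale r (S n)) v - r * f v) \<le> ennreal C * psi_mean (\<lambda>v. step_fun (S n) v - f v)" for n
    using C[of "\<lambda>v. step_fun (S n) v - f v"] by (simp add: step_scale(2) right_diff_distrib)
  have lim: "(\<lambda>n. ennreal C * psi_mean (\<lambda>v. step_fun (S n) v - f v)) \<longlonglongrightarrow> ennreal C * 0"
    by (intro ennreal_tendsto_cmult S) auto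
  have "(\<lambda>n. psi_mean (\<lambda>v. step_fun (step_scale r (S n)) v - r * f v)) \<longlonglongrightarrow> 0"
    by (rule tendsto_squeeze_const[OF lim[unfolded mult_zero_right add_0_left] _ le]) simp
  moreover have "tendsto_prob M (\<lambda>n. step_integral X (step_scale r (S n))) (\<lambda>\<omega>. r * Y \<omega>)"
    using tendsto_prob_scale[OF S(3)] by (simp add: step_scale(3)[abs_def])
  moreover have "step_on 0 T (step_scale r (S n))" for n using S(1) by (rule step_scale)
  ultimately show ?thesis
    unfolding psi_integral_def by (intro conjI exI[of _ "\<lambda>n. step_scale r (S n)"]) auto
qed

lemma psi_integral_0: "psi_integral T (\<lambda>v. 0) (\<lambda>\<omega>. 0)"
proof -
  have "tendsto_prob M (\<lambda>n. step_integral X []) (\<lambda>\<omega>. 0)"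
    by (auto simp: tendsto_prob_def)
  then show ?thesis
    unfolding psi_integral_def by (intro conjI exI[of _ "\<lambda>n. []"]) (auto simp: psi_mean_0)
qed

lemma psi_integral_sum:
  fixes n :: nat
  assumes "\<And>k. k < n \<Longrightarrow> psi_integral T (f k) (Y k)"
  shows "psi_integral T (\<lambda>v. \<Sum>k<n. f k v) (\<lambda>\<omega>. \<Sum>k<n. Y k \<omega>)"
  using assms by (induction n) (auto intro: psi_integral_add psi_integral_0)

text \<open>One step function at distance less than 1 suffices, since step functions have finite
  mean and the mean is subadditive up to a factor 2. This is the source of all integrability of
  \<psi> along integrands.\<close>

lemma psi_integral_finite:
  assumes f: "psi_integral T f Y" and T: "0 \<le> T" shows "psi_mean f < \<infinity>"
proof -
  obtain S where S: "\<And>n. step_on 0 T (S n)" "(\<lambda>n. psi_mean (\<lambda>v. step_fun (S n) v - f v)) \<longlonglongrightarrow> 0"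
    and [measurable]: "f \<in> borel_measurable borel"
    using f unfolding psi_integral_def by blast
  have "\<forall>\<^sub>F n in sequentially. psi_mean (\<lambda>v. step_fun (S n) v - f v) < 1"
    using S(2) by (intro order_tendstoD) auto
  then obtain n where n: "psi_mean (\<lambda>v. step_fun (S n) v - f v) < 1"
    unfolding eventually_sequentially by blast
  have "psi_mean (\<lambda>v. f v - step_fun (S n) v) \<le> psi_mean (\<lambda>v. step_fun (S n) v - f v)"
    by (rule psi_mean_mono) (simp add: abs_minus_commute)
  then have "psi_mean (\<lambda>v. f v - step_fun (S n) v) < \<infinity>"
    using n by (metis infinity_ennreal_def order.strict_trans1 order.strict_trans ennreal_one_less_top)
  moreover have "psi_mean (step_fun (S n)) < \<infinity>" by (rule psi_mean_step_finite[OF S(1) T])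
  moreover have "psi_mean f \<le> 2 * psi_mean (\<lambda>v. f v - step_fun (S n) v) + 2 * psi_mean (step_fun (S n))"
    using psi_mean_add[of "\<lambda>v. f v - step_fun (S n) v" "step_fun (S n)"] by simp
  ultimately show ?thesis
    by (auto simp: ennreal_mult_less_top elim!: order_le_less_trans)
qed

text \<open>Each approximating step function is cut at \<open>s\<close>. The late part factorizes
  against \<open>W\<close> by \<open>expectation_step\<close>; the early part, which may depend on
  \<open>W\<close>, has a characteristic function tending to 1 and is dropped by
  \<open>expectation_iexp_diff_le\<close>.\<close>

lemma psi_integral_expectation:
  fixes W :: "'a \<Rightarrow> complex"
  assumes f: "psi_integral T f Y" and sT: "0 \<le> s" "s \<le> T" and f0: "\<And>v. v \<le> s \<Longrightarrow> f v = 0"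
    and W: "W \<in> borel_measurable (F s)" and bd: "\<And>\<omega>. cmod (W \<omega>) \<le> 1"
  shows "(CLINT \<omega>|M. W \<omega> * iexp (Y \<omega>)) = (CLINT \<omega>|M. W \<omega>) * exp (CLBINT v. \<psi> (f v))"
proof -
  have T: "0 \<le> T" using sT by simp
  obtain S where S: "\<And>n. step_on 0 T (S n)" "(\<lambda>n. psi_mean (\<lambda>v. step_fun (S n) v - f v)) \<longlonglongrightarrow> 0"
      "tendsto_prob M (\<lambda>n. step_integral X (S n)) Y"
    and fm[measurable]: "f \<in> borel_measurable borel" and Ym[measurable]: "Y \<in> borel_measurable M"
    using f unfolding psi_integral_def by blast
  have Wm[measurable]: "W \<in> borel_measurable M" using measurable_F[OF W sT(1)] .
  have Sm: "step_integral X (S n) \<in> borel_measurable M" for n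
    by (rule measurable_step_integral[OF S(1)]) simp
  define L where "L = (\<lambda>n. step_map id (min s) (S n))"
  define R where "R = (\<lambda>n. step_map id (max s) (S n))"
  have LR: "step_on 0 s (L n)" "step_on s T (R n)"
    "step_fun (L n) v = indicator {..s} v * step_fun (S n) v"
    "step_fun (R n) v = indicator {s<..} v * step_fun (S n) v"
    "step_integral X (S n) \<omega> = step_integral X (L n) \<omega> + step_integral X (R n) \<omega>" for n v \<omega>
    unfolding L_def R_def by (rule step_truncate[OF S(1) sT])+
  have LRm: "step_integral X (L n) \<in> borel_measurable M" "step_integral X (R n) \<in> borel_measurable M" for n
    using measurable_step_integral[OF LR(1)] measurable_step_integral[OF LR(2) sT(1)] by auto
  \<comment> \<open>As \<open>f\<close> vanishes up to \<open>s\<close>, both \<open>L n\<close> and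
    \<open>R n - f\<close> are restrictions of the error \<open>S n - f\<close>, so monotonicity of
    the mean handles them.\<close>
  have lim0: "(\<lambda>n. psi_mean (\<lambda>v. step_fun (L n) v - 0)) \<longlonglongrightarrow> 0"
    by (rule tendsto_squeeze_const[OF S(2)])
      (auto intro!: psi_mean_mono simp: LR(3) f0 indicator_def)
  have lim1: "(\<lambda>n. psi_mean (\<lambda>v. step_fun (R n) v - f v)) \<longlonglongrightarrow> 0"
    by (rule tendsto_squeeze_const[OF S(2)])
      (auto intro!: psi_mean_mono simp: LR(4) f0 indicator_def)
  have "(\<lambda>n. CLBINT v. \<psi> (step_fun (L n) v)) \<longlonglongrightarrow> (CLBINT v::real. \<psi> 0)"
    by (rule integral_exponent_tendsto[where f = "\<lambda>_. 0" and g = "\<lambda>n. step_fun (L n)", OF _ _ _ lim0])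
      (auto simp: psi_mean_0 intro: integrable_exponent_step[OF LR(1) sT(1)])
  then have eL: "(\<lambda>n. exp (CLBINT v. \<psi> (step_fun (L n) v))) \<longlonglongrightarrow> 1"
    using tendsto_exp by (fastforce simp: exponent_0)
  have eR: "(\<lambda>n. exp (CLBINT v. \<psi> (step_fun (R n) v))) \<longlonglongrightarrow> exp (CLBINT v. \<psi> (f v))"
    by (intro tendsto_exp integral_exponent_tendsto[where f = f and g = "\<lambda>n. step_fun (R n)", OF _ _ psi_integral_finite[OF f T] lim1])
      (auto intro: integrable_exponent_step[OF LR(2) sT(2)])
  have expL: "(CLINT \<omega>|M. iexp (step_integral X (L n) \<omega>)) = exp (CLBINT v. \<psi> (step_fun (L n) v))" for n
    using expectation_step[OF LR(1) _ sT(1), where W = "\<lambda>_. 1" and K = 1] by (simp add: prob_space)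
  have expR: "(CLINT \<omega>|M. W \<omega> * iexp (step_integral X (R n) \<omega>)) =
      (CLINT \<omega>|M. W \<omega>) * exp (CLBINT v. \<psi> (step_fun (R n) v))" for n
    by (rule expectation_step[OF LR(2) sT W bd])
  \<comment> \<open>The tolerance \<open>e\<close> doubles as the weight: the bound is
    \<open>e / 2\<close> plus a null sequence divided by the fixed \<open>e\<close>.\<close>
  have "(\<lambda>n. (CLINT \<omega>|M. W \<omega> * iexp (step_integral X (S n) \<omega>)) - (CLINT \<omega>|M. W \<omega> * iexp (step_integral X (R n) \<omega>))) \<longlonglongrightarrow> 0"
  proof (rule LIMSEQ_I)
    fix e :: real assume e: "e > 0"
    have le: "cmod ((CLINT \<omega>|M. W \<omega> * iexp (step_integral X (S n) \<omega>)) - (CLINT \<omega>|M. W \<omega> * iexp (step_integral X (R n) \<omega>))) \<le>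
       e / 2 + cmod (1 - exp (CLBINT v. \<psi> (step_fun (L n) v))) / e" for n
      using expectation_iexp_diff_le[OF LRm Wm bd e, of n n] unfolding expL LR(5)[symmetric] .
    have lim: "(\<lambda>n. cmod (1 - exp (CLBINT v. \<psi> (step_fun (L n) v))) / e) \<longlonglongrightarrow> cmod (1 - 1) / e"
      using e by (intro tendsto_intros eL) auto
    have "\<forall>\<^sub>F n in sequentially. cmod (1 - exp (CLBINT v. \<psi> (step_fun (L n) v))) / e < e / 2"
      by (rule order_tendstoD(2)[OF lim]) (use e in simp)
    then have "\<forall>\<^sub>F n in sequentially. norm ((CLINT \<omega>|M. W \<omega> * iexp (step_integral X (S n) \<omega>)) -
        (CLINT \<omega>|M. W \<omega> * iexp (step_integral X (R n) \<omega>)) - 0) < e"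
    proof eventually_elim
      case (elim n)
      then show ?case unfolding diff_zero using le[of n] by linarith
    qed
    then show "\<exists>N. \<forall>n\<ge>N. norm ((CLINT \<omega>|M. W \<omega> * iexp (step_integral X (S n) \<omega>)) -
        (CLINT \<omega>|M. W \<omega> * iexp (step_integral X (R n) \<omega>)) - 0) < e"
      unfolding eventually_sequentially .
  qed
  moreover have "(\<lambda>n. CLINT \<omega>|M. W \<omega> * iexp (step_integral X (R n) \<omega>)) \<longlonglongrightarrow>
      (CLINT \<omega>|M. W \<omega>) * exp (CLBINT v. \<psi> (f v))"
    unfolding expR by (intro tendsto_intros eR)
  ultimately have "(\<lambda>n. CLINT \<omega>|M. W \<omega> * iexp (step_integral X (S n) \<omega>)) \<longlonglongrightarrow>
      0 + (CLINT \<omega>|M. W \<omega>) * exp (CLBINT v. \<psi> (f v))"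
    by (rule Lim_transform[OF _ , rotated, THEN tendsto_eq_rhs]) auto
  moreover have "(\<lambda>n. CLINT \<omega>|M. W \<omega> * iexp (step_integral X (S n) \<omega>)) \<longlonglongrightarrow> (CLINT \<omega>|M. W \<omega> * iexp (Y \<omega>))"
    by (rule expectation_iexp_tendsto_prob[OF S(3) Sm Ym Wm bd])
  ultimately show ?thesis using LIMSEQ_unique by fastforce
qed

end


section \<open>The conditional characteristic function\<close>

locale hull_white = levy +
  fixes \<alpha> \<beta> \<sigma> :: "real \<Rightarrow> real" and lam :: "real \<Rightarrow> 'a \<Rightarrow> real" and s t :: real
  assumes \<alpha>: "locally_integrable \<alpha>" and \<beta>: "locally_integrable \<beta>" and \<sigma>: "locally_integrable \<sigma>"
    and solution: "hw_solution M F X \<alpha> \<beta> \<sigma> lam"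
    and s_nonneg: "0 \<le> s" and s_le_t: "s \<le> t"
begin

text \<open>The driving term \<open>Z\<close> of the overview, read off from the path;
  \<open>hw_solution\<close> makes it a version of the stochastic integral of
  \<open>\<sigma>\<close> from 0 to \<open>u\<close>.\<close>

definition noise :: "real \<Rightarrow> 'a \<Rightarrow> real" where
  "noise u \<omega> = lam u \<omega> - lam 0 \<omega> - (LBINT v=0..u. \<alpha> v - \<beta> v * lam v \<omega>)"

text \<open>The function \<open>H\<close> of the overview.\<close>

definition weight :: "real \<Rightarrow> real" where
  "weight u = (LBINT v=u..t. hw_G \<beta> u v)"

text \<open>The cut-off makes \<open>\<sigma>\<close> Borel on the whole line, as
  \<open>psi_integral\<close> demands; local integrability controls it only at nonnegative
  times.\<close>

definition vol :: "real \<Rightarrow> real" where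
  "vol v = indicator {0..t} v * \<sigma> v"

text \<open>The limiting integrand, extended by 0 beyond \<open>{s<..t}\<close> so that, with
  \<open>\<psi> 0 = 0\<close>, the exponent becomes an integral over the whole line.\<close>

definition kernel :: "real \<Rightarrow> real" where
  "kernel v = indicator {s<..t} v * weight v * vol v"

definition residual :: "'a \<Rightarrow> real" where
  "residual \<omega> = hw_Lambda lam s t \<omega> - hw_M \<alpha> \<beta> s t (lam s \<omega>)"

definition weight_step :: "nat \<Rightarrow> real \<Rightarrow> real" where
  "weight_step n v = (\<Sum>k<Suc n. weight (equi s t n k) * indicator {equi s t n k<..equi s t n (Suc k)} v)"

definition residual_sum :: "nat \<Rightarrow> 'a \<Rightarrow> real" where
  "residual_sum n \<omega> = (\<Sum>k<Suc n. weight (equi s t n k) * (noise (equi s t n (Suc k)) \<omega> - noise (equi s t n k) \<omega>))"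

section \<open>Integrability of the coefficients and step approximation of the weight\<close>

lemma integrable_0t: "set_integrable lborel {0..t} \<alpha>" "set_integrable lborel {0..t} \<beta>" "set_integrable lborel {0..t} \<sigma>"
  using \<alpha> \<beta> \<sigma> s_nonneg s_le_t unfolding locally_integrable_def by auto

lemma integrable_st: "set_integrable lborel {s..t} \<alpha>" "set_integrable lborel {s..t} \<beta>"
  by (rule set_integrable_subset[OF integrable_0t(1)] set_integrable_subset[OF integrable_0t(2)];
      use s_nonneg in auto)+

lemma cadlag_lam: "\<omega> \<in> space M \<Longrightarrow> cadlag (\<lambda>u. lam u \<omega>)"
  using solution unfolding hw_solution_def by blast

lemma measurable_vol [measurable]: "vol \<in> borel_measurable borel"
  using borel_measurable_integrable[OF integrable_0t(3)[unfolded set_integrable_def]]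
  by (simp add: vol_def[abs_def])

lemma weight_primitive: "primitive_on s t weight (\<lambda>u. - (1 - \<beta> u * weight u))"
  using primitive_on_hw_G_integral[OF s_le_t integrable_st(2)]
  by (rule primitive_on_cong) (simp_all add: weight_def)

lemma weight_t: "weight t = 0"
  by (simp add: weight_def)

lemma weight_bounded: "\<exists>C\<ge>0. \<forall>u\<in>{s..t}. \<bar>weight u\<bar> \<le> C"
proof -
  have "bounded (weight ` {s..t})"
    by (intro compact_imp_bounded compact_continuous_image primitive_on_continuous[OF weight_primitive] compact_Icc)
  then obtain C where "\<forall>x\<in>weight ` {s..t}. norm x \<le> C" unfolding bounded_iff by blast
  then show ?thesis by (intro exI[of _ "max 0 C"]) (auto simp: le_max_iff_disj)
qed

lemma measurable_weight_step [measurable]: "weight_step n \<in> borel_measurable borel"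
  unfolding weight_step_def by measurable

lemma weight_step_outside: "v \<notin> {s<..t} \<Longrightarrow> weight_step n v = 0"
  unfolding weight_step_def
  by (rule grid_indicator_sum_outside[OF incseq_equi[OF s_le_t]]) (simp only: equi_0 equi_end not_False_eq_True)

lemma weight_step_bounded:
  assumes C: "C \<ge> 0" "\<And>u. u \<in> {s..t} \<Longrightarrow> \<bar>weight u\<bar> \<le> C" shows "\<bar>weight_step n v\<bar> \<le> C"
proof (cases "v \<in> {s<..t}")
  case True
  then have "v \<in> {equi s t n 0<..equi s t n (Suc n)}" by (simp only: equi_0 equi_end)
  then obtain k where k: "k < Suc n" "v \<in> {equi s t n k<..equi s t n (Suc k)}"
    using grid_exists by blast
  have "weight_step n v = weight (equi s t n k)"
    unfolding weight_step_def by (rule grid_indicator_sum[OF incseq_equi[OF s_le_t] k])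
  then show ?thesis using C(2)[OF equi_in[OF s_le_t]] k by simp
next
  case False
  then show ?thesis using weight_step_outside C by simp
qed

lemma weight_step_tendsto: "(\<lambda>n. weight_step n v) \<longlonglongrightarrow> indicator {s<..t} v * weight v"
proof (cases "v \<in> {s<..t}")
  case True
  then show ?thesis
    using equi_left_sum_tendsto[OF s_le_t True primitive_on_continuous[OF weight_primitive]]
    by (simp add: weight_step_def[abs_def])
qed (simp add: weight_step_outside)

text \<open>The integrals supplied by the equation are brought to the common horizon
  \<open>t\<close>, where they can be combined linearly.\<close>

lemma psi_integral_noise:
  assumes u: "u \<in> {0..t}"
  shows "psi_integral t (\<lambda>v. indicator {0..u} v * \<sigma> v) (noise u)"
proof -
  have "(\<lambda>v. indicator {0..u} v * vol v) \<in> borel_measurable borel" by measurable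
  also have "(\<lambda>v. indicator {0..u} v * vol v) = (\<lambda>v. indicator {0..u} v * \<sigma> v)"
    using u by (auto simp: vol_def indicator_def)
  finally have "psi_integral u (\<lambda>v. indicator {0..u} v * \<sigma> v) (noise u)"
    using solution u unfolding hw_solution_def noise_def[abs_def]
    by (intro has_stoch_integral_imp_psi_integral) auto
  then show ?thesis by (rule psi_integral_mono) (use u in simp)
qed

lemma psi_mean_vol: "psi_mean vol < \<infinity>"
  using psi_integral_finite[OF psi_integral_noise[of t]] s_nonneg s_le_t
  by (simp add: vol_def[abs_def])

text \<open>A noise increment over a cell is the difference of two integrals from 0, with integrand
  \<open>\<sigma>\<close> restricted to the half-open cell. Linearity alone then integrates the
  product of \<open>weight_step n\<close> and \<open>vol\<close>.\<close>

lemma psi_integral_residual_sum: "psi_integral t (\<lambda>v. weight_step n v * vol v) (residual_sum n)"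
proof -
  let ?u = "equi s t n"
  have u: "?u k \<in> {0..t}" if "k \<le> Suc n" for k
    using equi_in[OF s_le_t that] s_nonneg by auto
  have "psi_integral t (\<lambda>v. \<Sum>k<Suc n. weight (?u k) * (indicator {0..?u (Suc k)} v * \<sigma> v + - 1 * (indicator {0..?u k} v * \<sigma> v)))
     (\<lambda>\<omega>. \<Sum>k<Suc n. weight (?u k) * (noise (?u (Suc k)) \<omega> + - 1 * noise (?u k) \<omega>))"
    by (intro psi_integral_sum psi_integral_scale psi_integral_add psi_integral_noise u) auto
  moreover have "(\<Sum>k<Suc n. weight (?u k) * (indicator {0..?u (Suc k)} v * \<sigma> v + - 1 * (indicator {0..?u k} v * \<sigma> v))) =
      weight_step n v * vol v" for v
    unfolding weight_step_def sum_distrib_right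
  proof (rule sum.cong[OF refl])
    fix k assume k: "k \<in> {..<Suc n}"
    have "?u k \<in> {0..t}" "?u (Suc k) \<in> {0..t}" "?u k \<le> ?u (Suc k)"
      using k u incseqD[OF incseq_equi[OF s_le_t, of n], of k "Suc k"] by auto
    then show "weight (?u k) * (indicator {0..?u (Suc k)} v * \<sigma> v + - 1 * (indicator {0..?u k} v * \<sigma> v)) =
        weight (?u k) * indicator {?u k<..?u (Suc k)} v * vol v"
      unfolding vol_def by (auto simp: indicator_def)
  qed
  ultimately show ?thesis by (simp add: residual_sum_def[abs_def])
qed

lemma exponent_vol_dominated:
  "\<exists>C\<ge>0. \<forall>y v. \<bar>y\<bar> \<le> B \<longrightarrow> cmod (\<psi> (y * vol v)) \<le> C * psi_sup (vol v)"
  using psi_sup_scale[of B] psi_sup_ge order_trans by meson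

text \<open>Factors bounded by \<open>B\<close> change \<open>psi_sup (vol v)\<close> by at most a
  constant, so one integrable function dominates all \<open>n\<close>. It serves twice: for the step
  weights converging to the weight, and for continuity in \<open>x\<close>.\<close>

lemma integral_exponent_tendsto_dominated:
  fixes y :: "nat \<Rightarrow> real \<Rightarrow> real"
  assumes [measurable]: "\<And>n. y n \<in> borel_measurable borel" and bd: "\<And>n v. \<bar>y n v\<bar> \<le> B"
    and lim: "\<And>v. (\<lambda>n. y n v) \<longlonglongrightarrow> y' v"
  shows "(\<lambda>n. CLBINT v. \<psi> (y n v * vol v)) \<longlonglongrightarrow> (CLBINT v. \<psi> (y' v * vol v))"
    and "integrable lborel (\<lambda>v. \<psi> (y' v * vol v))"
proof -
  obtain C where C: "C \<ge> 0" "\<And>y v. \<bar>y\<bar> \<le> B \<Longrightarrow> cmod (\<psi> (y * vol v)) \<le> C * psi_sup (vol v)"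
    using exponent_vol_dominated by blast
  have [measurable]: "y' \<in> borel_measurable borel" by (rule borel_measurable_LIMSEQ_real[OF lim]) measurable
  have i: "integrable lborel (\<lambda>v. C * psi_sup (vol v))"
    by (intro integrable_mult_right psi_mean_finiteD psi_mean_vol) measurable
  have l: "AE v in lborel. (\<lambda>n. \<psi> (y n v * vol v)) \<longlonglongrightarrow> \<psi> (y' v * vol v)"
    by (intro AE_I2 isCont_tendsto_compose[OF isCont_exponent] tendsto_intros lim)
  have b: "AE v in lborel. norm (\<psi> (y n v * vol v)) \<le> C * psi_sup (vol v)" for n
    using C(2) bd by auto
  show "(\<lambda>n. CLBINT v. \<psi> (y n v * vol v)) \<longlonglongrightarrow> (CLBINT v. \<psi> (y' v * vol v))"
    by (rule integral_dominated_convergence[OF _ _ i l b]) measurable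
  show "integrable lborel (\<lambda>v. \<psi> (y' v * vol v))"
    by (rule integrable_dominated_convergence[OF _ _ i l b]) measurable
qed

text \<open>The convergence holds for every path: only increments of the noise enter, so it may be
  restarted at \<open>s\<close>, and the Riemann-Stieltjes limit coincides with the integral in
  \<open>hull_white_path_integral\<close>.\<close>

lemma residual_sum_tendsto:
  assumes \<omega>: "\<omega> \<in> space M" shows "(\<lambda>n. residual_sum n \<omega>) \<longlonglongrightarrow> residual \<omega>"
proof -
  let ?L = "\<lambda>u. lam u \<omega>" and ?f = "\<lambda>v. \<alpha> v - \<beta> v * lam v \<omega>"
  note cad = cadlag_lam[OF \<omega>]
  obtain C where C: "\<And>u. u \<in> {0..t} \<Longrightarrow> \<bar>?L u\<bar> \<le> C" using cadlag_bounded[OF cad, of t] by blast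
  have "set_integrable lborel {0..t} (\<lambda>v. \<beta> v * ?L v)"
    by (rule set_integrable_mult_bounded[OF integrable_0t(2) cadlag_measurable[OF cad] _ C]) auto
  then have f: "set_integrable lborel {0..t} ?f"
    using integrable_0t(1) by (rule set_integral_diff(1)[rotated])
  have fs: "set_integrable lborel {s..t} ?f"
    by (rule set_integrable_subset[OF f]) (use s_nonneg in auto)
  define P where "P = (\<lambda>u. LBINT v:{s..u}. ?f v)"
  have P: "primitive_on s t P ?f"
    by (rule primitive_on_cong[OF primitive_on_indefinite[OF fs, of 0]]) (auto simp: P_def)
  have Pc: "continuous_on {s..t} P" using primitive_on_continuous[OF P] .
  define \<zeta> where "\<zeta> = (\<lambda>u. ?L u - ?L s - P u)"
  have noise: "noise u \<omega> = noise s \<omega> + \<zeta> u" if u: "u \<in> {s..t}" for u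
  proof -
    have "(LBINT v:{0..u}. ?f v) - (LBINT v:{0..s}. ?f v) = (LBINT v:{s<..u}. ?f v)"
      using primitive_on_diff[OF primitive_on_indefinite[OF f, of 0], of s u] u s_nonneg by simp
    also have "\<dots> = P u"
      unfolding P_def by (rule set_integral_discrete_difference[where X = "{s}"]) auto
    finally show ?thesis
      using u s_nonneg interval_integral_Icc[of 0 u ?f] interval_integral_Icc[of 0 s ?f]
      by (simp add: noise_def \<zeta>_def zero_ereal_def)
  qed
  have "bounded (P ` {s..t})"
    by (intro compact_imp_bounded compact_continuous_image Pc compact_Icc)
  then obtain D where "\<forall>x\<in>P ` {s..t}. norm x \<le> D" unfolding bounded_iff by blast
  then have D: "\<bar>P u\<bar> \<le> D" if "u \<in> {s..t}" for u using that by simp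
  have "(\<lambda>n. \<Sum>k<Suc n. weight (equi s t n k) * (\<zeta> (equi s t n (Suc k)) - \<zeta> (equi s t n k)))
    \<longlonglongrightarrow> (LBINT u:{s..t}. \<zeta> u * (1 - \<beta> u * weight u))"
  proof (rule riemann_stieltjes_sum_tendsto[OF s_le_t weight_primitive weight_t])
    show "\<zeta> s = 0" by (simp add: \<zeta>_def P_def set_integral_singleton)
    show "\<bar>\<zeta> u\<bar> \<le> 2 * C + D" if "u \<in> {s..t}" for u
      using C[of u] C[of s] D[OF that] that s_nonneg unfolding \<zeta>_def by auto
    show "(\<zeta> \<longlongrightarrow> \<zeta> u) (at_right u)" if u: "u \<in> {s..<t}" for u
    proof -
      have "(?L \<longlongrightarrow> ?L u) (at_right u)" using cad u s_nonneg unfolding cadlag_def by auto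
      moreover have "(P \<longlongrightarrow> P u) (at_right u)"
        using u by (intro continuous_on_Icc_at_rightD[of u t] continuous_on_subset[OF Pc]) auto
      ultimately show ?thesis unfolding \<zeta>_def by (intro tendsto_intros)
    qed
  qed
  moreover have "residual_sum n \<omega> = (\<Sum>k<Suc n. weight (equi s t n k) * (\<zeta> (equi s t n (Suc k)) - \<zeta> (equi s t n k)))" for n
    unfolding residual_sum_def
  proof (rule sum.cong[OF refl])
    fix k assume "k \<in> {..<Suc n}"
    then show "weight (equi s t n k) * (noise (equi s t n (Suc k)) \<omega> - noise (equi s t n k) \<omega>) =
        weight (equi s t n k) * (\<zeta> (equi s t n (Suc k)) - \<zeta> (equi s t n k))"
      using noise[OF equi_in[OF s_le_t, of k n]] noise[OF equi_in[OF s_le_t, of "Suc k" n]] by simp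
  qed
  moreover have "residual \<omega> = (LBINT u:{s..t}. \<zeta> u * (1 - \<beta> u * weight u))"
    using hull_white_path_integral[OF s_le_t integrable_st, of ?L C] cadlag_measurable[OF cad s_nonneg] C s_nonneg
    unfolding residual_def hw_Lambda_def \<zeta>_def P_def weight_def by auto
  ultimately show ?thesis by simp
qed

lemma measurable_residual_sum [measurable]: "residual_sum n \<in> borel_measurable M"
  using psi_integral_residual_sum unfolding psi_integral_def by blast

lemma measurable_residual [measurable]: "residual \<in> borel_measurable M"
  by (rule borel_measurable_LIMSEQ_real[OF residual_sum_tendsto measurable_residual_sum])

lemma kernel_tendsto: "(\<lambda>n. x * weight_step n v) \<longlonglongrightarrow> x * (indicator {s<..t} v * weight v)"
  by (intro tendsto_intros weight_step_tendsto)

text \<open>For each \<open>n\<close> the identity holds with \<open>residual_sum n\<close>, whose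
  integrand vanishes up to \<open>s\<close>. On the right the exponents converge by domination with
  \<open>psi_sup\<close>; on the left the integrands are bounded by 1 and converge pathwise.\<close>

lemma integrable_exponent_kernel: "integrable lborel (\<lambda>v. \<psi> (x * kernel v))"
  and expectation_residual:
    "\<And>W. W \<in> borel_measurable (F s) \<Longrightarrow> (\<And>\<omega>. cmod (W \<omega>) \<le> 1) \<Longrightarrow>
      (CLINT \<omega>|M. W \<omega> * iexp (x * residual \<omega>)) = (CLINT \<omega>|M. W \<omega>) * exp (CLBINT v. \<psi> (x * kernel v))"
proof -
  obtain C where C: "C \<ge> 0" "\<And>u. u \<in> {s..t} \<Longrightarrow> \<bar>weight u\<bar> \<le> C" using weight_bounded by blast
  have bd: "\<bar>x * weight_step n v\<bar> \<le> \<bar>x\<bar> * C" for n v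
    unfolding abs_mult by (intro mult_left_mono weight_step_bounded C) auto
  have m: "(\<lambda>v. x * weight_step n v) \<in> borel_measurable borel" for n by measurable
  note lim = integral_exponent_tendsto_dominated[OF m bd kernel_tendsto]
  have eq: "x * (indicator {s<..t} v * weight v) * vol v = x * kernel v" for v
    by (simp add: kernel_def)
  show "integrable lborel (\<lambda>v. \<psi> (x * kernel v))" using lim(2) unfolding eq .
  fix W :: "'a \<Rightarrow> complex"
  assume W: "W \<in> borel_measurable (F s)" and W1: "\<And>\<omega>. cmod (W \<omega>) \<le> 1"
  have Wm[measurable]: "W \<in> borel_measurable M" using measurable_F[OF W s_nonneg] .
  have "(CLINT \<omega>|M. W \<omega> * iexp (x * residual_sum n \<omega>)) =
      (CLINT \<omega>|M. W \<omega>) * exp (CLBINT v. \<psi> (x * (weight_step n v * vol v)))" for n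
    by (rule psi_integral_expectation[OF psi_integral_scale[OF psi_integral_residual_sum] s_nonneg s_le_t _ W W1])
      (simp add: weight_step_outside)
  moreover have "(\<lambda>n. (CLINT \<omega>|M. W \<omega>) * exp (CLBINT v. \<psi> (x * (weight_step n v * vol v)))) \<longlonglongrightarrow>
      (CLINT \<omega>|M. W \<omega>) * exp (CLBINT v. \<psi> (x * kernel v))"
    using lim(1) unfolding kernel_def mult.assoc by (intro tendsto_intros)
  moreover have "(\<lambda>n. CLINT \<omega>|M. W \<omega> * iexp (x * residual_sum n \<omega>)) \<longlonglongrightarrow> (CLINT \<omega>|M. W \<omega> * iexp (x * residual \<omega>))"
  proof (rule integral_dominated_convergence[where w = "\<lambda>_. 1"])
    show "AE \<omega> in M. (\<lambda>n. W \<omega> * iexp (x * residual_sum n \<omega>)) \<longlonglongrightarrow> W \<omega> * iexp (x * residual \<omega>)"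
      using residual_sum_tendsto by (intro AE_I2 tendsto_intros) auto
    show "AE \<omega> in M. norm (W \<omega> * iexp (x * residual_sum n \<omega>)) \<le> 1" for n
      using W1 by (simp add: norm_mult)
  qed auto
  ultimately show "(CLINT \<omega>|M. W \<omega> * iexp (x * residual \<omega>)) = (CLINT \<omega>|M. W \<omega>) * exp (CLBINT v. \<psi> (x * kernel v))"
    using LIMSEQ_unique by fastforce
qed

text \<open>This selects the continuous branch required by \<open>cond_log_char\<close>. A
  convergent sequence of arguments is bounded, so the domination for bounded factors
  applies.\<close>

lemma continuous_integral_exponent_kernel: "continuous_on UNIV (\<lambda>x. CLBINT v. \<psi> (x * kernel v))"
  unfolding continuous_on_eq_continuous_at[OF open_UNIV] continuous_at_sequentially o_def
proof (intro ballI allI impI)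
  fix x and z :: "nat \<Rightarrow> real" assume z: "z \<longlonglongrightarrow> x"
  obtain C where C: "C \<ge> 0" "\<And>u. u \<in> {s..t} \<Longrightarrow> \<bar>weight u\<bar> \<le> C" using weight_bounded by blast
  obtain R where R: "\<And>n. \<bar>z n\<bar> \<le> R"
    using convergent_imp_Bseq[OF convergentI[OF z]] unfolding Bseq_def by auto
  let ?k = "\<lambda>v. indicator {s<..t} v * weight v"
  have [measurable]: "?k \<in> borel_measurable borel"
    by (rule borel_measurable_LIMSEQ_real[OF weight_step_tendsto]) measurable
  have m: "(\<lambda>v. z n * ?k v) \<in> borel_measurable borel" for n by measurable
  have "\<bar>?k v\<bar> \<le> C" for v using C by (auto simp: indicator_def)
  then have bd: "\<bar>z n * ?k v\<bar> \<le> R * C" for n v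
    unfolding abs_mult[of "z n"] using R[of n] by (intro mult_mono) auto
  have l: "(\<lambda>n. z n * ?k v) \<longlonglongrightarrow> x * ?k v" for v by (intro tendsto_intros z)
  show "(\<lambda>n. CLBINT v. \<psi> (z n * kernel v)) \<longlonglongrightarrow> (CLBINT v. \<psi> (x * kernel v))"
    using integral_exponent_tendsto_dominated(1)[OF m bd l] by (simp add: kernel_def mult.assoc)
qed

lemma kernel_eq: "v \<in> {s<..t} \<Longrightarrow> (LBINT w=v..t. \<sigma> v * hw_G \<beta> v w) = kernel v"
  using s_nonneg by (simp add: kernel_def vol_def weight_def)

text \<open>The factor \<open>\<sigma> v\<close> leaves the inner integral, which then is
  \<open>weight v\<close>; outside \<open>{s<..t}\<close> both sides are 0 because
  \<open>\<psi> 0 = 0\<close>.\<close>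

lemma interval_exponent_kernel:
  "interval_lebesgue_integrable lborel s t (\<lambda>v. \<psi> (x * (LBINT w=v..t. \<sigma> v * hw_G \<beta> v w)))"
  "(LBINT v=s..t. \<psi> (x * (LBINT w=v..t. \<sigma> v * hw_G \<beta> v w))) = (CLBINT v. \<psi> (x * kernel v))"
proof -
  have eq: "indicator {s<..t} v *\<^sub>R \<psi> (x * (LBINT w=v..t. \<sigma> v * hw_G \<beta> v w)) = \<psi> (x * kernel v)" for v
  proof (cases "v \<in> {s<..t}")
    case False
    then have "kernel v = 0" by (simp add: kernel_def)
    then show ?thesis using False by (simp add: exponent_0)
  qed (simp only: kernel_eq indicator_simps scaleR_one)
  have i: "set_integrable lborel {s<..t} (\<lambda>v. \<psi> (x * (LBINT w=v..t. \<sigma> v * hw_G \<beta> v w)))"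
    unfolding set_integrable_def eq by (rule integrable_exponent_kernel)
  have "set_integrable lborel {s<..<t} (\<lambda>v. \<psi> (x * (LBINT w=v..t. \<sigma> v * hw_G \<beta> v w)))"
    by (rule set_integrable_subset[OF i]) auto
  then show "interval_lebesgue_integrable lborel s t (\<lambda>v. \<psi> (x * (LBINT w=v..t. \<sigma> v * hw_G \<beta> v w)))"
    unfolding interval_lebesgue_integrable_def using s_le_t by simp
  show "(LBINT v=s..t. \<psi> (x * (LBINT w=v..t. \<sigma> v * hw_G \<beta> v w))) = (CLBINT v. \<psi> (x * kernel v))"
    unfolding interval_integral_Ioc[OF s_le_t] set_lebesgue_integral_def eq ..
qed

text \<open>The noise-free path is affine in its initial value, and so is its time integral.\<close>

lemma measurable_hw_M [measurable]: "hw_M \<alpha> \<beta> s t \<in> borel_measurable borel"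
proof -
  define m where "m = (\<lambda>l u. hw_G \<beta> s u * (l + hw_I \<alpha> \<beta> s u))"
  have m: "hw_M \<alpha> \<beta> s t l = (LBINT u:{s..t}. m l u)" "set_integrable lborel {s..t} (m l)" for l
    using hw_M_eq_integral[OF s_le_t integrable_st, of l] unfolding m_def
    by (auto intro!: borel_integrable_atLeastAtMost' dest: primitive_on_continuous)
  have "hw_M \<alpha> \<beta> s t = (\<lambda>l. (LBINT u:{s..t}. m 0 u) + l * (LBINT u:{s..t}. m 1 u - m 0 u))"
  proof
    fix l
    have "(LBINT u:{s..t}. m l u) = (LBINT u:{s..t}. m 0 u + l * (m 1 u - m 0 u))"
      by (rule set_lebesgue_integral_cong) (auto simp: m_def algebra_simps)
    then show "hw_M \<alpha> \<beta> s t l = (LBINT u:{s..t}. m 0 u) + l * (LBINT u:{s..t}. m 1 u - m 0 u)"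
      unfolding m(1) using m(2) by simp
  qed
  then show ?thesis by simp
qed

section \<open>Conditioning on the sigma-algebra generated by \<open>lam s\<close>\<close>

lemma measurable_lam_s: "lam s \<in> borel_measurable (F s)"
  using solution s_nonneg unfolding hw_solution_def adapted_def by simp

lemma measurable_lam_s_M [measurable]: "lam s \<in> borel_measurable M"
  using measurable_F[OF measurable_lam_s s_nonneg] .

lemma measurable_generated_lam_s: "lam s \<in> borel_measurable (generated M (lam s))"
  unfolding generated_def by (rule measurable_vimage_algebra1) simp

lemma generated_lam_s_subset: "sets (generated M (lam s)) \<subseteq> sets (F s)"
proof -
  have sp: "space (F s) = space M" using subalgebra_F[OF s_nonneg] by (simp add: subalgebra_def)
  show ?thesis
    unfolding generated_def using measurable_sets[OF measurable_lam_s]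
    by (auto simp: sets_vimage_algebra2 sp)
qed

lemma subalgebra_generated: "subalgebra M (generated M (lam s))"
  using generated_lam_s_subset subalgebra_F[OF s_nonneg] unfolding subalgebra_def
  by (auto simp: generated_def)

text \<open>\<open>hw_Lambda\<close> is \<open>residual\<close> plus a function of
  \<open>lam s\<close>. Tested on an event generated by \<open>lam s\<close>, the second part joins
  the indicator in the \<open>F s\<close>-measurable factor, and \<open>expectation_residual\<close>
  evaluates the rest as a constant.\<close>

lemma cond_char_Lambda:
  "AE \<omega> in M. exp (\<i> * complex_of_real x * complex_of_real (hw_M \<alpha> \<beta> s t (lam s \<omega>)) + (CLBINT v. \<psi> (x * kernel v))) =
     complex_cond_exp M (generated M (lam s)) (\<lambda>\<omega>. iexp (x * hw_Lambda lam s t \<omega>)) \<omega>"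
proof -
  let ?N = "generated M (lam s)"
  interpret N: finite_measure_subalgebra M ?N
    by unfold_locales (rule subalgebra_generated)
  define g where "g = (\<lambda>\<omega>. iexp (x * hw_M \<alpha> \<beta> s t (lam s \<omega>)) * exp (CLBINT v. \<psi> (x * kernel v)))"
  define f where "f = (\<lambda>\<omega>. iexp (x * hw_Lambda lam s t \<omega>))"
  have mM: "(\<lambda>\<omega>. hw_M \<alpha> \<beta> s t (lam s \<omega>)) \<in> borel_measurable ?N"
    using measurable_compose[OF measurable_generated_lam_s measurable_hw_M] .
  have gN: "g \<in> borel_measurable ?N" unfolding g_def using mM by measurable
  have gM: "g \<in> borel_measurable M" using measurable_from_subalg[OF subalgebra_generated gN] .
  have "(\<lambda>\<omega>. iexp (x * (residual \<omega> + hw_M \<alpha> \<beta> s t (lam s \<omega>)))) \<in> borel_measurable M" by measurable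
  then have fM: "f \<in> borel_measurable M" unfolding f_def residual_def by simp
  have fi: "integrable M f"
    by (rule integrable_const_bound[of _ 1]) (use fM in \<open>auto simp: f_def\<close>)
  have gi: "integrable M g"
    by (rule integrable_const_bound[of _ "cmod (exp (CLBINT v. \<psi> (x * kernel v)))"])
      (use gM in \<open>auto simp: g_def norm_mult\<close>)
  have int_eq: "(CLINT \<omega>:A|M. f \<omega>) = (CLINT \<omega>:A|M. g \<omega>)" if A: "A \<in> sets ?N" for A
  proof -
    \<comment> \<open>Adaptedness makes \<open>W\<close> measurable for \<open>F s\<close>, and its
      modulus is at most 1, as \<open>expectation_residual\<close> requires.\<close>
    define W where "W = (\<lambda>\<omega>. indicator A \<omega> * iexp (x * hw_M \<alpha> \<beta> s t (lam s \<omega>)))"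
    have [measurable]: "A \<in> sets (F s)" "lam s \<in> borel_measurable (F s)"
      using A generated_lam_s_subset measurable_lam_s by auto
    have W: "W \<in> borel_measurable (F s)" unfolding W_def by measurable
    have "cmod (W \<omega>) \<le> 1" for \<omega> by (simp add: W_def norm_mult indicator_def)
    from expectation_residual[OF W this, of x]
    have "(CLINT \<omega>|M. W \<omega> * iexp (x * residual \<omega>)) = (CLINT \<omega>|M. W \<omega> * exp (CLBINT v. \<psi> (x * kernel v)))"
      by simp
    moreover have "W \<omega> * iexp (x * residual \<omega>) = indicator A \<omega> *\<^sub>R f \<omega>" for \<omega>
      by (simp add: W_def f_def residual_def indicator_def exp_add[symmetric] algebra_simps)
    moreover have "W \<omega> * exp (CLBINT v. \<psi> (x * kernel v)) = indicator A \<omega> *\<^sub>R g \<omega>" for \<omega>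
      by (simp add: W_def g_def indicator_def)
    ultimately show ?thesis unfolding set_lebesgue_integral_def by simp
  qed
  have iA: "integrable M (\<lambda>\<omega>. indicator A \<omega> *\<^sub>R h \<omega>)" if "A \<in> sets ?N" "integrable M h" for A and h :: "'a \<Rightarrow> complex"
    using that N.subalg by (intro integrable_mult_indicator) (auto simp: subalgebra_def)
  \<comment> \<open>\<open>real_cond_exp\<close> is characterized by real integrals over test sets,
    so the complex identity \<open>int_eq\<close> is used once for each part.\<close>
  have Re: "AE \<omega> in M. real_cond_exp M ?N (\<lambda>\<omega>. Re (f \<omega>)) \<omega> = Re (g \<omega>)"
  proof (rule N.real_cond_exp_charact)
    fix A assume A: "A \<in> sets ?N"
    show "(LINT \<omega>:A|M. Re (f \<omega>)) = (LINT \<omega>:A|M. Re (g \<omega>))"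
      using arg_cong[OF int_eq[OF A], of Re] integral_Re[OF iA[OF A fi]] integral_Re[OF iA[OF A gi]]
      unfolding set_lebesgue_integral_def by simp
  qed (use fi gi gN in auto)
  have Im: "AE \<omega> in M. real_cond_exp M ?N (\<lambda>\<omega>. Im (f \<omega>)) \<omega> = Im (g \<omega>)"
  proof (rule N.real_cond_exp_charact)
    fix A assume A: "A \<in> sets ?N"
    show "(LINT \<omega>:A|M. Im (f \<omega>)) = (LINT \<omega>:A|M. Im (g \<omega>))"
      using arg_cong[OF int_eq[OF A], of Im] integral_Im[OF iA[OF A fi]] integral_Im[OF iA[OF A gi]]
      unfolding set_lebesgue_integral_def by simp
  qed (use fi gi gN in auto)
  from Re Im show ?thesis
  proof eventually_elim
    case (elim \<omega>)
    have "exp (\<i> * complex_of_real x * complex_of_real (hw_M \<alpha> \<beta> s t (lam s \<omega>)) + (CLBINT v. \<psi> (x * kernel v))) = g \<omega>"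
      by (simp add: g_def exp_add mult.assoc)
    then show ?case
      using elim unfolding complex_cond_exp_def f_def by (simp add: complex_eq_iff)
  qed
qed

text \<open>Beyond the exponential identity this fixes the branch: continuity in \<open>x\<close>,
  and the value 0 at \<open>x = 0\<close> from \<open>\<psi> 0 = 0\<close>.\<close>

lemma cond_log_char_Lambda:
  "cond_log_char M (hw_Lambda lam s t) (lam s)
     (\<lambda>x \<omega>. \<i> * complex_of_real x * complex_of_real (hw_M \<alpha> \<beta> s t (lam s \<omega>)) + (CLBINT v. \<psi> (x * kernel v)))"
  unfolding cond_log_char_def
proof (intro conjI allI)
  show "(\<lambda>\<omega>. \<i> * complex_of_real x * complex_of_real (hw_M \<alpha> \<beta> s t (lam s \<omega>)) + (CLBINT v. \<psi> (x * kernel v)))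
      \<in> borel_measurable (generated M (lam s))" for x
    using measurable_compose[OF measurable_generated_lam_s measurable_hw_M] by measurable
  show "AE \<omega> in M. continuous_on UNIV (\<lambda>x. \<i> * complex_of_real x * complex_of_real (hw_M \<alpha> \<beta> s t (lam s \<omega>)) +
        (CLBINT v. \<psi> (x * kernel v))) \<and>
      \<i> * complex_of_real 0 * complex_of_real (hw_M \<alpha> \<beta> s t (lam s \<omega>)) + (CLBINT v. \<psi> (0 * kernel v)) = 0"
    by (intro AE_I2 conjI continuous_intros continuous_integral_exponent_kernel) (simp add: exponent_0)
qed (rule cond_char_Lambda)

end

theorem proposition3:
  fixes M :: "'a measure" and F :: "real \<Rightarrow> 'a measure"
    and X lam :: "real \<Rightarrow> 'a \<Rightarrow> real" and \<psi>X :: "real \<Rightarrow> complex"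
    and \<alpha> \<beta> \<sigma> :: "real \<Rightarrow> real" and s t :: real
  assumes "filtered_prob_space M F"
    and "levy_process M F X"
    and "char_exponent M X \<psi>X"
    and "locally_integrable \<alpha>" and "locally_integrable \<beta>" and "locally_integrable \<sigma>"
    and "hull_white_process M F X \<alpha> \<beta> \<sigma> lam"
    and "0 \<le> s" and "s \<le> t"
  shows "(\<forall>x. interval_lebesgue_integrable lborel s t
                (\<lambda>u. \<psi>X (x * (LBINT v=u..t. \<sigma> u * hw_G \<beta> u v)))) \<and>
         cond_log_char M (hw_Lambda lam s t) (lam s)
           (\<lambda>x \<omega>. \<i> * complex_of_real x * complex_of_real (hw_M \<alpha> \<beta> s t (lam s \<omega>)) +
                   (LBINT u=s..t. \<psi>X (x * (LBINT v=u..t. \<sigma> u * hw_G \<beta> u v))))"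
proof -
  have "prob_space M" using assms(1) unfolding filtered_prob_space_def by simp
  moreover have "hw_solution M F X \<alpha> \<beta> \<sigma> lam" using assms(7) unfolding hull_white_process_def by simp
  ultimately interpret hull_white M F X \<psi>X \<alpha> \<beta> \<sigma> lam s t
    using assms by (intro hull_white.intro levy.intro levy_axioms.intro hull_white_axioms.intro)
  show ?thesis
    unfolding interval_exponent_kernel(2) using interval_exponent_kernel(1) cond_log_char_Lambda by blast
qed

end
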